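(* Let $\alpha,\beta,\gamma>0$ satisfy $\varkappa=\beta-\frac{\gamma}{\alpha}>0$, and let the kernel $g$ satisfy assumptions (g1), (g2), (g3) listed in the context. Assume in addition that there exist $M_g>0$ and $\omega_g>0$ such that $$g(s)\le M_g\,\mathrm e^{-\omega_g s}\qquad\text{for all } s>0.$$ Then there exist $M\ge1$ and $\omega>0$, both independent of the initial data, such that for every $(u_0,v_0,w_0)\in\mathcal H=H^1\times H^1\times H$ the (unique global) weak solution $u$ of $$\partial_{ttt}u(t)+\alpha\,\partial_{tt}u(t)+\beta A\partial_t u(t)+\gamma Au(t)-\int_0^t g(s)Au(t-s)\,ds=0,\qquad u(0)=u_0,\ \partial_t u(0)=v_0,\ \partial_{tt}u(0)=w_0,$$ has energy $$\mathsf E(t)=\|u(t)\|_1^2+\|\partial_t u(t)\|_1^2+\|\partial_{tt}u(t)\|^2+\int_0^t -g'(s)\|u(t)-u(t-s)\|_1^2\,ds$$ satisfying $\mathsf E(t)\le M\,\mathsf E(0)\,\mathrm e^{-\omega t}$ for every $t\ge0$.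
   Context: $(H,\langle\cdot,\cdot\rangle,\|\cdot\|)$ is a real Hilbert space and $A$ is a strictly positive selfadjoint operator on $H$ with domain $\mathfrak D(A)\subset H$ (so that $\langle Au,u\rangle\ge\lambda\|u\|^2$ for some $\lambda>0$). For $\sigma\ge0$, $H^\sigma=\mathfrak D(A^{\sigma/2})$ with $\langle u,v\rangle_\sigma=\langle A^{\sigma/2}u,A^{\sigma/2}v\rangle$ and $\|u\|_\sigma=\|A^{\sigma/2}u\|$ (index omitted when $\sigma=0$); $H^{-\sigma}$ is the dual of $H^\sigma$, and $\langle\cdot,\cdot\rangle$ also denotes the duality pairing between them. $\mathcal H=H^1\times H^1\times H$ with norm $\|(u,v,w)\|_{\mathcal H}^2=\|u\|_1^2+\|v\|_1^2+\|w\|^2$. Assumptions on the kernel $g:(0,\infty)\to\mathbb R$, not identically zero: (g1) $g$ and its derivative $g'$ are summable on $(0,\infty)$ and absolutely continuous on $(0,\infty)$ (i.e. on every compact subinterval of $(0,\infty)$; $g'$ may be unbounded near $0$), and $\kappa=\int_0^\infty g(s)\,ds<\gamma$. (g2) $g(s)\ge0$ and $g'(s)\le0$ for every $s>0$. (g3) There is $\delta>0$, which may be and is taken with $\delta<\alpha$, such that $(\alpha-\delta)g'(s)-g''(s)\le0$ for a.e. $s>0$. Weak solution on $[0,T]$: a function $u$ such that (i) $(u,\partial_tu,\partial_{tt}u)\in\mathcal C([0,T],\mathcal H)$; (ii) the initial conditions hold; (iii) for every $\zeta\in H^1$ and a.e. $t\in[0,T]$, $$\langle\partial_{ttt}u(t),\zeta\rangle+\alpha\langle\partial_{tt}u(t),\zeta\rangle+\beta\langle\partial_tu(t),\zeta\rangle_1+\gamma\langle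 u(t),\zeta\rangle_1-\int_0^tg(s)\langle u(t-s),\zeta\rangle_1\,ds=0.$$ A global weak solution is a $u$ on $[0,\infty)$ that is a weak solution on $[0,T]$ for every $T>0$; under the assumptions above it exists and is unique. *)

theory Defs
  imports "HOL-Analysis.Analysis"
begin

section \<open>Unbounded operators on a real Hilbert space\<close>

text \<open>
  A possibly unbounded operator is a pair of its domain and a total function, whose values
  outside the domain are irrelevant.
\<close>

type_synonym 'a unb_op = "'a set \<times> ('a \<Rightarrow> 'a)"

abbreviation op_dom :: "'a unb_op \<Rightarrow> 'a set" where
  "op_dom A \<equiv> fst A"

abbreviation op_app :: "'a unb_op \<Rightarrow> 'a \<Rightarrow> 'a" where
  "op_app A \<equiv> snd A"

definition densely_defined_linear :: "'a::real_normed_vector unb_op \<Rightarrow> bool" where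
  "densely_defined_linear A \<longleftrightarrow>
     subspace (op_dom A) \<and> closure (op_dom A) = UNIV \<and>
     (\<forall>x\<in>op_dom A. \<forall>y\<in>op_dom A. op_app A (x + y) = op_app A x + op_app A y) \<and>
     (\<forall>c. \<forall>x\<in>op_dom A. op_app A (c *\<^sub>R x) = c *\<^sub>R op_app A x)"

definition op_graph :: "'a unb_op \<Rightarrow> ('a \<times> 'a) set" where
  "op_graph A = (\<lambda>x. (x, op_app A x)) ` op_dom A"

definition adjoint_graph :: "'a::real_inner unb_op \<Rightarrow> ('a \<times> 'a) set" where
  "adjoint_graph A = {(v, f). \<forall>u\<in>op_dom A. inner (op_app A u) v = inner u f}"

definition selfadjoint :: "'a::real_inner unb_op \<Rightarrow> bool" where
  "selfadjoint A \<longleftrightarrow> densely_defined_linear A \<and> adjoint_graph A = op_graph A"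

definition strictly_positive :: "'a::real_inner unb_op \<Rightarrow> bool" where
  "strictly_positive A \<longleftrightarrow> (\<exists>l>0. \<forall>u\<in>op_dom A. inner (op_app A u) u \<ge> l * (norm u)\<^sup>2)"

definition is_sqrt_op :: "'a::real_inner unb_op \<Rightarrow> 'a unb_op \<Rightarrow> bool" where
  "is_sqrt_op A B \<longleftrightarrow>
     selfadjoint B \<and> (\<forall>u\<in>op_dom B. inner (op_app B u) u \<ge> 0) \<and>
     op_dom A = {u \<in> op_dom B. op_app B u \<in> op_dom B} \<and>
     (\<forall>u\<in>op_dom A. op_app B (op_app B u) = op_app A u)"

text \<open>
  A positive selfadjoint operator on a Hilbert space has exactly one positive selfadjoint
  square root, so the choice below only fixes the irrelevant values outside the domain.
\<close>

definition sqrt_op :: "'a::real_inner unb_op \<Rightarrow> 'a unb_op" where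
  "sqrt_op A = (SOME B. is_sqrt_op A B)"


section \<open>The spaces associated with the operator\<close>

definition H1 :: "'a::real_inner unb_op \<Rightarrow> 'a set" where
  "H1 A = op_dom (sqrt_op A)"

definition inner1 :: "'a::real_inner unb_op \<Rightarrow> 'a \<Rightarrow> 'a \<Rightarrow> real" where
  "inner1 A u v = inner (op_app (sqrt_op A) u) (op_app (sqrt_op A) v)"

definition norm1 :: "'a::real_inner unb_op \<Rightarrow> 'a \<Rightarrow> real" where
  "norm1 A u = norm (op_app (sqrt_op A) u)"

text \<open>
  The dual of \<open>H1 A\<close>: bounded linear functionals on \<open>H1 A\<close>, represented by total functions
  whose values outside \<open>H1 A\<close> are irrelevant. An element \<open>w\<close> of the Hilbert space is identified
  with the functional \<open>inner w\<close>.
\<close>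

definition H1_dual :: "'a::real_inner unb_op \<Rightarrow> ('a \<Rightarrow> real) set" where
  "H1_dual A = {\<phi>.
     (\<forall>x\<in>H1 A. \<forall>y\<in>H1 A. \<phi> (x + y) = \<phi> x + \<phi> y) \<and>
     (\<forall>c. \<forall>x\<in>H1 A. \<phi> (c *\<^sub>R x) = c * \<phi> x) \<and>
     (\<exists>C. \<forall>x\<in>H1 A. \<bar>\<phi> x\<bar> \<le> C * norm1 A x)}"

definition phase_space :: "'a::real_inner unb_op \<Rightarrow> ('a \<times> 'a \<times> 'a) set" where
  "phase_space A = H1 A \<times> H1 A \<times> UNIV"

definition phase_norm :: "'a::real_inner unb_op \<Rightarrow> 'a \<times> 'a \<times> 'a \<Rightarrow> real" where
  "phase_norm A = (\<lambda>(u, v, w). sqrt ((norm1 A u)\<^sup>2 + (norm1 A v)\<^sup>2 + (norm w)\<^sup>2))"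

definition phase_continuous_on ::
    "'a::real_inner unb_op \<Rightarrow> real set \<Rightarrow> (real \<Rightarrow> 'a \<times> 'a \<times> 'a) \<Rightarrow> bool" where
  "phase_continuous_on A S U \<longleftrightarrow>
     (\<forall>t\<in>S. U t \<in> phase_space A) \<and>
     (\<forall>t\<in>S. ((\<lambda>s. phase_norm A (U s - U t)) \<longlongrightarrow> 0) (at t within S))"


section \<open>Assumptions on the memory kernel\<close>

definition abs_cont_on :: "real \<Rightarrow> real \<Rightarrow> (real \<Rightarrow> real) \<Rightarrow> bool" where
  "abs_cont_on a b f \<longleftrightarrow>
     (\<forall>e>0. \<exists>d>0. \<forall>P. finite P \<and> (\<forall>(x, y)\<in>P. a \<le> x \<and> x \<le> y \<and> y \<le> b) \<and>
        disjoint_family_on (\<lambda>(x, y). {x<..<y}) P \<and> (\<Sum>(x, y)\<in>P. y - x) < d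
        \<longrightarrow> (\<Sum>(x, y)\<in>P. \<bar>f y - f x\<bar>) < e)"

text \<open>
  The derivative of the kernel \<open>g\<close> is \<open>deriv g\<close>. It exists at every \<open>s > 0\<close>, because it is
  required to be (absolutely) continuous.
\<close>

definition kernel_g1 :: "real \<Rightarrow> (real \<Rightarrow> real) \<Rightarrow> bool" where
  "kernel_g1 \<gamma> g \<longleftrightarrow>
     (\<forall>s>0. g field_differentiable (at s)) \<and>
     set_integrable lborel {0<..} g \<and> set_integrable lborel {0<..} (deriv g) \<and>
     (\<forall>a b. 0 < a \<and> a \<le> b \<longrightarrow> abs_cont_on a b g \<and> abs_cont_on a b (deriv g)) \<and>
     (LINT s:{0<..}|lborel. g s) < \<gamma>"

definition kernel_g2 :: "(real \<Rightarrow> real) \<Rightarrow> bool" where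
  "kernel_g2 g \<longleftrightarrow> (\<forall>s>0. g s \<ge> 0 \<and> deriv g s \<le> 0)"

text \<open>
  The second derivative exists almost everywhere because \<open>deriv g\<close> is locally absolutely
  continuous; the differentiability clause below only excludes points where
  \<open>deriv (deriv g)\<close> would have no meaning.
\<close>

definition kernel_g3 :: "real \<Rightarrow> (real \<Rightarrow> real) \<Rightarrow> bool" where
  "kernel_g3 \<alpha> g \<longleftrightarrow>
     (\<exists>\<delta>>0. \<delta> < \<alpha> \<and>
        (AE s in lborel. 0 < s \<longrightarrow>
           deriv g field_differentiable (at s) \<and>
           (\<alpha> - \<delta>) * deriv g s - deriv (deriv g) s \<le> 0))"


section \<open>Weak solutions and energy\<close>

text \<open>
  \<open>is_dual_derivative A T w z\<close>: on \<open>[0, T]\<close>, the \<open>H1_dual A\<close>-valued function \<open>z\<close> is the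
  weak time derivative of \<open>w\<close>, expressed by the fundamental theorem of calculus after testing
  with any element of \<open>H1 A\<close>.
\<close>

definition is_dual_derivative ::
    "'a::real_inner unb_op \<Rightarrow> real \<Rightarrow> (real \<Rightarrow> 'a) \<Rightarrow> (real \<Rightarrow> 'a \<Rightarrow> real) \<Rightarrow> bool" where
  "is_dual_derivative A T w z \<longleftrightarrow>
     (\<forall>t\<in>{0..T}. z t \<in> H1_dual A) \<and>
     (\<forall>\<zeta>\<in>H1 A. set_integrable lborel {0..T} (\<lambda>t. z t \<zeta>) \<and>
        (\<forall>t\<in>{0..T}. inner (w t) \<zeta> - inner (w 0) \<zeta> = (LINT s:{0..t}|lborel. z s \<zeta>)))"

text \<open>
  The arguments \<open>v\<close> and \<open>w\<close> of the following two predicates are the first and the second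
  time derivative of \<open>u\<close>; they are determined by \<open>u\<close>. The derivatives are one-sided at the
  end points of the time interval.
\<close>

definition weak_solution_on ::
    "'a::real_inner unb_op \<Rightarrow> real \<Rightarrow> real \<Rightarrow> real \<Rightarrow> (real \<Rightarrow> real) \<Rightarrow> 'a \<times> 'a \<times> 'a \<Rightarrow>
     real \<Rightarrow> (real \<Rightarrow> 'a) \<Rightarrow> (real \<Rightarrow> 'a) \<Rightarrow> (real \<Rightarrow> 'a) \<Rightarrow> bool" where
  "weak_solution_on A \<alpha> \<beta> \<gamma> g U0 T u v w \<longleftrightarrow>
     (\<forall>t\<in>{0..T}. (u has_vector_derivative v t) (at t within {0..T}) \<and>
                  (v has_vector_derivative w t) (at t within {0..T})) \<and>
     phase_continuous_on A {0..T} (\<lambda>t. (u t, v t, w t)) \<and>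
     (u 0, v 0, w 0) = U0 \<and>
     (\<exists>z. is_dual_derivative A T w z \<and>
        (\<forall>\<zeta>\<in>H1 A. AE t in lborel. t \<in> {0..T} \<longrightarrow>
           z t \<zeta> + \<alpha> * inner (w t) \<zeta> + \<beta> * inner1 A (v t) \<zeta> + \<gamma> * inner1 A (u t) \<zeta>
             - (LINT s:{0<..<t}|lborel. g s * inner1 A (u (t - s)) \<zeta>) = 0))"

definition global_weak_solution ::
    "'a::real_inner unb_op \<Rightarrow> real \<Rightarrow> real \<Rightarrow> real \<Rightarrow> (real \<Rightarrow> real) \<Rightarrow> 'a \<times> 'a \<times> 'a \<Rightarrow>
     (real \<Rightarrow> 'a) \<Rightarrow> (real \<Rightarrow> 'a) \<Rightarrow> (real \<Rightarrow> 'a) \<Rightarrow> bool" where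
  "global_weak_solution A \<alpha> \<beta> \<gamma> g U0 u v w \<longleftrightarrow>
     (\<forall>T>0. weak_solution_on A \<alpha> \<beta> \<gamma> g U0 T u v w)"

definition energy ::
    "'a::real_inner unb_op \<Rightarrow> (real \<Rightarrow> real) \<Rightarrow>
     (real \<Rightarrow> 'a) \<Rightarrow> (real \<Rightarrow> 'a) \<Rightarrow> (real \<Rightarrow> 'a) \<Rightarrow> real \<Rightarrow> real" where
  "energy A g u v w t =
     (norm1 A (u t))\<^sup>2 + (norm1 A (v t))\<^sup>2 + (norm (w t))\<^sup>2
     + (LINT s:{0<..<t}|lborel. - deriv g s * (norm1 A (u t - u (t - s)))\<^sup>2)"

end

theory Submission
  imports Defs "HOL-Computational_Algebra.Formal_Power_Series"
begin

text \<open>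
  Write \<open>v\<close>, \<open>w\<close> for the first two time derivatives of \<open>u\<close>. For regular solutions, testing the equation with \<open>w + \<alpha> v\<close> gives a functional
  \<open>\<Phi>\<close> with \<open>\<Phi>' \<le> - (\<alpha> \<beta> - \<gamma>) \<parallel>v\<parallel>\<^sub>1\<^sup>2 - (\<delta> / 2) \<integral> - g' \<parallel>u(t) - u(t - s)\<parallel>\<^sub>1\<^sup>2\<close> that controls the energy
  from above only up to \<open>\<integral> g(s) \<parallel>u(t - s)\<parallel>\<^sub>1\<^sup>2\<close>. The exponential bound on \<open>g\<close> allows one
  to add a small multiple of \<open>\<Psi>(t) = \<integral> e\<^bsup>-\<omega>s\<^esup> \<parallel>u(t - s)\<parallel>\<^sub>1\<^sup>2\<close>, for which
  \<open>\<Psi>' = \<parallel>u\<parallel>\<^sub>1\<^sup>2 - \<omega> \<Psi>\<close>; together with the multipliers \<open>u\<close> (which dissipates \<open>\<parallel>u\<parallel>\<^sub>1\<^sup>2\<close>)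
  and \<open>- v\<close> (which dissipates \<open>\<parallel>w\<parallel>\<^sup>2\<close>) one gets \<open>\<Lambda>' \<le> - \<eta> \<Lambda>\<close>.
  Weak solutions are regularised in space by the resolvent \<open>(I + \<epsilon> A)\<^sup>-\<^sup>1\<close>, which commutes with
  \<open>A\<^sup>1\<^sup>/\<^sup>2\<close>, and the estimate passes to the limit \<open>\<epsilon> \<rightarrow> 0\<close>.
\<close>

section \<open>Selfadjoint operators and square roots\<close>

text \<open>Two obstacles shape the proof. (g3) only limits the relative growth of - g' to the rate
  \<alpha> - \<delta>; it yields no bound of g by a multiple of - g', so the memory part of the
  energy does not control the history integral weighted by g. The term added to absorb that integral
  has its own decay, and it vanishes at t = 0, so that the final bound involves E(0) alone. The
  growth of - g' costs (\<alpha> - \<delta>)/2 times the memory term, the multiplier \<alpha> v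
  gains \<alpha>/2 times it, and \<delta>/2 survives. For a weak solution the derivative of w lies
  only in the dual of H^1 and A^(1/2) w need not exist, so w is not an admissible test function.
  Behind the resolvent every operator in the equation is bounded, and the constants depend on A only
  through its coercivity bound \<open>l\<close>, hence not on \<epsilon>.\<close>

lemma exists_nonzero_orthogonal:
  fixes S :: "'a::{real_inner,complete_space} set"
  assumes S: "subspace S" "closed S" "x \<notin> S"
  shows "\<exists>z. z \<noteq> 0 \<and> (\<forall>y\<in>S. inner y z = 0)"
proof -
  have ne: "S \<noteq> {}" using S(1) subspace_0 by blast
  define d where "d = infdist x S"
  have d_le: "d \<le> norm (x - y)" if "y \<in> S" for y
    using infdist_le[OF that] unfolding d_def dist_norm .
  have d0: "0 \<le> d" unfolding d_def by (rule infdist_nonneg)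
  have "\<exists>y\<in>S. (norm (x - y))\<^sup>2 < d\<^sup>2 + 1 / Suc n" for n
  proof -
    have "d < sqrt (d\<^sup>2 + 1 / Suc n)"
      by (rule real_less_rsqrt) simp
    then have "Inf (dist x ` S) < sqrt (d\<^sup>2 + 1 / Suc n)"
      using ne by (simp add: d_def infdist_def)
    then have "\<exists>y\<in>S. dist x y < sqrt (d\<^sup>2 + 1 / Suc n)"
      using cInf_lessD[of "dist x ` S"] ne by blast
    then obtain y where y: "y \<in> S" "norm (x - y) < sqrt (d\<^sup>2 + 1 / Suc n)"
      unfolding dist_norm by blast
    have "(norm (x - y))\<^sup>2 < (sqrt (d\<^sup>2 + 1 / Suc n))\<^sup>2"
      using y(2) by (intro power_strict_mono) auto
    then show ?thesis using y(1) by (auto intro!: bexI[of _ y])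
  qed
  then obtain y where yS: "\<And>n. y n \<in> S" and y: "\<And>n. (norm (x - y n))\<^sup>2 < d\<^sup>2 + 1 / Suc n"
    by metis
  have par: "(norm (y m - y n))\<^sup>2 \<le> 2 * (1 / Suc m) + 2 * (1 / Suc n)" for m n
  proof -
    \<comment> \<open>Midpoints of the minimising sequence stay in \<open>S\<close>, so their
      distance from \<open>x\<close> is at least \<open>d\<close>; the parallelogram law then forces
      \<open>y m - y n\<close> to be small.\<close>
    have mid: "(1/2) *\<^sub>R (y m + y n) \<in> S"
      using yS S(1) by (simp add: subspace_add subspace_scale)
    have "d\<^sup>2 \<le> (norm (x - (1/2) *\<^sub>R (y m + y n)))\<^sup>2"
      using d_le[OF mid] d0 by (rule power_mono)
    moreover have "(norm (y m - y n))\<^sup>2 + 4 * (norm (x - (1/2) *\<^sub>R (y m + y n)))\<^sup>2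
        = 2 * (norm (x - y m))\<^sup>2 + 2 * (norm (x - y n))\<^sup>2"
      unfolding power2_norm_eq_inner
      by (simp add: inner_diff_left inner_diff_right inner_add_left inner_add_right inner_commute algebra_simps)
    ultimately show ?thesis using y[of m] y[of n] by linarith
  qed
  have "Cauchy y"
  proof (rule metric_CauchyI)
    fix e :: real assume "e > 0"
    then obtain N where N: "4 / e\<^sup>2 < real N" using reals_Archimedean2 by blast
    show "\<exists>M. \<forall>m\<ge>M. \<forall>n\<ge>M. dist (y m) (y n) < e"
    proof (intro exI allI impI)
      fix m n assume mn: "N \<le> m" "N \<le> n"
      have N0: "0 < real N" by (rule less_trans[OF _ N]) (use \<open>e > 0\<close> in simp)
      have "1 / real (Suc m) < 1 / real N" "1 / real (Suc n) < 1 / real N"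
        using mn N0 by (auto intro!: divide_strict_left_mono)
      then have "(norm (y m - y n))\<^sup>2 < 4 / real N" using par[of m n] by argo
      also have "\<dots> < e\<^sup>2" using N N0 \<open>e > 0\<close> by (simp add: field_simps)
      finally show "dist (y m) (y n) < e" using \<open>e > 0\<close>
        by (simp add: dist_norm power_less_imp_less_base)
    qed
  qed
  then obtain p where p: "y \<longlonglongrightarrow> p" using Cauchy_convergent convergent_def by blast
  have pS: "p \<in> S" using S(2) yS p closed_sequentially by blast
  have "(\<lambda>n. (norm (x - y n))\<^sup>2) \<longlonglongrightarrow> (norm (x - p))\<^sup>2" by (intro tendsto_intros p)
  moreover have "(\<lambda>n. d\<^sup>2 + 1 / Suc n) \<longlonglongrightarrow> d\<^sup>2 + 0"
    by (intro tendsto_intros LIMSEQ_inverse_real_of_nat[unfolded inverse_eq_divide])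
  ultimately have xp: "(norm (x - p))\<^sup>2 \<le> d\<^sup>2"
    using y by (intro LIMSEQ_le[of _ "(norm (x - p))\<^sup>2" _ "d\<^sup>2"]) (auto intro: less_imp_le)
  have "inner s (x - p) = 0" if s: "s \<in> S" for s
  proof (cases "s = 0")
    case False
    \<comment> \<open>The parameter that minimises |x - p - t s|^2; minimality of \<open>p\<close>
      leaves no component of \<open>x - p\<close> along \<open>s\<close>.\<close>
    define t where "t = inner s (x - p) / inner s s"
    have "p + t *\<^sub>R s \<in> S" using pS s S(1) by (simp add: subspace_add subspace_scale)
    then have "d\<^sup>2 \<le> (norm (x - (p + t *\<^sub>R s)))\<^sup>2" using d_le d0 by (intro power_mono) auto
    also have "\<dots> = (norm (x - p))\<^sup>2 - 2 * t * inner s (x - p) + t\<^sup>2 * inner s s"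
      unfolding power2_norm_eq_inner power2_eq_square[of t]
      by (simp add: inner_diff_left inner_diff_right inner_add_left inner_add_right inner_commute algebra_simps)
    also have "\<dots> = (norm (x - p))\<^sup>2 - (inner s (x - p))\<^sup>2 / inner s s"
      using False by (simp add: t_def field_simps power2_eq_square)
    finally have "(inner s (x - p))\<^sup>2 / inner s s \<le> 0" using xp by linarith
    moreover have "0 < inner s s" using False by simp
    ultimately show ?thesis using divide_pos_pos[of "(inner s (x - p))\<^sup>2" "inner s s"] by fastforce
  qed simp
  moreover have "x - p \<noteq> 0" using pS S(3) by auto
  ultimately show ?thesis by blast
qed

lemma riesz_representation:
  fixes \<phi> :: "'a::{real_inner,complete_space} \<Rightarrow> real"
  assumes "bounded_linear \<phi>"
  shows "\<exists>f. \<forall>x. \<phi> x = inner x f"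
proof (cases "\<forall>x. \<phi> x = 0")
  case True
  then show ?thesis by (intro exI[of _ 0]) simp
next
  case False
  then obtain x0 where x0: "\<phi> x0 \<noteq> 0" by blast
  interpret bounded_linear \<phi> by fact
  let ?S = "{x. \<phi> x = 0}"
  have "subspace ?S" by (auto simp: subspace_def add scaleR zero)
  moreover have "closed ?S"
    by (intro closed_Collect_eq continuous_intros continuous_on linear_continuous_on assms)
  moreover have "x0 \<notin> ?S" using x0 by simp
  ultimately obtain z where z: "z \<noteq> 0" "\<And>y. \<phi> y = 0 \<Longrightarrow> inner y z = 0"
    using exists_nonzero_orthogonal by blast
  have phiz: "\<phi> z \<noteq> 0" using z(2)[of z] z(1) by auto
  have "\<phi> x = inner x ((\<phi> z / inner z z) *\<^sub>R z)" for x
  proof -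
    have "\<phi> (x - (\<phi> x / \<phi> z) *\<^sub>R z) = 0" using phiz by (simp add: diff scaleR)
    from z(2)[OF this] have "inner x z = \<phi> x / \<phi> z * inner z z" by (simp add: inner_diff_left)
    then show ?thesis using phiz z(1) by (simp add: field_simps)
  qed
  then show ?thesis by blast
qed

section \<open>Elementary properties of selfadjoint operators\<close>

lemma op_linear:
  assumes "selfadjoint A"
  shows "subspace (op_dom A)"
    and "x \<in> op_dom A \<Longrightarrow> y \<in> op_dom A \<Longrightarrow> op_app A (x + y) = op_app A x + op_app A y"
    and "x \<in> op_dom A \<Longrightarrow> op_app A (c *\<^sub>R x) = c *\<^sub>R op_app A x"
    and "x \<in> op_dom A \<Longrightarrow> y \<in> op_dom A \<Longrightarrow> op_app A (x - y) = op_app A x - op_app A y"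
    and "op_app A 0 = 0"
proof -
  show sub: "subspace (op_dom A)"
    and add: "\<And>x y. x \<in> op_dom A \<Longrightarrow> y \<in> op_dom A \<Longrightarrow> op_app A (x + y) = op_app A x + op_app A y"
    and sc: "\<And>x c. x \<in> op_dom A \<Longrightarrow> op_app A (c *\<^sub>R x) = c *\<^sub>R op_app A x"
    using assms by (auto simp: selfadjoint_def densely_defined_linear_def)
  show "op_app A (x - y) = op_app A x - op_app A y" if "x \<in> op_dom A" "y \<in> op_dom A" for x y
    using add[OF that(1), of "(-1) *\<^sub>R y"] sc[OF that(2), of "-1"] subspace_scale[OF sub that(2), of "-1"]
    by simp
  show "op_app A 0 = 0" using sc[OF subspace_0[OF sub], of 0] by simp
qed

lemma selfadjoint_inner:
  assumes "selfadjoint A" "x \<in> op_dom A" "y \<in> op_dom A"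
  shows "inner (op_app A x) y = inner x (op_app A y)"
proof -
  have "(y, op_app A y) \<in> adjoint_graph A"
    using assms by (auto simp: selfadjoint_def op_graph_def)
  then show ?thesis using assms(2) by (auto simp: adjoint_graph_def)
qed

text \<open>The maximality half of selfadjointness, adjoint graph contained in graph: it turns a
  weak identity into membership in the domain.\<close>

lemma selfadjointD:
  assumes "selfadjoint A" "\<And>x. x \<in> op_dom A \<Longrightarrow> inner (op_app A x) v = inner x f"
  shows "v \<in> op_dom A" "op_app A v = f"
proof -
  have "(v, f) \<in> op_graph A"
    using assms by (auto simp: selfadjoint_def adjoint_graph_def set_eq_iff)
  then show "v \<in> op_dom A" "op_app A v = f" by (auto simp: op_graph_def)
qed

lemma selfadjoint_closed:
  assumes "selfadjoint A" "\<And>n. x n \<in> op_dom A" "x \<longlonglongrightarrow> a" "(\<lambda>n. op_app A (x n)) \<longlonglongrightarrow> b"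
  shows "a \<in> op_dom A" "op_app A a = b"
proof -
  have "inner (op_app A u) a = inner u b" if "u \<in> op_dom A" for u
  proof (rule LIMSEQ_unique)
    show "(\<lambda>n. inner (op_app A u) (x n)) \<longlonglongrightarrow> inner (op_app A u) a" by (intro tendsto_intros assms)
    show "(\<lambda>n. inner (op_app A u) (x n)) \<longlonglongrightarrow> inner u b"
      unfolding selfadjoint_inner[OF assms(1) that assms(2)] by (intro tendsto_intros assms)
  qed
  from selfadjointD[OF assms(1) this] show "a \<in> op_dom A" "op_app A a = b" by auto
qed

text \<open>Coercivity bounds the operator from below, so its range is closed because its graph is.
  A vector orthogonal to the range lies in the domain by \<open>selfadjointD\<close> and is
  annihilated by the operator, hence is zero.\<close>

lemma selfadjoint_coercive_surj:
  fixes A :: "'a::{real_inner,complete_space} unb_op"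
  assumes A: "selfadjoint A" and l: "l > 0"
    and pos: "\<And>u. u \<in> op_dom A \<Longrightarrow> l * (norm u)\<^sup>2 \<le> inner (op_app A u) u"
  shows "\<exists>x\<in>op_dom A. op_app A x = y"
proof (rule ccontr)
  note lin = op_linear[OF A]
  have lower: "l * norm u \<le> norm (op_app A u)" if "u \<in> op_dom A" for u
  proof (cases "u = 0")
    case False
    have "l * norm u * norm u \<le> norm (op_app A u) * norm u"
      using pos[OF that] norm_cauchy_schwarz[of "op_app A u" u] by (simp add: power2_eq_square)
    then show ?thesis using False by simp
  qed simp
  define Ran where "Ran = op_app A ` op_dom A"
  have "subspace Ran" unfolding Ran_def subspace_def
  proof (intro conjI ballI allI)
    show "0 \<in> op_app A ` op_dom A" using lin(5) subspace_0[OF lin(1)] by (metis imageI)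
    fix a b assume "a \<in> op_app A ` op_dom A" "b \<in> op_app A ` op_dom A"
    then show "a + b \<in> op_app A ` op_dom A"
      using lin(2) subspace_add[OF lin(1)] by (auto simp: image_iff) metis
  next
    fix c a assume "a \<in> op_app A ` op_dom A"
    then show "c *\<^sub>R a \<in> op_app A ` op_dom A"
      using lin(3) subspace_scale[OF lin(1)] by (auto simp: image_iff) metis
  qed
  moreover have "closed Ran" unfolding closed_sequential_limits
  proof (intro allI impI)
    fix f b assume "(\<forall>n. f n \<in> Ran) \<and> f \<longlonglongrightarrow> b"
    then have fb: "f \<longlonglongrightarrow> b" and "\<forall>n. \<exists>x\<in>op_dom A. f n = op_app A x" by (auto simp: Ran_def)
    then obtain x where x: "\<And>n. x n \<in> op_dom A" "\<And>n. f n = op_app A (x n)" by metis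
    have "Cauchy x"
    proof (rule metric_CauchyI)
      fix e :: real assume "e > 0"
      then obtain M where M: "\<forall>m\<ge>M. \<forall>n\<ge>M. dist (f m) (f n) < l * e"
        using LIMSEQ_imp_Cauchy[OF fb] l metric_CauchyD[of f "l * e"] by auto
      have "dist (x m) (x n) < e" if "m \<ge> M" "n \<ge> M" for m n
      proof -
        have "l * norm (x m - x n) \<le> norm (f m - f n)"
          using lower[OF subspace_diff[OF lin(1) x(1) x(1)]] lin(4)[OF x(1) x(1)] x(2) by simp
        also have "\<dots> < l * e" using M that by (auto simp: dist_norm)
        finally show ?thesis using l by (simp add: dist_norm)
      qed
      then show "\<exists>M. \<forall>m\<ge>M. \<forall>n\<ge>M. dist (x m) (x n) < e" by blast
    qed
    then obtain a where "x \<longlonglongrightarrow> a" using Cauchy_convergent convergent_def by blast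
    moreover have "(\<lambda>n. op_app A (x n)) = f" by (rule ext) (rule x(2)[symmetric])
    ultimately have "a \<in> op_dom A" "op_app A a = b"
      using selfadjoint_closed[where x = x and a = a and b = b, OF A x(1)] fb by simp_all
    then show "b \<in> Ran" by (auto simp: Ran_def)
  qed
  moreover assume "\<not> ?thesis"
  then have "y \<notin> Ran" by (auto simp: Ran_def)
  ultimately obtain z where z: "z \<noteq> 0" "\<forall>y\<in>Ran. inner y z = 0"
    using exists_nonzero_orthogonal by blast
  have "inner (op_app A u) z = inner u 0" if "u \<in> op_dom A" for u
    using z(2) that by (simp add: Ran_def)
  from selfadjointD[OF A this] have "z \<in> op_dom A" "op_app A z = 0" by auto
  then show False using lower[of z] z(1) l by (simp add: mult_le_0_iff)
qed

section \<open>The binomial series and square roots of bounded operators\<close>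

text \<open>The Taylor coefficients of sqrt(1 - x) at 0.\<close>

definition sqrt_coeff :: "nat \<Rightarrow> real" where
  "sqrt_coeff n = (- 1) ^ n * ((1/2) gchoose n)"

lemma sqrt_coeff_0: "sqrt_coeff 0 = 1"
  by (simp add: sqrt_coeff_def)

text \<open>These are the Taylor coefficients of 1/sqrt(1 - x), which are also the partial sums of
  \<open>sqrt_coeff\<close>; consecutive ones have ratio (n + 1/2)/(n + 1).\<close>

lemma neg_half_gchoose_nonneg: "0 \<le> (- 1) ^ n * ((- 1/2 :: real) gchoose n)"
proof (induction n)
  case (Suc n)
  have "(Suc n) * ((- 1/2 :: real) gchoose Suc n) = (- 1/2 - n) * ((- 1/2) gchoose n)"
    using gbinomial_mult_1[of "- 1/2 :: real" n] by (simp add: algebra_simps)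
  then have "(Suc n) * ((- 1) ^ Suc n * ((- 1/2 :: real) gchoose Suc n))
      = (1/2 + n) * ((- 1) ^ n * ((- 1/2) gchoose n))"
    by (simp add: mult.left_commute[of "real (Suc n)"] del: of_nat_Suc) (simp add: algebra_simps)
  also have "\<dots> \<ge> 0" using Suc.IH by simp
  finally show ?case
    by (metis mult_le_cancel_left_pos mult_zero_right of_nat_0_less_iff zero_less_Suc)
qed simp

lemma sqrt_coeff_Suc_nonpos: "sqrt_coeff (Suc n) \<le> 0"
proof -
  have "sqrt_coeff (Suc n) = - ((1/2) / (Suc n) * ((- 1) ^ n * ((- 1/2) gchoose n)))"
    using gbinomial_absorption[of n "1/2 :: real"] by (simp add: sqrt_coeff_def field_simps)
  then show ?thesis using neg_half_gchoose_nonneg[of n] by simp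
qed

text \<open>Only the coefficient at 0 is positive, so the sum of the absolute values is 2 minus the
  plain partial sum, and the latter is a coefficient of 1/sqrt(1 - x), hence nonnegative.\<close>

lemma sqrt_coeff_abs_sum_le: "(\<Sum>k\<le>n. \<bar>sqrt_coeff k\<bar>) \<le> 2"
proof -
  have "\<bar>sqrt_coeff k\<bar> = (if k = 0 then 2 else 0) - sqrt_coeff k" for k
    using sqrt_coeff_Suc_nonpos[of "k - 1"] by (cases k) (auto simp: sqrt_coeff_0 abs_if)
  then have "(\<Sum>k\<le>n. \<bar>sqrt_coeff k\<bar>) = 2 - (\<Sum>k\<le>n. sqrt_coeff k)"
    by (simp add: sum_subtractf)
  moreover have "(\<Sum>k\<le>n. sqrt_coeff k) = (- 1) ^ n * ((- 1/2) gchoose n)"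
    using gbinomial_sum_lower_neg[of "1/2 :: real" n] by (simp add: sqrt_coeff_def mult.commute)
  ultimately show ?thesis using neg_half_gchoose_nonneg[of n] by simp
qed

lemma sqrt_coeff_summable: "summable (\<lambda>n. \<bar>sqrt_coeff n\<bar>)"
  and sqrt_coeff_suminf_le: "(\<Sum>n. \<bar>sqrt_coeff n\<bar>) \<le> 2"
proof -
  have le: "(\<Sum>k<n. \<bar>sqrt_coeff k\<bar>) \<le> 2" for n
    using sqrt_coeff_abs_sum_le[of "n - 1"] by (cases n) (simp_all add: lessThan_Suc_atMost)
  show sm: "summable (\<lambda>n. \<bar>sqrt_coeff n\<bar>)"
    by (rule summableI_nonneg_bounded[OF _ le]) simp
  show "(\<Sum>n. \<bar>sqrt_coeff n\<bar>) \<le> 2" using sm le by (rule suminf_le_const)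
qed

text \<open>Vandermonde's identity for 1/2 + 1/2 = 1: the square of the series is 1 - x.\<close>

lemma sqrt_coeff_convolution:
  "(\<Sum>i\<le>k. sqrt_coeff i * sqrt_coeff (k - i)) = (if k = 0 then 1 else if k = 1 then - 1 else 0)"
proof -
  have "(\<Sum>i\<le>k. sqrt_coeff i * sqrt_coeff (k - i))
      = (\<Sum>i\<le>k. (- 1) ^ k * (((1/2) gchoose i) * ((1/2) gchoose (k - i))))"
  proof (rule sum.cong[OF refl])
    fix i assume "i \<in> {..k}"
    then have "(- 1 :: real) ^ k = (- 1) ^ i * (- 1) ^ (k - i)" by (simp flip: power_add)
    then show "sqrt_coeff i * sqrt_coeff (k - i)
        = (- 1) ^ k * (((1/2) gchoose i) * ((1/2) gchoose (k - i)))"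
      by (simp add: sqrt_coeff_def)
  qed
  also have "\<dots> = (- 1) ^ k * ((1 :: real) gchoose k)"
    using gbinomial_Vandermonde[of "1/2 :: real" "1/2" k]
    by (simp add: atLeast0AtMost flip: sum_distrib_left)
  also have "(1 :: real) gchoose k = real (1 choose k)"
    using binomial_gbinomial[of 1 k, where ?'a = real] by simp
  also have "(- 1) ^ k * real (1 choose k) = (if k = 0 then 1 else if k = 1 then - 1 else 0)"
    by (cases k; cases "k - 1") (auto simp: binomial_eq_0)
  finally show ?thesis .
qed

text \<open>The square root of \<open>I - X\<close> is given by the binomial series, which converges absolutely on
  the whole closed unit ball.\<close>

lemma contraction_sqrt_exists:
  fixes X :: "'a::{real_inner,complete_space} \<Rightarrow> 'a"
  assumes lin: "linear X" and sym: "\<And>x y. inner (X x) y = inner x (X y)"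
    and contr: "\<And>x. norm (X x) \<le> norm x"
  shows "\<exists>S. bounded_linear S \<and> (\<forall>x y. inner (S x) y = inner x (S y)) \<and>
           (\<forall>x. inner (S x) x \<ge> 0) \<and> (\<forall>x. S (S x) = x - X x)"
proof -
  let ?c = sqrt_coeff
  have Xn: "linear (X ^^ n) \<and> norm ((X ^^ n) x) \<le> norm x \<and> inner ((X ^^ n) x) y = inner x ((X ^^ n) y)"
    for n x y
  proof (induction n arbitrary: x y)
    case 0 then show ?case by (simp add: linear_iff)
  next
    case (Suc n)
    have "linear (X ^^ Suc n)" using linear_compose[of "X ^^ n" X] Suc lin by simp
    moreover have "norm ((X ^^ Suc n) x) \<le> norm x"
      using order_trans[OF contr[of "(X ^^ n) x"]] Suc[of x x] by simp
    moreover have "inner ((X ^^ Suc n) x) y = inner x ((X ^^ Suc n) y)"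
      using Suc[of x "X y"] sym[of "(X ^^ n) x" y] by (simp add: funpow_swap1)
    ultimately show ?case by blast
  qed
  then have Xlin: "linear (X ^^ n)" for n by blast
  have ip_le: "\<bar>inner ((X ^^ n) x) y\<bar> \<le> norm x * norm y" for n x y
    using Cauchy_Schwarz_ineq2[of "(X ^^ n) x" y] Xn[of n x] mult_right_mono norm_ge_zero order_trans
    by metis
  have nle: "\<bar>?c n * inner ((X ^^ n) x) y\<bar> \<le> \<bar>?c n\<bar> * (norm x * norm y)" for n x y
    using ip_le by (simp add: abs_mult mult_left_mono)
  have asm: "summable (\<lambda>n. \<bar>?c n * inner ((X ^^ n) x) y\<bar>)" for x y
    by (rule summable_comparison_test'[OF summable_mult2[OF sqrt_coeff_summable, of "norm x * norm y"]])
       (use nle in auto)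
  have sm: "summable (\<lambda>n. ?c n * inner ((X ^^ n) x) y)" for x y
    using asm by (rule summable_rabs_cancel)
  have sum_le: "\<bar>\<Sum>n. ?c n * inner ((X ^^ n) x) y\<bar> \<le> 2 * (norm x * norm y)" for x y
  proof -
    have "\<bar>\<Sum>n. ?c n * inner ((X ^^ n) x) y\<bar> \<le> (\<Sum>n. \<bar>?c n * inner ((X ^^ n) x) y\<bar>)"
      by (rule summable_rabs[OF asm])
    also have "\<dots> \<le> (\<Sum>n. \<bar>?c n\<bar> * (norm x * norm y))"
      by (rule suminf_le[OF nle asm summable_mult2[OF sqrt_coeff_summable]])
    also have "\<dots> = (\<Sum>n. \<bar>?c n\<bar>) * (norm x * norm y)"
      by (rule suminf_mult2[symmetric, OF sqrt_coeff_summable])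
    also have "\<dots> \<le> 2 * (norm x * norm y)" by (intro mult_right_mono sqrt_coeff_suminf_le) simp
    finally show ?thesis .
  qed
  \<comment> \<open>The operator series is summed weakly: for each \<open>x\<close> the scalar
    series is a bounded functional of \<open>y\<close>, whose Riesz representative is taken as
    \<open>S x\<close>.\<close>
  have "\<exists>f. \<forall>y. (\<Sum>n. ?c n * inner ((X ^^ n) x) y) = inner y f" for x
  proof (rule riesz_representation, rule bounded_linear_intro[where K = "2 * norm x"])
    show "(\<Sum>n. ?c n * inner ((X ^^ n) x) (y + z))
        = (\<Sum>n. ?c n * inner ((X ^^ n) x) y) + (\<Sum>n. ?c n * inner ((X ^^ n) x) z)" for y z
      by (simp add: inner_add_right distrib_left suminf_add[OF sm sm])
    show "(\<Sum>n. ?c n * inner ((X ^^ n) x) (r *\<^sub>R y)) = r *\<^sub>R (\<Sum>n. ?c n * inner ((X ^^ n) x) y)" for r y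
      using suminf_mult[OF sm[of x y], of r] by (simp add: mult_ac)
    show "norm (\<Sum>n. ?c n * inner ((X ^^ n) x) y) \<le> norm y * (2 * norm x)" for y
      using sum_le[of x y] by (simp add: mult_ac)
  qed
  then obtain S where S: "\<And>x y. (\<Sum>n. ?c n * inner ((X ^^ n) x) y) = inner (S x) y"
    by (metis inner_commute)
  have S_inner: "((\<lambda>n. ?c n * inner ((X ^^ n) x) y) has_sum inner (S x) y) UNIV" for x y
    by (rule norm_summable_imp_has_sum) (use asm sm S in \<open>auto simp flip: S intro: summable_sums\<close>)
  have S_eqI: "S x = z" if "\<And>y. (\<Sum>n. ?c n * inner ((X ^^ n) x) y) = inner z y" for x z
    using that vector_eq_rdot[of "S x" z] unfolding S by blast
  have S_add: "S (x + y) = S x + S y" for x y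
    by (rule S_eqI)
       (simp add: linear_add[OF Xlin] inner_add_left distrib_left suminf_add[OF sm sm, symmetric] flip: S)
  have S_scale: "S (r *\<^sub>R x) = r *\<^sub>R S x" for r x
    by (rule S_eqI)
       (simp add: linear_scale[OF Xlin] suminf_mult[OF sm, symmetric] mult_ac flip: S)
  have S_norm: "norm (S x) \<le> norm x * 2" for x
  proof (cases "S x = 0")
    case False
    have "norm (S x) * norm (S x) \<le> (norm x * 2) * norm (S x)"
      using sum_le[of x "S x"] unfolding S by (simp add: dot_square_norm power2_eq_square mult_ac)
    then show ?thesis using False by simp
  qed simp
  have "bounded_linear S" by (rule bounded_linear_intro[OF S_add S_scale S_norm])
  moreover have S_sym: "inner (S x) y = inner x (S y)" for x y
  proof -
    have "((\<lambda>n. ?c n * inner ((X ^^ n) x) y) has_sum inner (S y) x) UNIV"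
      using S_inner[of y x] Xn by (simp add: inner_commute)
    then show ?thesis using has_sum_unique[OF S_inner[of x y]] by (simp add: inner_commute)
  qed
  moreover have "inner (S x) x \<ge> 0" for x
  proof -
    have s1: "(\<lambda>n. ?c n * inner ((X ^^ n) x) x) sums inner (S x) x"
      by (rule has_sum_imp_sums[OF S_inner])
    have s2: "(\<lambda>n. (if n = 0 then 2 * (norm x)\<^sup>2 else 0) - \<bar>?c n\<bar> * (norm x)\<^sup>2) sums
        (2 * (norm x)\<^sup>2 - (\<Sum>n. \<bar>?c n\<bar>) * (norm x)\<^sup>2)"
      by (intro sums_diff sums_mult2 summable_sums sqrt_coeff_summable)
         (use sums_single[of 0 "\<lambda>_. 2 * (norm x)\<^sup>2"] in simp)
    \<comment> \<open>At n = 0 both sides equal |x|^2; for n > 0 the left side is - |c n| |x|^2. The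
      comparison series sums to (2 - sum of |c n|) |x|^2, which is nonnegative.\<close>
    have s3: "(if n = 0 then 2 * (norm x)\<^sup>2 else 0) - \<bar>?c n\<bar> * (norm x)\<^sup>2
        \<le> ?c n * inner ((X ^^ n) x) x" for n
    proof (cases "n = 0")
      case True then show ?thesis by (simp add: sqrt_coeff_0 power2_norm_eq_inner)
    next
      case False
      have "\<bar>?c n * inner ((X ^^ n) x) x\<bar> \<le> \<bar>?c n\<bar> * (norm x)\<^sup>2"
        using nle[of n x x] by (simp add: power2_eq_square)
      then show ?thesis using False by simp
    qed
    have "2 * (norm x)\<^sup>2 - (\<Sum>n. \<bar>?c n\<bar>) * (norm x)\<^sup>2 \<le> inner (S x) x"
      by (rule sums_le[OF s3 s2 s1])
    moreover have "(\<Sum>n. \<bar>?c n\<bar>) * (norm x)\<^sup>2 \<le> 2 * (norm x)\<^sup>2"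
      by (intro mult_right_mono sqrt_coeff_suminf_le) simp
    ultimately show ?thesis by linarith
  qed
  moreover have "S (S x) = x - X x" for x
  proof -
    have "inner (S (S x)) y = inner (x - X x) y" for y
    proof -
      define d where "d k = inner ((X ^^ k) x) y" for k
      define f where "f = (\<lambda>(m, n). ?c m * ?c n * d (m + n))"
      have d_le: "\<bar>d k\<bar> \<le> norm x * norm y" for k
        unfolding d_def by (rule ip_le)
      have inner1: "((\<lambda>n. f (m, n)) has_sum (?c m * inner ((X ^^ m) x) (S y))) UNIV" for m
      proof -
        have "((\<lambda>n. ?c m * (?c n * inner ((X ^^ n) ((X ^^ m) x)) y)) has_sum
            (?c m * inner (S ((X ^^ m) x)) y)) UNIV"
          by (intro has_sum_cmult_right S_inner)
        moreover have "(X ^^ (m + n)) x = (X ^^ n) ((X ^^ m) x)" for n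
          by (metis add.commute comp_apply funpow_add)
        ultimately show ?thesis by (simp add: f_def d_def S_sym mult.assoc)
      qed
      have outer: "((\<lambda>m. ?c m * inner ((X ^^ m) x) (S y)) has_sum inner (S x) (S y)) UNIV"
        by (rule S_inner)
      have cs: "((\<lambda>n. \<bar>?c n\<bar>) has_sum (\<Sum>n. \<bar>?c n\<bar>)) UNIV"
        using norm_summable_imp_has_sum[of "\<lambda>n. \<bar>?c n\<bar>"] sqrt_coeff_summable
        by (simp add: summable_sums)
      have fs0: "(\<lambda>(m, n). \<bar>?c m\<bar> * (\<bar>?c n\<bar> * (norm x * norm y))) summable_on UNIV \<times> UNIV"
        by (rule summable_on_SigmaI[where g = "\<lambda>m. \<bar>?c m\<bar> * ((\<Sum>n. \<bar>?c n\<bar>) * (norm x * norm y))"])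
           (auto intro!: has_sum_cmult_right has_sum_cmult_left cs
             summable_on_cmult_left has_sum_imp_summable[OF cs])
      have "(\<lambda>z. norm (f z)) summable_on UNIV \<times> UNIV"
      proof (rule Infinite_Sum.abs_summable_on_comparison_test'[OF fs0], clarify)
        fix m n
        show "norm (f (m, n)) \<le> \<bar>?c m\<bar> * (\<bar>?c n\<bar> * (norm x * norm y))"
          using d_le[of "m + n"] by (simp add: f_def abs_mult mult.assoc mult_left_mono)
      qed
      then have fs: "f summable_on UNIV \<times> UNIV" by (rule abs_summable_summable)
      have f1: "(f has_sum inner (S x) (S y)) (UNIV \<times> UNIV)"
        by (rule has_sum_SigmaI[OF inner1 outer fs])
      \<comment> \<open>Absolute convergence allows summation along the diagonals m + n = k, of
        which only k = 0 and k = 1 contribute.\<close>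
      have "((\<lambda>(k, i). ?c i * ?c (k - i) * d k) has_sum inner (S x) (S y)) (SIGMA k:UNIV. {..k})"
        by (rule iffD1[OF has_sum_reindex_bij_witness[where i = "\<lambda>(k, i). (i, k - i)"
              and j = "\<lambda>(m, n). (m + n, m)"] f1]) (auto simp: f_def)
      then have "((\<lambda>k. \<Sum>i\<le>k. ?c i * ?c (k - i) * d k) has_sum inner (S x) (S y)) UNIV"
        by (rule has_sum_SigmaD) (auto intro: has_sum_finiteI)
      moreover have "(\<Sum>i\<le>k. ?c i * ?c (k - i) * d k)
          = (if k = 0 then d 0 else 0) + (if k = 1 then - d 1 else 0)" for k
        using sqrt_coeff_convolution[of k] by (simp flip: sum_distrib_right)
      ultimately have "(\<lambda>k. (if k = 0 then d 0 else 0) + (if k = 1 then - d 1 else 0)) sums inner (S x) (S y)"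
        by (simp add: has_sum_imp_sums)
      moreover have "(\<lambda>k. (if k = 0 then d 0 else 0) + (if k = 1 then - d 1 else 0)) sums (d 0 + - d 1)"
        by (intro sums_add) (use sums_single[of 0 "\<lambda>_. d 0"] sums_single[of 1 "\<lambda>_. - d 1"] in auto)
      ultimately have "inner (S x) (S y) = d 0 + - d 1" by (rule sums_unique2)
      then show ?thesis by (simp add: d_def S_sym inner_diff_left)
    qed
    then show ?thesis using vector_eq_ldot by (metis inner_commute)
  qed
  ultimately show ?thesis by blast
qed

text \<open>For a norm bound \<open>K\<close> of \<open>R\<close>, the operator I - R/K is a
  contraction to which \<open>contraction_sqrt_exists\<close> applies; the factor sqrt K undoes the
  scaling.\<close>

lemma bounded_positive_sqrt_exists:
  fixes R :: "'a::{real_inner,complete_space} \<Rightarrow> 'a"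
  assumes R: "bounded_linear R" and sym: "\<And>x y. inner (R x) y = inner x (R y)"
    and pos: "\<And>x. inner (R x) x \<ge> 0"
  shows "\<exists>S. bounded_linear S \<and> (\<forall>x y. inner (S x) y = inner x (S y)) \<and>
           (\<forall>x. inner (S x) x \<ge> 0) \<and> (\<forall>x. S (S x) = R x)"
proof -
  interpret R: bounded_linear R by fact
  obtain K where K: "K > 0" "\<And>x. norm (R x) \<le> norm x * K" using R.pos_bounded by blast
  define X where "X x = x - (1 / K) *\<^sub>R R x" for x
  have lin: "linear X" by (rule linearI) (simp_all add: X_def R.add R.scale algebra_simps)
  have Xsym: "inner (X x) y = inner x (X y)" for x y
    by (simp add: X_def inner_diff_left inner_diff_right sym)
  have Xpos: "inner (X x) x \<ge> 0" for x
  proof -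
    have "inner (R x) x \<le> norm (R x) * norm x" by (rule norm_cauchy_schwarz)
    also have "\<dots> \<le> norm x * K * norm x" by (intro mult_right_mono K) simp
    finally show ?thesis using K(1)
      by (simp add: X_def inner_diff_left field_simps dot_square_norm power2_eq_square)
  qed
  have Xle: "inner (X x) x \<le> inner x x" for x
    using pos[of x] K(1) by (simp add: X_def inner_diff_left)
  have contr: "norm (X x) \<le> norm x" for x
  proof -
    \<comment> \<open>The form bounds 0 <= X <= I imply |X x| <= |x|: evaluate the positive form at
      x - X x.\<close>
    have "0 \<le> inner (X (x - X x)) (x - X x)" by (rule Xpos)
    also have "\<dots> = inner (X x) x - 2 * inner (X x) (X x) + inner (X (X x)) (X x)"
      by (simp add: linear_diff[OF lin] inner_diff_left inner_diff_right Xsym inner_commute)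
    also have "\<dots> \<le> inner x x - inner (X x) (X x)" using Xle[of x] Xle[of "X x"] by simp
    finally show ?thesis by (simp add: norm_le)
  qed
  obtain S where S: "bounded_linear S" "\<And>x y. inner (S x) y = inner x (S y)"
      "\<And>x. inner (S x) x \<ge> 0" "\<And>x. S (S x) = x - X x"
    using contraction_sqrt_exists[OF lin Xsym contr] by blast
  define T where "T x = sqrt K *\<^sub>R S x" for x
  have "bounded_linear T" unfolding T_def by (intro bounded_linear_const_scaleR S(1))
  moreover have "inner (T x) y = inner x (T y)" "inner (T x) x \<ge> 0" for x y
    using S(2,3) K(1) by (simp_all add: T_def)
  moreover have "T (T x) = R x" for x
    using S(4)[of x] K(1) linear_scale[OF bounded_linear.linear[OF S(1)]]
    by (simp add: T_def X_def)
  ultimately show ?thesis by blast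
qed

section \<open>Inverse, square root and resolvent of an unbounded operator\<close>

text \<open>Applied to A, as the way to its square root, and to I + \<epsilon> A, where the inverse
  is the resolvent.\<close>

lemma coercive_inverse:
  fixes A :: "'a::{real_inner,complete_space} unb_op"
  assumes A: "selfadjoint A" and l: "l > 0"
    and pos: "\<And>u. u \<in> op_dom A \<Longrightarrow> l * (norm u)\<^sup>2 \<le> inner (op_app A u) u"
  obtains R where "bounded_linear R" "\<And>x. norm (R x) \<le> norm x / l"
    "\<And>x y. inner (R x) y = inner x (R y)" "\<And>x. inner (R x) x \<ge> 0"
    "\<And>x. R x \<in> op_dom A" "\<And>x. op_app A (R x) = x" "\<And>x. x \<in> op_dom A \<Longrightarrow> R (op_app A x) = x"
proof -
  note lin = op_linear[OF A]
  have inj: "x = y" if "x \<in> op_dom A" "y \<in> op_dom A" "op_app A x = op_app A y" for x y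
    using pos[OF subspace_diff[OF lin(1) that(1,2)]] lin(4)[OF that(1,2)] that(3) l
    by (simp add: mult_le_0_iff)
  have "\<forall>y. \<exists>x. x \<in> op_dom A \<and> op_app A x = y"
    using selfadjoint_coercive_surj[OF A l pos] by blast
  then obtain R where R: "\<And>y. R y \<in> op_dom A" "\<And>y. op_app A (R y) = y" by metis
  have R3: "R (op_app A x) = x" if "x \<in> op_dom A" for x
    using inj[OF R(1) that] R(2) by blast
  have add: "R (x + y) = R x + R y" for x y
    by (rule inj) (simp_all add: R lin(2) subspace_add[OF lin(1)])
  have scale: "R (c *\<^sub>R x) = c *\<^sub>R R x" for c x
    by (rule inj) (simp_all add: R lin(3) subspace_scale[OF lin(1)])
  have bd: "norm (R x) \<le> norm x / l" for x
  proof (cases "R x = 0")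
    case True
    then show ?thesis using l by simp
  next
    case False
    have "l * norm (R x) * norm (R x) \<le> norm x * norm (R x)"
      using pos[OF R(1)[of x]] norm_cauchy_schwarz[of x "R x"] R(2) by (simp add: power2_eq_square)
    then show ?thesis using False l by (simp add: field_simps)
  qed
  have "bounded_linear R"
    by (rule bounded_linear_intro[where K = "1 / l", OF add scale]) (use bd in simp)
  moreover have "inner (R x) y = inner x (R y)" for x y
    using selfadjoint_inner[OF A R(1) R(1), of x y] by (simp add: R(2))
  moreover have "inner (R x) x \<ge> 0" for x
  proof -
    have "0 \<le> l * (norm (R x))\<^sup>2" using l by simp
    then show ?thesis using pos[OF R(1)[of x]] by (simp add: R(2) inner_commute)
  qed
  ultimately show ?thesis using that R R3 bd by blast
qed

text \<open>\<open>sqrt_op\<close> is defined by choice, so a square root must be exhibited. The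
  bounded inverse \<open>R\<close> of A has a bounded square root \<open>S\<close>, injective
  because \<open>R\<close> is, and the inverse of \<open>S\<close> on its range squares to
  A.\<close>

lemma is_sqrt_op_sqrt_op:
  fixes A :: "'a::{real_inner,complete_space} unb_op"
  assumes A: "selfadjoint A" "strictly_positive A"
  shows "is_sqrt_op A (sqrt_op A)"
proof -
  obtain l where l: "l > 0" "\<And>u. u \<in> op_dom A \<Longrightarrow> l * (norm u)\<^sup>2 \<le> inner (op_app A u) u"
    using A(2) by (auto simp: strictly_positive_def)
  obtain R where R: "bounded_linear R" "\<And>x y. inner (R x) y = inner x (R y)"
      "\<And>x. inner (R x) x \<ge> 0" "\<And>x. R x \<in> op_dom A" "\<And>x. op_app A (R x) = x"
      "\<And>x. x \<in> op_dom A \<Longrightarrow> R (op_app A x) = x"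
    using coercive_inverse[OF A(1) l] by metis
  obtain S where S: "bounded_linear S" "\<And>x y. inner (S x) y = inner x (S y)"
      "\<And>x. inner (S x) x \<ge> 0" "\<And>x. S (S x) = R x"
    using bounded_positive_sqrt_exists[OF R(1-3)] by blast
  have inj: "inj S"
  proof (rule injI)
    fix x y assume "S x = S y"
    then have "R x = R y" using S(4) by metis
    then show "x = y" using R(5) by metis
  qed
  define B where "B = (range S, inv S)"
  have BS [simp]: "op_app B (S x) = x" for x by (simp add: B_def inv_f_f[OF inj])
  have dom: "op_dom B = range S" by (simp add: B_def)
  have domA: "op_dom A = range R"
    using R(4,6) by (metis (no_types, opaque_lifting) image_eqI rangeE subsetI subset_antisym UNIV_I)
  interpret S: bounded_linear S by fact
  have "densely_defined_linear B" unfolding densely_defined_linear_def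
  proof (intro conjI ballI allI)
    show "subspace (op_dom B)"
      unfolding dom by (intro linear_subspace_image S.linear subspace_UNIV)
    have "op_dom A \<subseteq> op_dom B" unfolding domA dom by (metis S(4) image_subsetI rangeI)
    then have "closure (op_dom A) \<subseteq> closure (op_dom B)" by (rule closure_mono)
    moreover have "closure (op_dom A) = UNIV"
      using A(1) by (simp add: selfadjoint_def densely_defined_linear_def)
    ultimately show "closure (op_dom B) = UNIV" by auto
    fix c x y assume "x \<in> op_dom B" "y \<in> op_dom B"
    then obtain a b where "x = S a" "y = S b" unfolding dom by blast
    then show "op_app B (x + y) = op_app B x + op_app B y"
      by (simp flip: S.add)
  next
    fix c x assume "x \<in> op_dom B"
    then obtain a where "x = S a" unfolding dom by blast
    then show "op_app B (c *\<^sub>R x) = c *\<^sub>R op_app B x" by (simp flip: S.scaleR)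
  qed
  moreover have "adjoint_graph B = op_graph B"
  proof -
    have "(v, f) \<in> adjoint_graph B \<longleftrightarrow> v = S f" for v f
    proof -
      have "(v, f) \<in> adjoint_graph B \<longleftrightarrow> (\<forall>y. inner y v = inner y (S f))"
        by (simp add: adjoint_graph_def dom S(2))
      then show ?thesis using vector_eq_ldot by blast
    qed
    moreover have "(v, f) \<in> op_graph B \<longleftrightarrow> v = S f" for v f
      by (auto simp: op_graph_def dom image_image)
    ultimately show ?thesis by auto
  qed
  ultimately have "selfadjoint B" by (simp add: selfadjoint_def)
  moreover have "\<forall>u\<in>op_dom B. inner (op_app B u) u \<ge> 0"
    using S(3) by (auto simp: dom inner_commute[of _ "S _"])
  moreover have "op_dom A = {u \<in> op_dom B. op_app B u \<in> op_dom B}"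
    unfolding domA dom by (auto simp flip: S(4))
  moreover have "\<forall>u\<in>op_dom A. op_app B (op_app B u) = op_app A u"
    unfolding domA by (auto simp: R(5) simp flip: S(4)) (simp add: S(4) R(5))
  ultimately have "is_sqrt_op A B" by (simp add: is_sqrt_op_def)
  then show ?thesis unfolding sqrt_op_def by (rule someI)
qed

text \<open>The resolvent \<open>J = (I + \<epsilon> A)\<^sup>-\<^sup>1\<close>, the bounded operators \<open>L = A\<^sup>1\<^sup>/\<^sup>2 J\<close> and
  \<open>C = A J\<close>.\<close>

lemma resolvent:
  fixes A :: "'a::{real_inner,complete_space} unb_op"
  assumes A: "selfadjoint A" and e: "e > (0::real)"
    and l: "l > 0" "\<And>u. u \<in> op_dom A \<Longrightarrow> l * (norm u)\<^sup>2 \<le> inner (op_app A u) u"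
  obtains J L C where "bounded_linear J" "bounded_linear L" "bounded_linear C"
    "\<And>x. norm (J x) \<le> norm x" "\<And>x. J x \<in> H1 A"
    "\<And>x. op_app (sqrt_op A) (J x) = L x"
    "\<And>x. x \<in> H1 A \<Longrightarrow> L x = J (op_app (sqrt_op A) x)"
    "\<And>x. l * (norm (J x))\<^sup>2 \<le> (norm (L x))\<^sup>2"
    "\<And>x y. inner (J x) y = inner x (J y)"
    "\<And>x y. inner (C x) (J y) = inner (L x) (L y)"
    "\<And>x y. x \<in> H1 A \<Longrightarrow> inner1 A x (J y) = inner (C x) y"
    "\<And>x. x \<in> op_dom A \<Longrightarrow> norm (J x - x) \<le> e * norm (op_app A x)"
proof -
  note lin = op_linear[OF A]
  have sp: "strictly_positive A" using l by (auto simp: strictly_positive_def)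
  define B where "B = sqrt_op A"
  have B: "selfadjoint B" "op_dom A = {u \<in> op_dom B. op_app B u \<in> op_dom B}"
      "\<And>u. u \<in> op_dom A \<Longrightarrow> op_app B (op_app B u) = op_app A u"
    using is_sqrt_op_sqrt_op[OF A sp] unfolding B_def is_sqrt_op_def by blast+
  note linB = op_linear[OF B(1)]
  define T where "T = (op_dom A, \<lambda>x. x + e *\<^sub>R op_app A x)"
  have T: "op_dom T = op_dom A" "\<And>x. op_app T x = x + e *\<^sub>R op_app A x" by (auto simp: T_def)
  have "densely_defined_linear T"
    using A by (auto simp: selfadjoint_def densely_defined_linear_def T algebra_simps)
  moreover have "adjoint_graph T = op_graph T"
  proof -
    \<comment> \<open>The adjoint relation of I + e A for (v, f) is that of A for (v, (f - v)/e),
      and the graphs correspond in the same way; selfadjointness carries over.\<close>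
    have "(v, f) \<in> adjoint_graph T \<longleftrightarrow> (v, (1 / e) *\<^sub>R (f - v)) \<in> adjoint_graph A" for v f
      using e by (auto simp: adjoint_graph_def T inner_add_left inner_diff_right field_simps)
    moreover have "(v, f) \<in> op_graph T \<longleftrightarrow> (v, (1 / e) *\<^sub>R (f - v)) \<in> op_graph A" for v f
    proof -
      have "(1 / e) *\<^sub>R (f - v) = op_app A v \<longleftrightarrow> f = v + e *\<^sub>R op_app A v"
      proof
        assume "(1 / e) *\<^sub>R (f - v) = op_app A v"
        then have "f - v = e *\<^sub>R op_app A v" using e by (simp flip: \<open>(1 / e) *\<^sub>R (f - v) = op_app A v\<close>)
        then show "f = v + e *\<^sub>R op_app A v" by (simp add: algebra_simps)
      qed (use e in simp)
      then show ?thesis by (auto simp: op_graph_def T)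
    qed
    moreover have "adjoint_graph A = op_graph A" using A by (simp add: selfadjoint_def)
    ultimately show ?thesis by auto
  qed
  ultimately have Tsa: "selfadjoint T" by (simp add: selfadjoint_def)
  have Tpos: "1 * (norm u)\<^sup>2 \<le> inner (op_app T u) u" if "u \<in> op_dom T" for u
  proof -
    have "0 \<le> l * (norm u)\<^sup>2" using l(1) by simp
    then have "0 \<le> e * inner (op_app A u) u" using l(2)[of u] that e by (simp add: T)
    then show ?thesis by (simp add: T inner_add_left dot_square_norm)
  qed
  obtain J where J: "bounded_linear J" "\<And>x. norm (J x) \<le> norm x / 1"
      "\<And>x y. inner (J x) y = inner x (J y)"
      "\<And>x. J x \<in> op_dom T" "\<And>x. op_app T (J x) = x" "\<And>x. x \<in> op_dom T \<Longrightarrow> J (op_app T x) = x"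
    using coercive_inverse[OF Tsa _ Tpos] by (metis zero_less_one)
  interpret J: bounded_linear J by fact
  have JA: "J x \<in> op_dom A" for x using J(4) T by simp
  have JB: "J x \<in> op_dom B" "op_app B (J x) \<in> op_dom B" for x using JA B(2) by auto
  have AJ: "op_app A (J x) = (1 / e) *\<^sub>R (x - J x)" for x
  proof -
    have "x - J x = e *\<^sub>R op_app A (J x)" using J(5)[of x] by (simp add: T algebra_simps)
    then show ?thesis using e by simp
  qed
  \<comment> \<open>From J x + e A (J x) = x, the operator A J equals (I - J)/e, bounded although A
    is not. Through inner (C x) (J x) = |L x|^2 it bounds \<open>L\<close> as well.\<close>
  define C where "C x = (1 / e) *\<^sub>R (x - J x)" for x
  define L where "L x = op_app B (J x)" for x
  have C: "bounded_linear C"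
    unfolding C_def by (intro bounded_linear_const_scaleR bounded_linear_sub bounded_linear_ident J(1))
  interpret C: bounded_linear C by fact
  have LL: "inner (L x) (L y) = inner (C x) (J y)" for x y
    using selfadjoint_inner[OF B(1) JB(2)[of x] JB(1)[of y]] B(3)[OF JA[of x]]
    by (simp add: L_def C_def AJ)
  obtain K where K: "K > 0" "\<And>x. norm (C x) \<le> norm x * K" using C.pos_bounded by blast
  have L: "bounded_linear L"
  proof (rule bounded_linear_intro[where K = "sqrt K"])
    show "L (x + y) = L x + L y" for x y by (simp add: L_def J.add linB(2) JB)
    show "L (c *\<^sub>R x) = c *\<^sub>R L x" for c x by (simp add: L_def J.scaleR linB(3) JB)
    show "norm (L x) \<le> norm x * sqrt K" for x
    proof (rule power2_le_imp_le)
      have "(norm (L x))\<^sup>2 \<le> norm (C x) * norm (J x)"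
        using LL[of x x] norm_cauchy_schwarz[of "C x" "J x"] by (simp add: dot_square_norm)
      also have "\<dots> \<le> (norm x * K) * norm x" using K J(2)[of x] by (intro mult_mono) auto
      finally show "(norm (L x))\<^sup>2 \<le> (norm x * sqrt K)\<^sup>2"
        using K(1) by (simp add: power_mult_distrib power2_eq_square[of "norm x"] mult_ac)
    qed (use K(1) in simp)
  qed
  \<comment> \<open>Since A (L x) = B (C x) = (B x - L x)/e, applying I + e A to L x gives B x;
    inverting yields L x = J (B x).\<close>
  have comm: "L x = J (op_app B x)" if x: "x \<in> op_dom B" for x
  proof -
    have y: "op_app B (op_app B (J x)) = C x" using B(3)[OF JA] by (simp add: AJ C_def)
    have "C x \<in> op_dom B" unfolding C_def
      using x JB(1)[of x] linB(1) by (simp add: subspace_diff subspace_scale)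
    then have LA: "L x \<in> op_dom A" unfolding B(2) L_def using JB y by simp
    have "op_app A (L x) = op_app B (C x)"
      unfolding B(3)[OF LA, symmetric] by (simp add: L_def y)
    also have "\<dots> = (1 / e) *\<^sub>R (op_app B x - L x)"
      unfolding C_def L_def
      using linB(3)[OF subspace_diff[OF linB(1) x JB(1)]] linB(4)[OF x JB(1)] by simp
    finally have "op_app T (L x) = op_app B x" using e by (simp add: T)
    then show ?thesis using J(6)[of "L x"] LA T(1) by simp
  qed
  have in1: "inner1 A x (J y) = inner (C x) y" if "x \<in> H1 A" for x y
  proof -
    have "inner1 A x (J y) = inner x (op_app B (op_app B (J y)))"
      using selfadjoint_inner[OF B(1), of x "op_app B (J y)"] that JB
      by (simp add: inner1_def H1_def B_def)
    also have "\<dots> = inner (C x) y"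
      using B(3)[OF JA] J(3)[of x y] by (simp add: AJ C_def inner_diff_left inner_diff_right)
    finally show ?thesis .
  qed
  have Jx: "norm (J x - x) \<le> e * norm (op_app A x)" if "x \<in> op_dom A" for x
  proof -
    have "J x - x = - (e *\<^sub>R J (op_app A x))"
      using J(6)[of x] that unfolding T by (simp add: J.add J.scaleR algebra_simps)
    then show ?thesis using J(2)[of "op_app A x"] e by (simp add: mult_left_mono)
  qed
  show ?thesis
  proof (rule that[of J L C])
    show "norm (J x) \<le> norm x" for x using J(2)[of x] by simp
    show "J x \<in> H1 A" "op_app (sqrt_op A) (J x) = L x" for x
      using JB(1) by (simp_all add: H1_def L_def flip: B_def)
    show "L x = J (op_app (sqrt_op A) x)" if "x \<in> H1 A" for x
      using comm that by (simp add: H1_def flip: B_def)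
    show "l * (norm (J x))\<^sup>2 \<le> (norm (L x))\<^sup>2" for x
      using l(2)[OF JA[of x]] LL[of x x] by (simp add: AJ C_def dot_square_norm)
  qed (fact J C L LL[symmetric] in1 Jx)+
qed

section \<open>Absolutely continuous functions\<close>

lemma abs_cont_onE:
  assumes "abs_cont_on a b f" "e > 0"
  obtains d where "d > 0"
    "\<forall>P. finite P \<and> (\<forall>(x, y)\<in>P. a \<le> x \<and> x \<le> y \<and> y \<le> b) \<and>
        disjoint_family_on (\<lambda>(x, y). {x<..<y}) P \<and> (\<Sum>(x, y)\<in>P. y - x) < d
        \<longrightarrow> (\<Sum>(x, y)\<in>P. \<bar>f y - f x\<bar>) < e"
proof -
  from mp[OF spec[OF assms(1)[unfolded abs_cont_on_def], of e] assms(2)]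
  show thesis by (elim exE conjE) (rule that)
qed

lemma abs_cont_on_imp_continuous_on:
  assumes "abs_cont_on a b f"
  shows "continuous_on {a..b} f"
proof (rule continuous_onI)
  fix x e :: real assume x: "x \<in> {a..b}" and e: "e > 0"
  obtain d where d: "d > 0" and D0: "\<forall>P. finite P \<and> (\<forall>(x, y)\<in>P. a \<le> x \<and> x \<le> y \<and> y \<le> b) \<and>
        disjoint_family_on (\<lambda>(x, y). {x<..<y}) P \<and> (\<Sum>(x, y)\<in>P. y - x) < d
        \<longrightarrow> (\<Sum>(x, y)\<in>P. \<bar>f y - f x\<bar>) < e"
    by (rule abs_cont_onE[OF assms e])
  note D = D0[THEN spec, THEN mp]
  have f: "\<bar>f (max x y) - f (min x y)\<bar> < e" if "y \<in> {a..b}" "\<bar>y - x\<bar> < d" for y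
  proof -
    have "max x y - min x y < d" "min x y \<le> max x y" using that(2) by linarith+
    then show ?thesis
      using D[of "{(min x y, max x y)}"] that x by (simp add: disjoint_family_on_def)
  qed
  show "\<exists>d>0. \<forall>x'\<in>{a..b}. dist x' x < d \<longrightarrow> dist (f x') (f x) \<le> e"
  proof (intro exI[of _ d] conjI d ballI impI)
    fix y assume "y \<in> {a..b}" "dist y x < d"
    from f[OF this(1)] this(2) show "dist (f y) (f x) \<le> e"
      by (auto simp: dist_real_def max_def min_def split: if_splits)
  qed
qed

text \<open>Allows the factor exp(- \<rho> s) to be attached to g', so that the differential
  inequality in (g3) becomes a statement about monotonicity.\<close>

lemma abs_cont_on_mult_lipschitz:
  assumes f: "abs_cont_on a b f" and L: "L-lipschitz_on {a..b} h"
  shows "abs_cont_on a b (\<lambda>x. f x * h x)"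
proof -
  have "compact (f ` {a..b})" "compact (h ` {a..b})"
    using abs_cont_on_imp_continuous_on[OF f] lipschitz_on_continuous_on[OF L]
    by (auto intro: compact_continuous_image)
  then have "bounded (f ` {a..b})" "bounded (h ` {a..b})" by (auto intro: compact_imp_bounded)
  then obtain F H where FH: "F > 0" "H > 0" "\<And>x. x \<in> {a..b} \<Longrightarrow> \<bar>f x\<bar> \<le> F"
      "\<And>x. x \<in> {a..b} \<Longrightarrow> \<bar>h x\<bar> \<le> H"
    unfolding bounded_pos by auto
  have L0: "L \<ge> 0" using L by (rule lipschitz_on_nonneg)
  show ?thesis unfolding abs_cont_on_def
  proof (intro allI impI)
    fix e :: real assume e: "e > 0"
    have e2: "e / 2 / H > 0" using e FH by simp
    obtain d where d: "d > 0" and D0: "\<forall>P. finite P \<and> (\<forall>(x, y)\<in>P. a \<le> x \<and> x \<le> y \<and> y \<le> b) \<and>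
        disjoint_family_on (\<lambda>(x, y). {x<..<y}) P \<and> (\<Sum>(x, y)\<in>P. y - x) < d
        \<longrightarrow> (\<Sum>(x, y)\<in>P. \<bar>f y - f x\<bar>) < e / 2 / H"
    by (rule abs_cont_onE[OF f e2])
  note D = D0[THEN spec, THEN mp]
    define d' where "d' = min d (e / 2 / (F * (L + 1)))"
    have d': "d' > 0" using d e FH L0 by (simp add: d'_def)
    show "\<exists>d>0. \<forall>P. finite P \<and> (\<forall>(x, y)\<in>P. a \<le> x \<and> x \<le> y \<and> y \<le> b) \<and>
        disjoint_family_on (\<lambda>(x, y). {x<..<y}) P \<and> (\<Sum>(x, y)\<in>P. y - x) < d
        \<longrightarrow> (\<Sum>(x, y)\<in>P. \<bar>f y * h y - f x * h x\<bar>) < e"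
    proof (intro exI[of _ d'] conjI d' allI impI)
      fix P assume P: "finite P \<and> (\<forall>(x, y)\<in>P. a \<le> x \<and> x \<le> y \<and> y \<le> b) \<and>
        disjoint_family_on (\<lambda>(x, y). {x<..<y}) P \<and> (\<Sum>(x, y)\<in>P. y - x) < d'"
      have 1: "(\<Sum>(x, y)\<in>P. \<bar>f y - f x\<bar>) < e / 2 / H"
        using P by (intro D) (auto simp: d'_def)
      have "(\<Sum>(x, y)\<in>P. \<bar>f y * h y - f x * h x\<bar>)
          \<le> (\<Sum>(x, y)\<in>P. H * \<bar>f y - f x\<bar> + F * L * (y - x))"
      proof (rule sum_mono, clarify)
        fix x y assume "(x, y) \<in> P"
        then have xy: "a \<le> x" "x \<le> y" "y \<le> b" using P by auto
        have "\<bar>f y * h y - f x * h x\<bar> \<le> \<bar>h y\<bar> * \<bar>f y - f x\<bar> + \<bar>f x\<bar> * \<bar>h y - h x\<bar>"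
          unfolding abs_mult[symmetric]
          by (rule order_trans[OF _ abs_triangle_ineq]) (simp add: algebra_simps)
        also have "\<dots> \<le> H * \<bar>f y - f x\<bar> + F * (L * (y - x))"
          using xy FH lipschitz_onD[OF L, of y x] by (intro add_mono mult_mono) (auto simp: dist_real_def)
        finally show "\<bar>f y * h y - f x * h x\<bar> \<le> H * \<bar>f y - f x\<bar> + F * L * (y - x)" by simp
      qed
      also have "\<dots> = H * (\<Sum>(x, y)\<in>P. \<bar>f y - f x\<bar>) + F * L * (\<Sum>(x, y)\<in>P. y - x)"
        by (simp add: sum.distrib sum_distrib_left case_prod_unfold)
      also have "\<dots> < e / 2 + e / 2"
      proof (rule add_less_le_mono)
        show "H * (\<Sum>(x, y)\<in>P. \<bar>f y - f x\<bar>) < e / 2" using 1 FH by (simp add: field_simps)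
        have "F * L * (\<Sum>(x, y)\<in>P. y - x) \<le> F * (L + 1) * d'"
          using P FH L0 by (intro mult_mono sum_nonneg) auto
        also have "\<dots> \<le> F * (L + 1) * (e / 2 / (F * (L + 1)))"
          using FH L0 by (intro mult_left_mono) (auto simp: d'_def)
        finally show "F * L * (\<Sum>(x, y)\<in>P. y - x) \<le> e / 2" using FH L0 by simp
      qed
      finally show "(\<Sum>(x, y)\<in>P. \<bar>f y * h y - f x * h x\<bar>) < e" by simp
    qed
  qed
qed

text \<open>On a fine tagged division the intervals tagged outside the exceptional null set contribute at
  most \<open>\<epsilon> * (b - a)\<close>, by differentiability; the others lie in an open set of small measure and are
  controlled by absolute continuity.\<close>

lemma abs_cont_on_nonincreasing:
  assumes AC: "abs_cont_on a b f" and ab: "a \<le> b"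
    and der: "AE x in lborel. a < x \<and> x < b \<longrightarrow> (\<exists>D\<le>0. (f has_real_derivative D) (at x))"
  shows "f b \<le> f a"
proof (rule field_le_epsilon)
  fix e0 :: real assume "e0 > 0"
  define e where "e = e0 / 2 / (b - a + 1)"
  have e: "e > 0" using \<open>e0 > 0\<close> ab by (simp add: e_def)
  obtain d where d: "d > 0" and D0: "\<forall>P. finite P \<and> (\<forall>(x, y)\<in>P. a \<le> x \<and> x \<le> y \<and> y \<le> b) \<and>
        disjoint_family_on (\<lambda>(x, y). {x<..<y}) P \<and> (\<Sum>(x, y)\<in>P. y - x) < d
        \<longrightarrow> (\<Sum>(x, y)\<in>P. \<bar>f y - f x\<bar>) < e0 / 2"
    by (rule abs_cont_onE[OF AC half_gt_zero[OF \<open>e0 > 0\<close>]])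
  note D = D0[THEN spec, THEN mp]
  define good where "good x \<longleftrightarrow> a < x \<and> x < b \<and> (\<exists>D\<le>0. (f has_real_derivative D) (at x))" for x
  define Z where "Z = {x\<in>{a..b}. \<not> good x}"
  obtain N where N: "N \<in> null_sets lborel" "{x \<in> space lborel. \<not> (a < x \<and> x < b \<longrightarrow>
        (\<exists>D\<le>0. (f has_real_derivative D) (at x)))} \<subseteq> N"
    by (rule bexE[OF der[unfolded eventually_ae_filter]])
  \<comment> \<open>Points called \<open>good\<close> are interior, so the end points join the
    exceptional set.\<close>
  have N': "N \<union> {a, b} \<in> null_sets lborel"
    by (intro null_sets.Un N(1)) (simp add: finite_imp_null_set_lborel)
  have ZN: "Z \<subseteq> N \<union> {a, b}" 
  proof
    fix x assume "x \<in> Z"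
    then show "x \<in> N \<union> {a, b}" using N(2) by (cases "x = a \<or> x = b") (auto simp: Z_def good_def)
  qed
  obtain U where U: "open U" "N \<union> {a, b} \<subseteq> U" "emeasure lborel (U - (N \<union> {a, b})) < ennreal d"
    using outer_regular_lborel[of "N \<union> {a, b}" d] N' d by (auto simp: null_sets_def)
  have Ud: "emeasure lborel U < ennreal d"
  proof -
    have "U = (U - (N \<union> {a, b})) \<union> (N \<union> {a, b})" using U(2) by auto
    moreover have "emeasure lborel ((U - (N \<union> {a, b})) \<union> (N \<union> {a, b})) = emeasure lborel (U - (N \<union> {a, b}))"
      using U(1) N' by (intro emeasure_Un_null_set) (auto simp: null_sets_def)
    ultimately show ?thesis using U(3) by simp
  qed
  have "\<exists>r>0. \<forall>p q. x - r < p \<and> p \<le> x \<and> x \<le> q \<and> q < x + r \<longrightarrow> f q - f p \<le> e * (q - p)"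
    if gx: "good x" for x
  proof -
    obtain D where D0: "D \<le> 0" "(f has_real_derivative D) (at x)" using gx by (auto simp: good_def)
    then have "(f has_derivative (\<lambda>h. D * h)) (at x)" by (simp add: has_field_derivative_def)
    then obtain r where r: "r > 0" "\<And>y. norm (y - x) < r \<Longrightarrow> norm (f y - f x - D * (y - x)) \<le> e * norm (y - x)"
      using e unfolding has_derivative_at_alt by blast
    have "f q - f p \<le> e * (q - p)" if "x - r < p" "p \<le> x" "x \<le> q" "q < x + r" for p q
    proof -
      have "\<bar>f q - f x - D * (q - x)\<bar> \<le> e * (q - x)" "\<bar>f p - f x - D * (p - x)\<bar> \<le> e * (x - p)"
        using r(2)[of q] r(2)[of p] that by auto
      moreover have "D * (q - x) \<le> 0" "0 \<le> D * (p - x)"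
        using D0(1) that by (auto simp: mult_nonpos_nonneg mult_nonpos_nonpos)
      moreover have "e * (q - p) = e * (q - x) + e * (x - p)" by (simp add: algebra_simps)
      ultimately show ?thesis by linarith
    qed
    then show ?thesis using r(1) by blast
  qed
  then obtain r where r: "\<And>x. good x \<Longrightarrow> r x > 0"
    "\<And>x p q. good x \<Longrightarrow> x - r x < p \<Longrightarrow> p \<le> x \<Longrightarrow> x \<le> q \<Longrightarrow> q < x + r x \<Longrightarrow> f q - f p \<le> e * (q - p)"
    by metis
  \<comment> \<open>An interval with a good tag stays where the difference quotient is at most
    \<open>e\<close>; one with a bad tag stays in \<open>U\<close>, whose measure is below
    \<open>d\<close>. Tags lie in [a, b] and bad ones there belong to \<open>U\<close>, so the case
    \<open>UNIV\<close> only makes the gauge total.\<close>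
  define G where "G x = (if good x then ball x (r x) else if x \<in> U then U else UNIV)" for x
  have "gauge G" using U(1) r(1) by (auto simp: gauge_def G_def)
  then obtain p where p: "p tagged_division_of {a..b}" "G fine p" by (rule fine_division_exists_real)
  have fin: "finite p" using p(1) by blast
  have K: "x \<in> K" "Inf K \<le> x" "x \<le> Sup K" "K = {Inf K..Sup K}" "a \<le> Inf K" "Sup K \<le> b" "K \<subseteq> G x"
    if xK: "(x, K) \<in> p" for x K
  proof -
    show xk: "x \<in> K" using p(1) xK by blast
    obtain u v where "K = cbox u v" using p(1) xK by blast
    then have uv: "K = {u..v}" "u \<le> v" using xk by auto
    then have IS: "Inf K = u" "Sup K = v" by auto
    show "K = {Inf K..Sup K}" "Inf K \<le> x" "x \<le> Sup K" using uv xk unfolding IS by auto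
    have "K \<subseteq> {a..b}" using p(1) xK by blast
    then show "a \<le> Inf K" "Sup K \<le> b" using uv unfolding IS by auto
    show "K \<subseteq> G x" using p(2) xK by (auto simp: fine_def)
  qed
  let ?df = "\<lambda>(x::real, K). f (Sup K) - f (Inf K)"
  define pg where "pg = {(x, K)\<in>p. good x}"
  \<comment> \<open>Degenerate intervals contribute nothing and are dropped, so that distinct
    members of \<open>pb\<close> have distinct end-point pairs: absolute continuity is stated for a
    set of pairs, and no summand may be merged.\<close>
  define pb where "pb = {(x, K)\<in>p. \<not> good x \<and> Inf K < Sup K}"
  have "f b - f a = sum ?df p" by (rule additive_tagged_division_1[OF ab p(1), symmetric])
  also have "\<dots> = sum ?df (pg \<union> pb)"
  proof (rule sum.mono_neutral_right[OF fin])
    show "pg \<union> pb \<subseteq> p" by (auto simp: pg_def pb_def)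
    show "\<forall>i\<in>p - (pg \<union> pb). ?df i = 0"
    proof (rule ballI)
      fix i assume "i \<in> p - (pg \<union> pb)"
      then obtain x K where i: "i = (x, K)" and xK: "(x, K) \<in> p" "(x, K) \<notin> pg \<union> pb"
        by (cases i) auto
      then have "Inf K = Sup K" using K(2,3)[OF xK(1)]
        by (cases "Inf K < Sup K") (auto simp: pg_def pb_def)
      then show "?df i = 0" by (simp add: i)
    qed
  qed
  also have "\<dots> = sum ?df pg + sum ?df pb"
    by (rule sum.union_disjoint) (auto simp: pg_def pb_def intro: finite_subset[OF _ fin])
  also have "\<dots> \<le> e * (b - a) + e0 / 2"
  proof (rule add_mono)
    have "sum ?df pg \<le> (\<Sum>(x, K)\<in>pg. e * measure lborel K)"
    proof (rule sum_mono, clarify)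
      fix x K assume "(x, K) \<in> pg"
      then have xK: "(x, K) \<in> p" "good x" by (auto simp: pg_def)
      have "{Inf K, Sup K} \<subseteq> {Inf K..Sup K}" using K(2,3)[OF xK(1)] by auto
      also have "\<dots> \<subseteq> ball x (r x)" using K(4,7)[OF xK(1)] xK(2) by (simp add: G_def)
      finally have "{Inf K, Sup K} \<subseteq> ball x (r x)" .
      then have "f (Sup K) - f (Inf K) \<le> e * (Sup K - Inf K)"
        using K[OF xK(1)] by (intro r(2)[OF xK(2)]) (auto simp: dist_real_def)
      also have "Sup K - Inf K = measure lborel K"
        using K(2-4)[OF xK(1)] by (metis content_real order_trans)
      finally show "f (Sup K) - f (Inf K) \<le> e * measure lborel K" .
    qed
    also have "\<dots> \<le> (\<Sum>(x, K)\<in>p. e * measure lborel K)"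
      using fin e by (intro sum_mono2) (auto simp: pg_def)
    also have "\<dots> = e * (b - a)"
      using additive_content_tagged_division[of p a b] p(1) ab
      by (simp add: case_prod_unfold flip: sum_distrib_left)
    finally show "sum ?df pg \<le> e * (b - a)" .
  next
    let ?j = "\<lambda>(x::real, K::real set). (Inf K, Sup K)"
    have pbD: "(x, K) \<in> p" "\<not> good x" "Inf K < Sup K" if "(x, K) \<in> pb" for x K
      using that by (auto simp: pb_def)
    have int: "interior K = {Inf K<..<Sup K}" if "(x, K) \<in> pb" for x K
      using K(4)[OF pbD(1)[OF that]] by (metis interior_atLeastAtMost_real)
    have disj: "{Inf K<..<Sup K} \<inter> {Inf K'<..<Sup K'} = {}"
      if "(x, K) \<in> pb" "(x', K') \<in> pb" "(x, K) \<noteq> (x', K')" for x K x' K'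
      using tagged_division_ofD(5)[OF p(1) pbD(1)[OF that(1)] pbD(1)[OF that(2)] that(3)]
      by (simp add: int[OF that(1)] int[OF that(2)])
    have inj: "inj_on ?j pb"
    proof (rule inj_onI, clarify)
      fix x K x' K' assume A: "(x, K) \<in> pb" "(x', K') \<in> pb" "Inf K = Inf K'" "Sup K = Sup K'"
      then have "(x, K) = (x', K')"
        using disj[OF A(1,2)] pbD(3)[OF A(1)] by (metis dense greaterThanLessThan_iff inf.idem empty_iff)
      then show "x = x' \<and> K = K'" by simp
    qed
    have finb: "finite pb" using fin by (auto simp: pb_def intro: finite_subset)
    have fam: "disjoint_family_on (\<lambda>(x, y). {x<..<y}) (?j ` pb)"
    unfolding disjoint_family_on_def
    proof (intro ballI impI)
      fix m n assume mn: "m \<in> ?j ` pb" "n \<in> ?j ` pb" "m \<noteq> n"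
      then obtain x K x' K' where "(x, K) \<in> pb" "(x', K') \<in> pb" "m = (Inf K, Sup K)" "n = (Inf K', Sup K')"
        by auto
      then show "(case m of (x, y) \<Rightarrow> {x<..<y}) \<inter> (case n of (x, y) \<Rightarrow> {x<..<y}) = {}"
        using disj[of x K x' K'] mn(3) by auto
    qed
    have len: "(\<Sum>(x, y)\<in>?j ` pb. y - x) < d"
    proof -
      have le: "fst z \<le> snd z" if "z \<in> ?j ` pb" for z using that pbD(3) by force
      have "ennreal (\<Sum>(x, y)\<in>?j ` pb. y - x) = (\<Sum>z\<in>?j ` pb. ennreal (snd z - fst z))"
        using le by (subst sum_ennreal) (auto simp: case_prod_unfold)
      also have "\<dots> = (\<Sum>z\<in>?j ` pb. emeasure lborel (case z of (x, y) \<Rightarrow> {x<..<y}))"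
        using le by (intro sum.cong) (auto simp: case_prod_unfold)
      also have "\<dots> = emeasure lborel (\<Union>z\<in>?j ` pb. case z of (x, y) \<Rightarrow> {x<..<y})"
        using finb fam by (intro sum_emeasure) auto
      also have "\<dots> \<le> emeasure lborel U"
      proof (rule emeasure_mono)
        show "(\<Union>z\<in>?j ` pb. case z of (x, y) \<Rightarrow> {x<..<y}) \<subseteq> U"
        proof clarify
          fix y x K assume "(x, K) \<in> pb" "y \<in> {Inf K<..<Sup K}"
          then have xK: "(x, K) \<in> p" "\<not> good x" "y \<in> K" using pbD K(4)[of x K] by auto
          have "x \<in> Z" using xK K(2,3,5,6)[OF xK(1)] by (auto simp: Z_def)
          then have "x \<in> U" using ZN U(2) by auto
          then show "y \<in> U" using K(7)[OF xK(1)] xK by (auto simp: G_def)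
        qed
      qed (use U(1) in auto)
      also have "\<dots> < ennreal d" by (rule Ud)
      finally show ?thesis using d by (simp add: ennreal_less_iff sum_nonneg case_prod_unfold le)
    qed
    have "(\<Sum>(x, y)\<in>?j ` pb. \<bar>f y - f x\<bar>) < e0 / 2"
    proof (rule D, intro conjI fam len)
      show "\<forall>(x, y)\<in>?j ` pb. a \<le> x \<and> x \<le> y \<and> y \<le> b"
      proof clarify
        fix x K assume "(x, K) \<in> pb"
        from pbD[OF this] show "a \<le> Inf K \<and> Inf K \<le> Sup K \<and> Sup K \<le> b"
          using K(5,6)[of x K] by simp
      qed
    qed (use finb in simp)
    moreover have "(\<Sum>(x, y)\<in>?j ` pb. \<bar>f y - f x\<bar>) = (\<Sum>(x, K)\<in>pb. \<bar>f (Sup K) - f (Inf K)\<bar>)"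
      by (subst sum.reindex[OF inj]) (simp add: case_prod_unfold o_def)
    moreover have "sum ?df pb \<le> (\<Sum>(x, K)\<in>pb. \<bar>f (Sup K) - f (Inf K)\<bar>)"
      by (intro sum_mono) auto
    ultimately show "sum ?df pb \<le> e0 / 2" by linarith
  qed
  also have "\<dots> \<le> e0"
    using ab \<open>e0 > 0\<close> by (simp add: e_def field_simps)
  finally show "f b \<le> f a + e0" by simp
qed

section \<open>Convolutions\<close>

lemma continuous_on_max0:
  fixes f :: "real \<Rightarrow> 'b::topological_space"
  assumes "continuous_on {0..} f"
  shows "continuous_on S (\<lambda>x. f (max x 0))"
  by (rule continuous_on_compose2[OF assms]) (auto intro!: continuous_intros)

lemma conv_integrable:
  fixes f :: "real \<Rightarrow> 'b::banach"
  assumes k: "continuous_on {0..} k" and f: "continuous_on {0..} f"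
  shows "(\<lambda>s. k s *\<^sub>R f (t - s)) integrable_on {0..t}"
  by (rule integrable_continuous_interval)
     (auto intro!: continuous_intros continuous_on_compose2[OF f] continuous_on_subset[OF k])

text \<open>The substitution s = t r moves the variable limit into the integrand and leaves a
  parameter integral over [0, 1]. The \<open>max\<close> terms keep the arguments in the half-line
  where \<open>k\<close> and \<open>f\<close> are continuous.\<close>

lemma conv_continuous:
  fixes f :: "real \<Rightarrow> 'b::banach"
  assumes k: "continuous_on {0..} k" and f: "continuous_on {0..} f"
  shows "continuous_on {0..} (\<lambda>t. integral {0..t} (\<lambda>s. k s *\<^sub>R f (t - s)))"
proof (rule continuous_on_cong[THEN iffD1, rotated 2])
  let ?F = "\<lambda>t r. t *\<^sub>R k (max (t * r) 0) *\<^sub>R f (max (t - t * r) 0)"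
  show "continuous_on {0..} (\<lambda>t. integral (cbox 0 1) (?F t))"
    by (rule integral_continuous_on_param)
       (auto simp: case_prod_unfold intro!: continuous_intros continuous_on_compose2[OF k] continuous_on_compose2[OF f])
  fix t :: real assume t: "t \<in> {0..}"
  show "integral (cbox 0 1) (?F t) = integral {0..t} (\<lambda>s. k s *\<^sub>R f (t - s))"
  proof (cases "t = 0")
    case False
    then have t0: "t > 0" using t by simp
    have "((\<lambda>s. k s *\<^sub>R f (t - s)) has_integral integral {0..t} (\<lambda>s. k s *\<^sub>R f (t - s))) (cbox 0 t)"
      using conv_integrable[OF k f] by (simp add: integrable_integral)
    from has_integral_affinity'[OF this t0, of 0]
    have "((\<lambda>r. k (t * r) *\<^sub>R f (t - t * r)) has_integral
        inverse t *\<^sub>R integral {0..t} (\<lambda>s. k s *\<^sub>R f (t - s))) {0..1}"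
      using t0 by (simp add: divide_inverse)
    from has_integral_cmul[OF this, of t]
    have "((\<lambda>r. t *\<^sub>R k (t * r) *\<^sub>R f (t - t * r)) has_integral
        integral {0..t} (\<lambda>s. k s *\<^sub>R f (t - s))) {0..1}"
      using t0 by simp
    then have "(?F t has_integral integral {0..t} (\<lambda>s. k s *\<^sub>R f (t - s))) {0..1}"
      by (rule has_integral_eq[rotated]) (use t0 in \<open>auto simp: max_def mult_le_0_iff mult_left_le\<close>)
    then show ?thesis by (simp add: integral_unique)
  qed simp
qed simp

text \<open>Continue \<open>f\<close> to negative arguments as a C^1 function that is affine there.
  The convolution over [0, x] becomes an integral over a fixed [0, T] minus an explicit tail, and
  differentiation under the integral sign applies.\<close>

lemma conv_has_vector_derivative:
  fixes f :: "real \<Rightarrow> 'b::banach"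
  assumes k: "continuous_on {0..} k" and f': "continuous_on {0..} f'"
    and f: "\<And>t. t \<ge> 0 \<Longrightarrow> (f has_vector_derivative f' t) (at t within {0..})"
    and t: "t \<ge> 0"
  shows "((\<lambda>t. integral {0..t} (\<lambda>s. k s *\<^sub>R f (t - s))) has_vector_derivative
    k t *\<^sub>R f 0 + integral {0..t} (\<lambda>s. k s *\<^sub>R f' (t - s))) (at t within {0..})"
proof -
  have fc: "continuous_on {0..} f"
    using f by (intro continuous_on_vector_derivative) auto
  define T where "T = t + 1"
  have T: "T > 0" "t < T" using t by (auto simp: T_def)
  \<comment> \<open>The antiderivative of f'(max y 0): it is \<open>f\<close> on the half-line and f
    0 + x f' 0 on [-T, 0]. The base point -T - 1 leaves room for two-sided derivatives on
    [-T, T].\<close>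
  define F where "F x = f 0 + (integral {-T-1..x} (\<lambda>y. f' (max y 0)) - integral {-T-1..0} (\<lambda>y. f' (max y 0)))" for x
  have F'c: "continuous_on S (\<lambda>x. f' (max x 0))" for S by (rule continuous_on_max0[OF f'])
  have F: "(F has_vector_derivative f' (max x 0)) (at x)" if "\<bar>x\<bar> \<le> T" for x
  proof -
    have "(F has_vector_derivative 0 + (f' (max x 0) - 0)) (at x within {-T-1..T+1})"
      unfolding F_def using that
      by (intro derivative_intros integral_has_vector_derivative F'c) auto
    then show ?thesis using that by (simp add: at_within_Icc_at)
  qed
  have Fpos: "F x = f x" if "x \<ge> 0" for x
  proof -
    have "((\<lambda>y. f' (max y 0)) has_integral f x - f 0) {0..x}"
      by (rule fundamental_theorem_of_calculus[OF that])
         (auto simp: max_def intro!: has_vector_derivative_within_subset[OF f])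
    moreover have "integral {-T-1..0} (\<lambda>y. f' (max y 0)) + integral {0..x} (\<lambda>y. f' (max y 0))
        = integral {-T-1..x} (\<lambda>y. f' (max y 0))"
      using that T by (intro Henstock_Kurzweil_Integration.integral_combine integrable_continuous_interval F'c) auto
    ultimately show ?thesis by (simp add: F_def integral_unique algebra_simps)
  qed
  have Fneg: "F x = f 0 + x *\<^sub>R f' 0" if "x \<le> 0" "-T \<le> x" for x
  proof -
    have "integral {-T-1..x} (\<lambda>y. f' (max y 0)) + integral {x..0} (\<lambda>y. f' (max y 0))
        = integral {-T-1..0} (\<lambda>y. f' (max y 0))"
      using that T by (intro Henstock_Kurzweil_Integration.integral_combine integrable_continuous_interval F'c) auto
    moreover have "integral {x..0} (\<lambda>y. f' (max y 0)) = integral {x..0} (\<lambda>y. f' 0)"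
      by (rule integral_cong) (auto simp: max_def)
    ultimately show ?thesis using that by (simp add: F_def algebra_simps)
  qed
  have Fc: "continuous_on {-T..T} F"
    by (intro continuous_at_imp_continuous_on ballI has_vector_derivative_continuous[OF F]) auto
  have kc: "continuous_on {a..b} k" if "0 \<le> a" for a b
    by (rule continuous_on_subset[OF k]) (use that in auto)
  \<comment> \<open>\<open>K\<close> and \<open>L\<close> are the moments of \<open>k\<close> of
    order 0 and 1; they express the integral over [x, T] of k(s) (f 0 + (x - s) f' 0).\<close>
  define K where "K x = integral {0..x} k" for x
  define L where "L x = integral {0..x} (\<lambda>s. k s * s)" for x
  have K': "(K has_vector_derivative k t) (at t within {0..T})"
    unfolding K_def using t T by (intro integral_has_vector_derivative kc) auto
  have L': "(L has_vector_derivative k t * t) (at t within {0..T})"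
    unfolding L_def using t T by (intro integral_has_vector_derivative continuous_intros kc) auto
  have FT: "((\<lambda>x. integral (cbox 0 T) (\<lambda>s. k s *\<^sub>R F (x - s))) has_vector_derivative
      integral (cbox 0 T) (\<lambda>s. k s *\<^sub>R f' (max (t - s) 0))) (at t within {0..T})"
  proof (rule leibniz_rule_vector_derivative)
    fix x s :: real assume x: "x \<in> {0..T}" "s \<in> cbox 0 T"
    have "((\<lambda>x. x - s) has_vector_derivative 1) (at x within {0..T})"
      by (auto intro!: derivative_eq_intros)
    moreover have "(F has_vector_derivative f' (max (x - s) 0)) (at (x - s) within (\<lambda>x. x - s) ` {0..T})"
      by (rule has_vector_derivative_at_within, rule F) (use x in auto)
    ultimately have "((\<lambda>x. F (x - s)) has_vector_derivative f' (max (x - s) 0)) (at x within {0..T})"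
      using vector_diff_chain_within[of "\<lambda>x. x - s" 1 x "{0..T}" F] by (simp add: o_def)
    then show "((\<lambda>x. k s *\<^sub>R F (x - s)) has_vector_derivative k s *\<^sub>R f' (max (x - s) 0)) (at x within {0..T})"
      by (rule bounded_linear.has_vector_derivative[OF bounded_linear_scaleR_right])
  next
    fix x :: real assume x: "x \<in> {0..T}"
    show "(\<lambda>s. k s *\<^sub>R F (x - s)) integrable_on cbox 0 T"
      using x by (auto intro!: integrable_continuous_interval continuous_intros kc
          continuous_on_compose2[OF Fc])
  next
    show "continuous_on ({0..T} \<times> cbox 0 T) (\<lambda>(x, s). k s *\<^sub>R f' (max (x - s) 0))"
      by (auto simp: case_prod_unfold intro!: continuous_intros
          continuous_on_compose2[OF k] continuous_on_compose2[OF f'])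
  qed (use t T in auto)
  have split: "integral {0..T} h = integral {0..x} h + integral {x..T} h"
    if "continuous_on {0..T} h" "x \<in> {0..T}" for x and h :: "real \<Rightarrow> 'c::banach"
    using that by (intro Henstock_Kurzweil_Integration.integral_combine[symmetric] integrable_continuous_interval) auto
  have tail: "(k has_integral (K T - K x)) {x..T}" "((\<lambda>s. k s * s) has_integral (L T - L x)) {x..T}"
    if x: "x \<in> {0..T}" for x
  proof -
    have c: "continuous_on {0..T} (\<lambda>s. k s * s)" by (intro continuous_intros kc) simp
    have "k integrable_on {x..T}" "(\<lambda>s. k s * s) integrable_on {x..T}"
      using x by (auto intro!: integrable_continuous_interval continuous_intros kc)
    moreover have "integral {x..T} k = K T - K x" "integral {x..T} (\<lambda>s. k s * s) = L T - L x"
      using split[OF kc x] split[OF c x] by (simp_all add: K_def L_def)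
    ultimately show "(k has_integral (K T - K x)) {x..T}" "((\<lambda>s. k s * s) has_integral (L T - L x)) {x..T}"
      by (metis integrable_integral)+
  qed
  have S: "integral (cbox 0 T) (\<lambda>s. k s *\<^sub>R F (x - s)) - (K T - K x) *\<^sub>R f 0
      - (x * (K T - K x) - (L T - L x)) *\<^sub>R f' 0 = integral {0..x} (\<lambda>s. k s *\<^sub>R f (x - s))"
    if x: "x \<in> {0..T}" for x
  proof -
    have "integral {0..T} (\<lambda>s. k s *\<^sub>R F (x - s))
        = integral {0..x} (\<lambda>s. k s *\<^sub>R F (x - s)) + integral {x..T} (\<lambda>s. k s *\<^sub>R F (x - s))"
      using x by (intro split) (auto intro!: continuous_intros kc continuous_on_compose2[OF Fc])
    also have "integral {0..x} (\<lambda>s. k s *\<^sub>R F (x - s)) = integral {0..x} (\<lambda>s. k s *\<^sub>R f (x - s))"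
      by (rule integral_cong) (simp add: Fpos)
    also have "integral {x..T} (\<lambda>s. k s *\<^sub>R F (x - s))
        = integral {x..T} (\<lambda>s. k s *\<^sub>R f 0 + (x * k s - k s * s) *\<^sub>R f' 0)"
      by (rule integral_cong) (use x in \<open>simp add: Fneg algebra_simps\<close>)
    also have "\<dots> = (K T - K x) *\<^sub>R f 0 + (x * (K T - K x) - (L T - L x)) *\<^sub>R f' 0"
      by (intro integral_unique has_integral_add has_integral_scaleR_left has_integral_diff
          has_integral_mult_right tail x)
    finally show ?thesis by simp
  qed
  have D: "integral (cbox 0 T) (\<lambda>s. k s *\<^sub>R f' (max (t - s) 0)) - (K T - K t) *\<^sub>R f' 0
     = integral {0..t} (\<lambda>s. k s *\<^sub>R f' (t - s))"
  proof -
    have "integral {0..T} (\<lambda>s. k s *\<^sub>R f' (max (t - s) 0))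
        = integral {0..t} (\<lambda>s. k s *\<^sub>R f' (max (t - s) 0)) + integral {t..T} (\<lambda>s. k s *\<^sub>R f' (max (t - s) 0))"
      using t T by (intro split) (auto intro!: continuous_intros kc continuous_on_compose2[OF f'])
    also have "integral {0..t} (\<lambda>s. k s *\<^sub>R f' (max (t - s) 0)) = integral {0..t} (\<lambda>s. k s *\<^sub>R f' (t - s))"
      by (rule integral_cong) simp
    also have "integral {t..T} (\<lambda>s. k s *\<^sub>R f' (max (t - s) 0)) = integral {t..T} (\<lambda>s. k s *\<^sub>R f' 0)"
      by (rule integral_cong) (simp add: max_def)
    also have "\<dots> = (K T - K t) *\<^sub>R f' 0" 
      by (rule integral_unique, rule has_integral_scaleR_left, rule tail(1)) (use t T in simp)
    finally show ?thesis by simp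
  qed
  have "((\<lambda>x. integral (cbox 0 T) (\<lambda>s. k s *\<^sub>R F (x - s)) - (K T - K x) *\<^sub>R f 0
      - (x * (K T - K x) - (L T - L x)) *\<^sub>R f' 0) has_vector_derivative
      k t *\<^sub>R f 0 + integral {0..t} (\<lambda>s. k s *\<^sub>R f' (t - s))) (at t within {0..T})"
    by (rule derivative_eq_intros FT K'[folded has_real_derivative_iff_has_vector_derivative]
          L'[folded has_real_derivative_iff_has_vector_derivative] refl)+
       (simp add: D[symmetric] algebra_simps)
  then have "((\<lambda>x. integral {0..x} (\<lambda>s. k s *\<^sub>R f (x - s))) has_vector_derivative
      k t *\<^sub>R f 0 + integral {0..t} (\<lambda>s. k s *\<^sub>R f' (t - s))) (at t within {0..T})"
    by (rule has_vector_derivative_transform[rotated 2]) (use S t T in auto)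
  moreover have "at t within {0..} = at t within {0..T}"
    by (rule at_within_nhd[of _ "{..<T}"]) (use t T in auto)
  ultimately show ?thesis by simp
qed

text \<open>Integrating by parts moves the derivative back onto the kernel; \<open>\<mu>\<close> may be unbounded at \<open>0\<close>.\<close>

lemma conv_has_vector_derivative_by_parts:
  fixes f :: "real \<Rightarrow> 'b::banach"
  assumes k: "continuous_on {0..} k" and f': "continuous_on {0..} f'"
    and f: "\<And>t. t \<ge> 0 \<Longrightarrow> (f has_vector_derivative f' t) (at t within {0..})"
    and k': "\<And>s. s > 0 \<Longrightarrow> (k has_real_derivative - \<mu> s) (at s)"
    and t: "t \<ge> 0"
  shows "(\<lambda>s. \<mu> s *\<^sub>R f (t - s)) integrable_on {0..t}"
    and "((\<lambda>t. integral {0..t} (\<lambda>s. k s *\<^sub>R f (t - s))) has_vector_derivative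
      k 0 *\<^sub>R f t - integral {0..t} (\<lambda>s. \<mu> s *\<^sub>R f (t - s))) (at t within {0..})"
    and "k t *\<^sub>R f 0 + integral {0..t} (\<lambda>s. k s *\<^sub>R f' (t - s))
      = k 0 *\<^sub>R f t - integral {0..t} (\<lambda>s. \<mu> s *\<^sub>R f (t - s))"
proof -
  have fc: "continuous_on {0..} f"
    using f by (intro continuous_on_vector_derivative) auto
  \<comment> \<open>\<open>k\<close> is differentiable for s > 0 only, so the interior form of the
    fundamental theorem is used; it delivers integrability together with the value.\<close>
  have "((\<lambda>s. - \<mu> s *\<^sub>R f (t - s) - k s *\<^sub>R f' (t - s)) has_integral
      (k t *\<^sub>R f (t - t) - k 0 *\<^sub>R f (t - 0))) {0..t}"
  proof (rule fundamental_theorem_of_calculus_interior[OF t])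
    show "continuous_on {0..t} (\<lambda>s. k s *\<^sub>R f (t - s))"
      by (auto intro!: continuous_intros continuous_on_compose2[OF fc] continuous_on_subset[OF k])
    fix s assume s: "s \<in> {0<..<t}"
    have "(f has_vector_derivative f' (t - s)) (at (t - s))"
    proof -
      have "at (t - s) within {0..} = at (t - s)"
        by (rule at_within_interior) (use s in \<open>simp add: interior_real_atLeast\<close>)
      then show ?thesis using f[of "t - s"] s by simp
    qed
    moreover have "((\<lambda>s. t - s) has_vector_derivative - 1) (at s)"
      by (auto intro!: derivative_eq_intros)
    ultimately have "((\<lambda>s. f (t - s)) has_vector_derivative - f' (t - s)) (at s)"
      using vector_diff_chain_at[of "\<lambda>s. t - s" "- 1" s f] by (simp add: o_def)
    then show "((\<lambda>s. k s *\<^sub>R f (t - s)) has_vector_derivative - \<mu> s *\<^sub>R f (t - s) - k s *\<^sub>R f' (t - s)) (at s)"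
      using k'[of s] s by (auto intro!: derivative_eq_intros)
  qed
  from has_integral_add[OF this integrable_integral[OF conv_integrable[OF k f', of t]]]
  have "((\<lambda>s. - \<mu> s *\<^sub>R f (t - s)) has_integral
      k t *\<^sub>R f 0 - k 0 *\<^sub>R f t + integral {0..t} (\<lambda>s. k s *\<^sub>R f' (t - s))) {0..t}"
    by simp
  from has_integral_neg[OF this]
  have I: "((\<lambda>s. \<mu> s *\<^sub>R f (t - s)) has_integral
      k 0 *\<^sub>R f t - (k t *\<^sub>R f 0 + integral {0..t} (\<lambda>s. k s *\<^sub>R f' (t - s)))) {0..t}"
    by (simp add: algebra_simps)
  show "(\<lambda>s. \<mu> s *\<^sub>R f (t - s)) integrable_on {0..t}" using I by blast
  show eq: "k t *\<^sub>R f 0 + integral {0..t} (\<lambda>s. k s *\<^sub>R f' (t - s))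
      = k 0 *\<^sub>R f t - integral {0..t} (\<lambda>s. \<mu> s *\<^sub>R f (t - s))"
    using integral_unique[OF I] by (simp add: algebra_simps)
  show "((\<lambda>t. integral {0..t} (\<lambda>s. k s *\<^sub>R f (t - s))) has_vector_derivative
      k 0 *\<^sub>R f t - integral {0..t} (\<lambda>s. \<mu> s *\<^sub>R f (t - s))) (at t within {0..})"
    using conv_has_vector_derivative[OF k f' f t] unfolding eq .
qed

text \<open>The memory functional is not differentiable in time, so the decay estimate is stated for a
  function that is touched from above by differentiable functions.\<close>

lemma exponential_decay_touching:
  fixes F :: "real \<Rightarrow> real"
  assumes F: "continuous_on {0..} F"
    and touch: "\<And>t. t \<ge> 0 \<Longrightarrow> \<exists>G D. (G has_real_derivative D) (at t within {t..}) \<and> D \<le> - c * F t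
      \<and> G t = F t \<and> (\<forall>\<^sub>F x in at_right t. F x \<le> G x)"
    and T: "T \<ge> 0"
  shows "F T \<le> F 0 * exp (- c * T)"
proof -
  define H where "H t = exp (c * t) * F t" for t
  have Hc: "continuous_on {0..} H" unfolding H_def by (intro continuous_intros F)
  have "H T \<le> H 0"
  proof (rule field_le_epsilon)
    fix e0 :: real assume "e0 > 0"
    define e where "e = e0 / (T + 1)"
    have e: "e > 0" using \<open>e0 > 0\<close> T by (simp add: e_def)
    have "H T \<le> H 0 + e * T"
    proof (rule ccontr)
      assume neg: "\<not> ?thesis"
      \<comment> \<open>The supremum \<open>s\<close> of this closed set is the last time at which H
        x <= H 0 + e x. The touching function at \<open>s\<close>, weighted by the exponential, has
        nonpositive slope, so the bound persists beyond \<open>s\<close>; the slack \<open>e\<close>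
        pays for the error of linearisation.\<close>
      define X where "X = {x\<in>{0..T}. H x \<le> H 0 + e * x}"
      have X: "0 \<in> X" "X \<noteq> {}" "bdd_above X" using T by (auto simp: X_def)
      have "closed X" unfolding X_def
        by (intro continuous_on_closed_Collect_le continuous_on_subset[OF Hc] continuous_intros) auto
      define s where "s = Sup X"
      have sX: "s \<in> X" unfolding s_def using closed_contains_Sup[OF X(2,3) \<open>closed X\<close>] .
      then have s: "0 \<le> s" "s < T" "H s \<le> H 0 + e * s"
        using neg by (auto simp: X_def less_le)
      obtain G D where G: "(G has_real_derivative D) (at s within {s..})" "D \<le> - c * F s"
          "G s = F s" "\<forall>\<^sub>F x in at_right s. F x \<le> G x"
        using touch[OF s(1)] by blast
      have "((\<lambda>x. exp (c * x) * G x) has_real_derivative exp (c * s) * (c * F s + D)) (at s within {s..})"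
        by (auto intro!: derivative_eq_intros G(1) simp: G(3) algebra_simps)
      moreover have "exp (c * s) * (c * F s + D) \<le> 0"
        using G(2) by (intro mult_nonneg_nonpos) auto
      ultimately have "((\<lambda>x. exp (c * x) * G x) has_derivative (*) (exp (c * s) * (c * F s + D))) (at s within {s..})"
        by (simp add: has_field_derivative_def)
      then obtain r where r: "r > 0" "\<And>y. y \<in> {s..} \<Longrightarrow> norm (y - s) < r \<Longrightarrow>
          norm (exp (c * y) * G y - exp (c * s) * G s - exp (c * s) * (c * F s + D) * (y - s)) \<le> e * norm (y - s)"
        using e unfolding has_derivative_within_alt by blast
      obtain b where b: "b > s" "\<And>y. y > s \<Longrightarrow> y < b \<Longrightarrow> F y \<le> G y"
        using G(4) unfolding eventually_at_right_field by blast
      define y where "y = (s + min T (min b (s + r))) / 2"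
      have y: "s < y" "y < T" "y < b" "y < s + r"
        using s b(1) r(1) by (auto simp: y_def min_def field_simps)
      have "\<bar>exp (c * y) * G y - H s - exp (c * s) * (c * F s + D) * (y - s)\<bar> \<le> e * (y - s)"
        using r(2)[of y] y by (simp add: H_def G(3))
      moreover have "exp (c * s) * (c * F s + D) * (y - s) \<le> 0"
        by (rule mult_nonpos_nonneg[OF \<open>exp (c * s) * (c * F s + D) \<le> 0\<close>]) (use y in simp)
      moreover have "H y \<le> exp (c * y) * G y" using b(2)[OF y(1,3)] by (simp add: H_def)
      moreover have "e * (y - s) = e * y - e * s" by (simp add: algebra_simps)
      ultimately have "H y \<le> H 0 + e * y" using s(3) by linarith
      then have "y \<in> X" using y s by (auto simp: X_def)
      then have "y \<le> s" unfolding s_def by (rule cSup_upper[OF _ X(3)])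
      then show False using y by simp
    qed
    also have "\<dots> \<le> H 0 + e0" using T \<open>e0 > 0\<close> by (simp add: e_def field_simps)
    finally show "H T \<le> H 0 + e0" .
  qed
  then have le: "exp (c * T) * F T \<le> F 0" by (simp add: H_def)
  have e1: "exp (- c * T) * exp (c * T) = 1" by (simp flip: exp_add)
  have "F T = exp (- c * T) * (exp (c * T) * F T)" unfolding mult.assoc[symmetric] e1 by simp
  also have "\<dots> \<le> exp (- c * T) * F 0" by (intro mult_left_mono le) simp
  finally show ?thesis by (simp only: mult.commute[of "F 0"])
qed

section \<open>The memory terms\<close>

lemma has_real_derivative_inner:
  assumes "(x has_vector_derivative x') (at t within S)" "(y has_vector_derivative y') (at t within S)"
  shows "((\<lambda>t. inner (x t) (y t)) has_real_derivative inner (x t) y' + inner x' (y t)) (at t within S)"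
  using bounded_bilinear.has_vector_derivative[OF bounded_bilinear_inner assms]
  by (simp add: has_real_derivative_iff_has_vector_derivative)

lemma has_real_derivative_blinfun_apply:
  fixes x :: "real \<Rightarrow> 'a::real_normed_vector \<Rightarrow>\<^sub>L real"
  assumes "(x has_vector_derivative x') (at t within S)" "(y has_vector_derivative y') (at t within S)"
  shows "((\<lambda>t. x t (y t)) has_real_derivative x t y' + x' (y t)) (at t within S)"
  using bounded_bilinear.has_vector_derivative[OF bounded_bilinear_blinfun_apply assms]
  by (simp add: has_real_derivative_iff_has_vector_derivative)

text \<open>In the application \<open>k\<close> is g extended to 0, \<open>\<mu>\<close> is - g',
  \<open>\<kappa>\<close> is the total mass of g and \<open>\<rho>\<close> is \<alpha> - \<delta>.
  The clause \<open>\<mu>_grow\<close> is (g3) in integrated form, free of second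
  derivatives.\<close>

locale memory_kernel =
  fixes k \<mu> :: "real \<Rightarrow> real" and \<rho> \<kappa> M \<omega> :: real
  assumes k_cont: "continuous_on {0..} k"
    and k_deriv: "\<And>s. s > 0 \<Longrightarrow> (k has_real_derivative - \<mu> s) (at s)"
    and \<mu>_nonneg: "\<And>s. s \<ge> 0 \<Longrightarrow> 0 \<le> \<mu> s"
    and \<mu>_grow: "\<And>s h. s > 0 \<Longrightarrow> h \<ge> 0 \<Longrightarrow> \<mu> (s + h) \<le> exp (\<rho> * h) * \<mu> s"
    and k_nonneg: "\<And>s. s \<ge> 0 \<Longrightarrow> 0 \<le> k s"
    and k_le: "\<And>s. s \<ge> 0 \<Longrightarrow> k s \<le> M * exp (- \<omega> * s)"
    and k_integral_le: "\<And>t. t \<ge> 0 \<Longrightarrow> integral {0..t} k \<le> \<kappa>"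
    and k_tail_le: "\<And>t. t \<ge> 0 \<Longrightarrow> \<kappa> - integral {0..t} k \<le> M / \<omega> * exp (- \<omega> * t)"
    and M_pos: "M > 0" and \<omega>_pos: "\<omega> > 0"
begin

lemma k_cont_on: "0 \<le> a \<Longrightarrow> continuous_on {a..b} k"
  by (rule continuous_on_subset[OF k_cont]) auto

lemma \<kappa>_nonneg: "0 \<le> \<kappa>"
  using k_integral_le[of 0] by simp

lemma \<mu>_has_integral:
  assumes "0 \<le> t"
  shows "(\<mu> has_integral (k 0 - k t)) {0..t}"
proof -
  have "((\<lambda>s. - \<mu> s) has_integral (k t - k 0)) {0..t}"
    by (rule fundamental_theorem_of_calculus_interior[OF assms k_cont_on])
       (auto simp: k_deriv simp flip: has_real_derivative_iff_has_vector_derivative)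
  from has_integral_neg[OF this] show ?thesis by simp
qed

lemma k_antimono: "0 \<le> s \<Longrightarrow> s \<le> t \<Longrightarrow> k t \<le> k s"
proof -
  assume st: "0 \<le> s" "s \<le> t"
  have "((\<lambda>s. - \<mu> s) has_integral (k t - k s)) {s..t}"
    using st by (intro fundamental_theorem_of_calculus_interior k_cont_on)
       (auto simp: k_deriv simp flip: has_real_derivative_iff_has_vector_derivative)
  from has_integral_neg[OF this] have "(\<mu> has_integral (k s - k t)) {s..t}" by simp
  then have "0 \<le> k s - k t" by (rule has_integral_nonneg) (use st in \<open>simp add: \<mu>_nonneg\<close>)
  then show ?thesis by simp
qed

text \<open>\<open>\<mu>\<close> may blow up at 0, but a nonnegative function with a finite integral
  is absolutely integrable, and a continuous factor is bounded on [0, t].\<close>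

lemma \<mu>_mult_integrable:
  assumes "continuous_on {0..t} h"
  shows "(\<lambda>s. \<mu> s * h s) integrable_on {0..t}"
proof (cases "t \<ge> 0")
  case True
  have "\<mu> absolutely_integrable_on {0..t}"
    using \<mu>_has_integral[OF True] \<mu>_nonneg
    by (intro nonnegative_absolutely_integrable_1) auto
  moreover have "h \<in> borel_measurable (lebesgue_on {0..t})"
    using assms by (intro continuous_imp_measurable_on_sets_lebesgue) auto
  moreover have "bounded (h ` {0..t})"
    using assms by (intro compact_imp_bounded compact_continuous_image) auto
  ultimately have "(\<lambda>s. h s * \<mu> s) absolutely_integrable_on {0..t}"
    by (intro absolutely_integrable_bounded_measurable_product_real) auto
  then show ?thesis by (auto simp: mult.commute dest: set_lebesgue_integral_eq_integral(1))
qed (simp add: integrable_on_empty)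

end

text \<open>In the application \<open>u\<close>, \<open>v\<close>, \<open>w\<close> are a regularised solution and its time derivatives and
  \<open>p\<close>, \<open>q\<close>, \<open>z\<close> their images under \<open>A\<^sup>1\<^sup>/\<^sup>2\<close>, so that \<open>\<parallel>u\<parallel>\<^sub>1 = norm p\<close>. The equation is
  only needed tested with \<open>u\<close>, \<open>v\<close> and \<open>w\<close>.\<close>

locale mgt_solution = memory_kernel +
  fixes \<alpha> \<beta> \<gamma> c :: real and u v w f :: "real \<Rightarrow> 'a::real_inner" and p q z :: "real \<Rightarrow> 'b::real_inner"
  assumes du: "\<And>t. t \<ge> 0 \<Longrightarrow> (u has_vector_derivative v t) (at t within {0..})"
    and dv: "\<And>t. t \<ge> 0 \<Longrightarrow> (v has_vector_derivative w t) (at t within {0..})"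
    and dw: "\<And>t. t \<ge> 0 \<Longrightarrow> (w has_vector_derivative f t) (at t within {0..})"
    and dp: "\<And>t. t \<ge> 0 \<Longrightarrow> (p has_vector_derivative q t) (at t within {0..})"
    and dq: "\<And>t. t \<ge> 0 \<Longrightarrow> (q has_vector_derivative z t) (at t within {0..})"
    and eq: "\<And>t x \<xi>. t \<ge> 0 \<Longrightarrow> (x, \<xi>) \<in> {(u, p), (v, q), (w, z)} \<Longrightarrow>
      inner (f t) (x t) = - \<alpha> * inner (w t) (x t) - \<beta> * inner (q t) (\<xi> t) - \<gamma> * inner (p t) (\<xi> t)
        + integral {0..t} (\<lambda>s. k s * inner (p (t - s)) (\<xi> t))"
    and poincare: "\<And>t. t \<ge> 0 \<Longrightarrow> norm (u t) \<le> c * norm (p t)" "\<And>t. t \<ge> 0 \<Longrightarrow> norm (v t) \<le> c * norm (q t)"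
begin

lemma p_cont: "continuous_on {0..} p" and q_cont: "continuous_on {0..} q"
  using dp dq by (auto intro!: continuous_on_vector_derivative)

text \<open>The sort \<open>{real_inner, complete_space}\<close> does not entail \<open>banach\<close>, as the integration theory
  requires. Vector-valued integrals are therefore taken in the dual space.\<close>

definition P :: "real \<Rightarrow> 'b \<Rightarrow>\<^sub>L real" where
  "P t = blinfun_inner_right (p t)"

lemma P_apply [simp]: "P t x = inner (p t) x"
  by (simp add: P_def)

lemma dP: "t \<ge> 0 \<Longrightarrow> (P has_vector_derivative blinfun_inner_right (q t)) (at t within {0..})"
  unfolding P_def by (rule bounded_linear.has_vector_derivative[OF bounded_linear_blinfun_inner_right dp])

lemma P'_cont: "continuous_on {0..} (\<lambda>t. blinfun_inner_right (q t) :: 'b \<Rightarrow>\<^sub>L real)"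
  by (intro bounded_linear.continuous_on[OF bounded_linear_blinfun_inner_right] q_cont)

definition sqp :: "real \<Rightarrow> real" where
  "sqp t = (norm (p t))\<^sup>2"

lemma dsqp: "t \<ge> 0 \<Longrightarrow> (sqp has_vector_derivative 2 * inner (p t) (q t)) (at t within {0..})"
  using has_real_derivative_inner[OF dp dp, of t]
  by (simp add: sqp_def[abs_def] power2_norm_eq_inner inner_commute has_real_derivative_iff_has_vector_derivative)

lemma sqp'_cont: "continuous_on {0..} (\<lambda>t. 2 * inner (p t) (q t))"
  by (intro continuous_intros p_cont q_cont)

lemma sqp_cont: "continuous_on {0..} sqp"
  unfolding sqp_def[abs_def] by (intro continuous_intros p_cont)

definition K :: "real \<Rightarrow> 'b \<Rightarrow>\<^sub>L real" where
  "K t = integral {0..t} (\<lambda>s. k s *\<^sub>R P (t - s))"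

text \<open>\<open>m\<close> and \<open>n\<close> are the first and second moments of the past under
  \<open>\<mu>\<close>; they arise when the square in \<open>Mem\<close> is expanded.\<close>

definition m :: "real \<Rightarrow> 'b \<Rightarrow>\<^sub>L real" where
  "m t = integral {0..t} (\<lambda>s. \<mu> s *\<^sub>R P (t - s))"

definition n :: "real \<Rightarrow> real" where
  "n t = integral {0..t} (\<lambda>s. \<mu> s * sqp (t - s))"

definition \<Xi> :: "real \<Rightarrow> real" where
  "\<Xi> t = integral {0..t} (\<lambda>s. k s * sqp (t - s))"

definition Mem :: "real \<Rightarrow> real" where
  "Mem t = integral {0..t} (\<lambda>s. \<mu> s * (norm (p t - p (t - s)))\<^sup>2)"

lemma dK: "t \<ge> 0 \<Longrightarrow> (K has_vector_derivative k 0 *\<^sub>R P t - m t) (at t within {0..})"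
  unfolding K_def m_def by (rule conv_has_vector_derivative_by_parts(2)[OF k_cont P'_cont dP k_deriv])

lemma d\<Xi>: "t \<ge> 0 \<Longrightarrow> (\<Xi> has_real_derivative k 0 * sqp t - n t) (at t within {0..})"
  using conv_has_vector_derivative_by_parts(2)[OF k_cont sqp'_cont dsqp k_deriv]
  by (simp add: \<Xi>_def[abs_def] n_def has_real_derivative_iff_has_vector_derivative)

text \<open>Integration by parts expresses \<open>m\<close> through the continuous kernel
  \<open>k\<close> instead of \<open>\<mu>\<close>; \<open>n_cont\<close> proceeds likewise.\<close>

lemma m_cont: "continuous_on {0..} m"
proof -
  have "continuous_on {0..} (\<lambda>t. k 0 *\<^sub>R P t - (k t *\<^sub>R P 0 + integral {0..t} (\<lambda>s. k s *\<^sub>R blinfun_inner_right (q (t - s)))))"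
    using dP by (intro continuous_intros conv_continuous k_cont P'_cont continuous_on_vector_derivative) auto
  then show ?thesis
    by (rule continuous_on_eq)
       (use conv_has_vector_derivative_by_parts(3)[OF k_cont P'_cont dP k_deriv] in \<open>auto simp: m_def\<close>)
qed

lemma n_cont: "continuous_on {0..} n"
proof -
  have "continuous_on {0..} (\<lambda>t. k 0 *\<^sub>R sqp t - (k t *\<^sub>R sqp 0 + integral {0..t} (\<lambda>s. k s *\<^sub>R (2 * inner (p (t - s)) (q (t - s))))))"
    by (intro continuous_intros conv_continuous k_cont sqp'_cont sqp_cont)
  then show ?thesis
    by (rule continuous_on_eq)
       (use conv_has_vector_derivative_by_parts(3)[OF k_cont sqp'_cont dsqp k_deriv] in \<open>auto simp: n_def\<close>)
qed

lemma K_apply: "t \<ge> 0 \<Longrightarrow> ((\<lambda>s. k s * inner (p (t - s)) x) has_integral K t x) {0..t}"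
proof -
  assume "t \<ge> 0"
  have "continuous_on {0..} P" using dP by (intro continuous_on_vector_derivative) auto
  then have "((\<lambda>s. k s *\<^sub>R P (t - s)) has_integral K t) {0..t}"
    unfolding K_def by (intro integrable_integral conv_integrable k_cont)
  from has_integral_linear[OF this blinfun.bounded_linear_left[of x]]
  show ?thesis by (simp add: o_def blinfun.scaleR_left)
qed

lemma m_apply: "t \<ge> 0 \<Longrightarrow> ((\<lambda>s. \<mu> s * inner (p (t - s)) x) has_integral m t x) {0..t}"
proof -
  assume "t \<ge> 0"
  then have "((\<lambda>s. \<mu> s *\<^sub>R P (t - s)) has_integral m t) {0..t}"
    unfolding m_def using conv_has_vector_derivative_by_parts(1)[OF k_cont P'_cont dP k_deriv]
    by (intro integrable_integral) auto
  from has_integral_linear[OF this blinfun.bounded_linear_left[of x]]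
  show ?thesis by (simp add: o_def blinfun.scaleR_left)
qed

lemma p_shift_cont: "continuous_on {0..t} (\<lambda>s. p (t - s))"
  by (rule continuous_on_compose2[OF p_cont]) (auto intro!: continuous_intros)

text \<open>The vector \<open>y\<close> is arbitrary because \<open>Mem_touch\<close> takes y = p x
  with x > t while the past up to t stays frozen.\<close>

lemma sq_integral:
  assumes "t \<ge> 0"
  shows "((\<lambda>s. \<mu> s * (norm (y - p (t - s)))\<^sup>2) has_integral
    (k 0 - k t) * (norm y)\<^sup>2 - 2 * m t y + n t) {0..t}"
proof -
  have "(\<lambda>s. \<mu> s * sqp (t - s)) integrable_on {0..t}"
    unfolding sqp_def by (intro \<mu>_mult_integrable continuous_intros p_shift_cont)
  then have "((\<lambda>s. \<mu> s * sqp (t - s)) has_integral n t) {0..t}"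
    unfolding n_def by (rule integrable_integral)
  with has_integral_mult_left[OF \<mu>_has_integral[OF assms], of "(norm y)\<^sup>2"]
    has_integral_mult_right[OF m_apply[OF assms], of 2 y]
  have "((\<lambda>s. \<mu> s * (norm y)\<^sup>2 - 2 * (\<mu> s * inner (p (t - s)) y) + \<mu> s * sqp (t - s)) has_integral
      (k 0 - k t) * (norm y)\<^sup>2 - 2 * m t y + n t) {0..t}"
    by (intro has_integral_add has_integral_diff)
  then show ?thesis
    by (rule has_integral_eq[rotated])
       (simp add: sqp_def power2_norm_eq_inner inner_diff_left inner_diff_right inner_commute algebra_simps)
qed

lemma Mem_eq: "t \<ge> 0 \<Longrightarrow> Mem t = (k 0 - k t) * sqp t - 2 * m t (p t) + n t"
  unfolding Mem_def sqp_def by (rule integral_unique[OF sq_integral])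

lemma Mem_nonneg: "0 \<le> Mem t"
  unfolding Mem_def by (intro integral_nonneg \<mu>_mult_integrable) (auto simp: \<mu>_nonneg intro!: continuous_intros p_shift_cont)

lemma Mem_cont: "continuous_on {0..} Mem"
proof -
  have "continuous_on {0..} (\<lambda>t. (k 0 - k t) * sqp t - 2 * m t (p t) + n t)"
    by (intro continuous_intros k_cont sqp_cont n_cont bounded_bilinear.continuous_on[OF bounded_bilinear_blinfun_apply] m_cont p_cont)
  then show ?thesis by (rule continuous_on_eq) (simp add: Mem_eq)
qed

text \<open>Makes the memory integral over lags s <= h of order h^2, invisible to a first
  derivative.\<close>

lemma p_lipschitz:
  assumes "0 \<le> T"
  shows "\<exists>B\<ge>0. \<forall>x\<in>{0..T}. \<forall>y\<in>{0..T}. norm (p x - p y) \<le> B * \<bar>x - y\<bar>"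
proof -
  have "compact (q ` {0..T})"
    by (intro compact_continuous_image continuous_on_subset[OF q_cont]) auto
  then obtain B where B: "B > 0" "\<And>t. t \<in> {0..T} \<Longrightarrow> norm (q t) \<le> B"
    using bounded_pos compact_imp_bounded by (metis imageI)
  have "norm (p x - p y) \<le> B * norm (x - y)" if "x \<in> {0..T}" "y \<in> {0..T}" for x y
  proof (rule differentiable_bound[OF _ _ _ that])
    fix t assume t: "t \<in> {0..T}"
    show "(p has_derivative (\<lambda>h. h *\<^sub>R q t)) (at t within {0..T})"
      using has_vector_derivative_within_subset[OF dp, of t "{0..T}"] t
      by (auto simp: has_vector_derivative_def)
    show "onorm (\<lambda>h. h *\<^sub>R q t) \<le> B"
      using B t by (intro onorm_bound) (auto simp: mult.commute[of B] mult_left_mono)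
  qed auto
  then show ?thesis using B(1) by (auto intro!: exI[of _ B])
qed

text \<open>Shifting \<open>s\<close> by \<open>x - t\<close> and using the growth bound on \<open>\<mu>\<close> replaces a differentiation of \<open>\<mu>\<close>,
  whose derivative need not be integrable near \<open>0\<close>.\<close>

lemma Mem_touch:
  assumes t: "t \<ge> 0"
  shows "\<exists>C. \<forall>x. t < x \<longrightarrow> x < t + 1 \<longrightarrow>
    Mem x \<le> C * (x - t)\<^sup>2 + exp (\<rho> * (x - t)) * ((k 0 - k t) * sqp x - 2 * m t (p x) + n t)"
proof -
  obtain B where B: "B \<ge> 0" "\<And>x y. x \<in> {0..t+1} \<Longrightarrow> y \<in> {0..t+1} \<Longrightarrow> norm (p x - p y) \<le> B * \<bar>x - y\<bar>"
    using p_lipschitz[of "t + 1"] t by auto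
  have "Mem x \<le> (B\<^sup>2 * k 0) * (x - t)\<^sup>2 + exp (\<rho> * (x - t)) * ((k 0 - k t) * sqp x - 2 * m t (p x) + n t)"
    if x: "t < x" "x < t + 1" for x
  proof -
    define h where "h = x - t"
    have h: "0 < h" "h \<le> x" "x = t + h" using x t by (auto simp: h_def)
    define G where "G s = \<mu> s * (norm (p x - p (x - s)))\<^sup>2" for s
    have Gint: "G integrable_on {0..x}"
      unfolding G_def by (intro \<mu>_mult_integrable continuous_intros p_shift_cont)
    \<comment> \<open>Lags up to h = x - t see only times in [t, x] and give O(h^2); longer lags,
      shifted by h, meet the same past values p (t - s) as at time t.\<close>
    have "Mem x = integral {0..h} G + integral {h..x} G"
      unfolding Mem_def G_def[symmetric]
      using h by (intro Henstock_Kurzweil_Integration.integral_combine[symmetric] Gint) auto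
    also have "integral {0..h} G \<le> (B\<^sup>2 * k 0) * h\<^sup>2"
    proof -
      have "integral {0..h} G \<le> integral {0..h} (\<lambda>s. \<mu> s * (B * h)\<^sup>2)"
      proof (rule integral_le)
        show "G integrable_on {0..h}" by (rule integrable_on_subinterval[OF Gint]) (use h in auto)
        show "(\<lambda>s. \<mu> s * (B * h)\<^sup>2) integrable_on {0..h}" by (intro \<mu>_mult_integrable continuous_intros)
        fix s assume s: "s \<in> {0..h}"
        have "norm (p x - p (x - s)) \<le> B * \<bar>x - (x - s)\<bar>" using s h x t by (intro B(2)) auto
        also have "\<dots> \<le> B * h" using s B(1) by (intro mult_left_mono) auto
        finally show "G s \<le> \<mu> s * (B * h)\<^sup>2"
          unfolding G_def using s by (intro mult_left_mono power_mono \<mu>_nonneg) auto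
      qed
      also have "\<dots> = (k 0 - k h) * (B * h)\<^sup>2"
        using h by (intro integral_unique has_integral_mult_left \<mu>_has_integral) auto
      also have "\<dots> \<le> k 0 * (B * h)\<^sup>2" using h k_nonneg[of h] by (intro mult_right_mono) auto
      finally show ?thesis by (simp add: power_mult_distrib mult_ac)
    qed
    also have "integral {h..x} G \<le> exp (\<rho> * h) * ((k 0 - k t) * sqp x - 2 * m t (p x) + n t)"
    proof -
      have sh: "G integrable_on {h..x}" by (rule integrable_on_subinterval[OF Gint]) (use h in auto)
      have "integral {h..x} G = integral {0..t} (\<lambda>s. G (s + h))"
        using integral_shift_real_ivl[of h h x G] h by simp
      \<comment> \<open>The growth bound on \<open>\<mu>\<close> is available for s > 0 only, hence
        the open interval.\<close>
      also have "\<dots> = integral {0<..<t} (\<lambda>s. G (s + h))" by (simp add: integral_open_interval_real)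
      also have "\<dots> \<le> integral {0<..<t} (\<lambda>s. exp (\<rho> * h) * (\<mu> s * (norm (p x - p (t - s)))\<^sup>2))"
      proof (rule integral_le)
        show "(\<lambda>s. G (s + h)) integrable_on {0<..<t}"
          using integrable_shift_real_ivl[OF sh, of h] h by (simp add: integrable_on_open_interval_real)
        show "(\<lambda>s. exp (\<rho> * h) * (\<mu> s * (norm (p x - p (t - s)))\<^sup>2)) integrable_on {0<..<t}"
          unfolding integrable_on_open_interval_real
          by (intro integrable_on_mult_right \<mu>_mult_integrable continuous_intros p_shift_cont)
        fix s assume s: "s \<in> {0<..<t}"
        have "x - (s + h) = t - s" using h by simp
        then have "G (s + h) = \<mu> (s + h) * (norm (p x - p (t - s)))\<^sup>2" by (simp only: G_def)
        also have "\<dots> \<le> (exp (\<rho> * h) * \<mu> s) * (norm (p x - p (t - s)))\<^sup>2"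
          using s h by (intro mult_right_mono \<mu>_grow) auto
        finally show "G (s + h) \<le> exp (\<rho> * h) * (\<mu> s * (norm (p x - p (t - s)))\<^sup>2)" by simp
      qed
      also have "\<dots> = exp (\<rho> * h) * ((k 0 - k t) * (norm (p x))\<^sup>2 - 2 * m t (p x) + n t)"
        unfolding integral_open_interval_real[symmetric]
        by (intro integral_unique has_integral_mult_right sq_integral t)
      finally show ?thesis by (simp add: sqp_def)
    qed
    finally show ?thesis unfolding h_def by simp
  qed
  then show ?thesis by blast
qed

text \<open>Young's inequality with equal weights under k(s) ds, whose mass is at most
  \<open>\<kappa>\<close>; the equal weights let \<kappa> be compared with \<gamma> without
  loss.\<close>

lemma K_le:
  assumes t: "t \<ge> 0"
  shows "K t x \<le> \<kappa> / 2 * (norm x)\<^sup>2 + \<Xi> t / 2"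
proof -
  have k_int: "(k has_integral integral {0..t} k) {0..t}"
    by (intro integrable_integral integrable_continuous_interval k_cont_on) simp
  have \<Xi>_int: "((\<lambda>s. k s * sqp (t - s)) has_integral \<Xi> t) {0..t}"
    unfolding \<Xi>_def sqp_def
    by (intro integrable_integral integrable_continuous_interval continuous_intros k_cont_on p_shift_cont) simp
  have "K t x \<le> integral {0..t} k * ((norm x)\<^sup>2 / 2) + \<Xi> t / 2"
  proof (rule has_integral_le[OF K_apply[OF t]])
    show "((\<lambda>s. k s * ((norm x)\<^sup>2 / 2) + k s * sqp (t - s) / 2) has_integral
        integral {0..t} k * ((norm x)\<^sup>2 / 2) + \<Xi> t / 2) {0..t}"
      by (intro has_integral_add has_integral_mult_left k_int has_integral_divide \<Xi>_int)
    fix s assume s: "s \<in> {0..t}"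
    have "0 \<le> (norm (p (t - s) - x))\<^sup>2" by simp
    also have "\<dots> = sqp (t - s) - 2 * inner (p (t - s)) x + (norm x)\<^sup>2"
      by (simp add: sqp_def power2_norm_eq_inner inner_diff_left inner_diff_right inner_commute)
    finally have "inner (p (t - s)) x \<le> (norm x)\<^sup>2 / 2 + sqp (t - s) / 2" by simp
    from mult_left_mono[OF this k_nonneg[of s]] s
    show "k s * inner (p (t - s)) x \<le> k s * ((norm x)\<^sup>2 / 2) + k s * sqp (t - s) / 2"
      by (simp add: distrib_left)
  qed
  also have "integral {0..t} k * ((norm x)\<^sup>2 / 2) \<le> \<kappa> * ((norm x)\<^sup>2 / 2)"
    by (intro mult_right_mono k_integral_le t) simp
  finally show ?thesis by simp
qed

lemma K_ge: "t \<ge> 0 \<Longrightarrow> - K t x \<le> \<kappa> / 2 * (norm x)\<^sup>2 + \<Xi> t / 2"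
  using K_le[of t "- x"] by (simp add: blinfun.minus_right)

text \<open>The weight is the part of the mass \<open>\<kappa>\<close> beyond \<open>s\<close>, with
  derivative - k. Differentiating \<open>\<Theta>\<close> therefore produces - \<open>\<Xi>\<close>,
  which cancels the \<open>\<Xi>\<close> left behind by \<open>K_le\<close>.\<close>

definition \<Theta> :: "real \<Rightarrow> real" where
  "\<Theta> t = integral {0..t} (\<lambda>s. (\<kappa> - integral {0..s} k) * sqp (t - s))"

definition \<Psi> :: "real \<Rightarrow> real" where
  "\<Psi> t = integral {0..t} (\<lambda>s. exp (- \<omega> * s) * sqp (t - s))"

lemma exp_cont: "continuous_on {0..} (\<lambda>s. exp (- \<omega> * s))"
  by (intro continuous_intros)

lemma K0_deriv: "s \<ge> 0 \<Longrightarrow> ((\<lambda>s. integral {0..s} k) has_real_derivative k s) (at s within {0..})"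
proof -
  assume s: "s \<ge> 0"
  have "((\<lambda>s. integral {0..s} k) has_real_derivative k s) (at s within {0..s+1})"
    using s by (intro integral_has_real_derivative k_cont_on) auto
  moreover have "at s within {0..} = at s within {0..s+1}"
    by (rule at_within_nhd[of _ "{..<s+1}"]) (use s in auto)
  ultimately show ?thesis by simp
qed

lemma tail_cont: "continuous_on {0..} (\<lambda>s. \<kappa> - integral {0..s} k)"
  by (intro continuous_intros DERIV_continuous_on[OF K0_deriv]) auto

lemma d\<Theta>: "t \<ge> 0 \<Longrightarrow> (\<Theta> has_real_derivative \<kappa> * sqp t - \<Xi> t) (at t within {0..})"
proof -
  assume t: "t \<ge> 0"
  have "((\<lambda>s. \<kappa> - integral {0..s} k) has_real_derivative - k s) (at s)" if "s > 0" for s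
  proof -
    have "at s within {0..} = at s"
      by (rule at_within_interior) (use that in \<open>simp add: interior_real_atLeast\<close>)
    then show ?thesis using K0_deriv[of s] that by (auto intro!: derivative_eq_intros)
  qed
  from conv_has_vector_derivative_by_parts(2)[OF tail_cont sqp'_cont dsqp this t]
  show ?thesis
    by (simp add: \<Theta>_def[abs_def] \<Xi>_def has_real_derivative_iff_has_vector_derivative)
qed

lemma d\<Psi>: "t \<ge> 0 \<Longrightarrow> (\<Psi> has_real_derivative sqp t - \<omega> * \<Psi> t) (at t within {0..})"
proof -
  assume t: "t \<ge> 0"
  have "((\<lambda>s. exp (- \<omega> * s)) has_real_derivative - (\<omega> * exp (- \<omega> * s))) (at s)" for s
    by (auto intro!: derivative_eq_intros)
  from conv_has_vector_derivative_by_parts(2)[OF exp_cont sqp'_cont dsqp this t]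
  show ?thesis
    by (simp add: \<Psi>_def[abs_def] has_real_derivative_iff_has_vector_derivative mult.assoc)
qed

lemma weight_le:
  assumes "continuous_on {0..} h" "continuous_on {0..} g" "\<And>s. s \<ge> 0 \<Longrightarrow> h s \<le> g s"
  shows "integral {0..t} (\<lambda>s. h s * sqp (t - s)) \<le> integral {0..t} (\<lambda>s. g s * sqp (t - s))"
proof (rule integral_le)
  show "(\<lambda>s. h s * sqp (t - s)) integrable_on {0..t}" "(\<lambda>s. g s * sqp (t - s)) integrable_on {0..t}"
    using conv_integrable[OF assms(1) sqp_cont, of t] conv_integrable[OF assms(2) sqp_cont, of t] by simp_all
  show "h s * sqp (t - s) \<le> g s * sqp (t - s)" if "s \<in> {0..t}" for s
    using that assms(3) by (intro mult_right_mono) (auto simp: sqp_def)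
qed

lemma \<Psi>_nonneg: "0 \<le> \<Psi> t"
  using weight_le[of "\<lambda>_. 0" "\<lambda>s. exp (- \<omega> * s)" t] exp_cont by (simp add: \<Psi>_def)

lemma \<Theta>_nonneg: "0 \<le> \<Theta> t"
  using weight_le[of "\<lambda>_. 0" "\<lambda>s. \<kappa> - integral {0..s} k" t] tail_cont k_integral_le by (simp add: \<Theta>_def)

text \<open>The exponential bound on the kernel enters here, and in integrated form in
  \<open>\<Theta>_le\<close>: both history terms are dominated by \<open>\<Psi>\<close>.\<close>

lemma \<Xi>_le: "\<Xi> t \<le> M * \<Psi> t"
  using weight_le[of k "\<lambda>s. M * exp (- \<omega> * s)" t] k_cont k_le
    continuous_on_mult_left[OF exp_cont, of M]
  by (simp add: \<Xi>_def \<Psi>_def mult.assoc)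

lemma \<Theta>_le: "\<Theta> t \<le> M / \<omega> * \<Psi> t"
  using weight_le[OF tail_cont continuous_on_mult_left[OF exp_cont, of "M / \<omega>"] k_tail_le, of t]
  by (simp only: \<Theta>_def \<Psi>_def mult.assoc integral_mult_right)

lemma \<Psi>_0: "\<Psi> 0 = 0"
  by (simp add: \<Psi>_def)

end

section \<open>The Lyapunov functional\<close>

lemma inner_le_half: "inner x y \<le> r / 2 * (norm x)\<^sup>2 + (norm y)\<^sup>2 / (2 * r)" if "r > 0"
  for x y :: "'a::real_inner"
proof -
  have "0 \<le> (norm (r *\<^sub>R x - y))\<^sup>2" by simp
  also have "\<dots> = r\<^sup>2 * (norm x)\<^sup>2 - 2 * r * inner x y + (norm y)\<^sup>2"
    unfolding power2_norm_eq_inner power2_eq_square[of r]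
    by (simp add: inner_diff_left inner_diff_right inner_commute algebra_simps)
  finally have "2 * r * inner x y \<le> r\<^sup>2 * (norm x)\<^sup>2 + (norm y)\<^sup>2" by simp
  then show ?thesis using that by (simp add: field_simps power2_eq_square)
qed

lemma inner_abs_le: "\<bar>inner x y\<bar> \<le> (norm x)\<^sup>2 / 2 + (norm y)\<^sup>2 / 2" for x y :: "'a::real_inner"
  using inner_le_half[of 1 x y] inner_le_half[of 1 "- x" y] by simp

context mgt_solution
begin

lemma eq_u: "t \<ge> 0 \<Longrightarrow> inner (f t) (u t) = - \<alpha> * inner (w t) (u t) - \<beta> * inner (q t) (p t) - \<gamma> * inner (p t) (p t) + K t (p t)"
  using eq[of t u p] integral_unique[OF K_apply, of t "p t"] by simp

lemma eq_v: "t \<ge> 0 \<Longrightarrow> inner (f t) (v t) = - \<alpha> * inner (w t) (v t) - \<beta> * inner (q t) (q t) - \<gamma> * inner (p t) (q t) + K t (q t)"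
  using eq[of t v q] integral_unique[OF K_apply, of t "q t"] by simp

lemma eq_w: "t \<ge> 0 \<Longrightarrow> inner (f t) (w t) = - \<alpha> * inner (w t) (w t) - \<beta> * inner (q t) (z t) - \<gamma> * inner (p t) (z t) + K t (z t)"
  using eq[of t w z] integral_unique[OF K_apply, of t "z t"] by simp

text \<open>The primitive produced by the multiplier w + \<alpha> v. The extra \<alpha>/2
  \<open>\<Xi>\<close> completes a square: the memory terms of weight \<alpha> in the derivative
  combine to - \<alpha>/2 (k(t) |p|^2 + Mem).\<close>

definition \<Phi>\<^sub>0 :: "real \<Rightarrow> real" where
  "\<Phi>\<^sub>0 t = inner (w t) (w t) / 2 + \<alpha> * inner (w t) (v t) + \<alpha>\<^sup>2 / 2 * inner (v t) (v t)
     + \<beta> / 2 * inner (q t) (q t) + \<gamma> * inner (p t) (q t) + \<alpha> * \<gamma> / 2 * inner (p t) (p t)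
     - K t (q t) - \<alpha> * K t (p t) + \<alpha> / 2 * \<Xi> t"

text \<open>The correction cancels the indefinite terms - k(0) inner p q + m(q) in the derivative of
  \<open>\<Phi>\<^sub>0\<close>.\<close>

definition \<Phi> :: "real \<Rightarrow> real" where
  "\<Phi> t = \<Phi>\<^sub>0 t + (k t * sqp t + Mem t) / 2"

lemma d\<Phi>\<^sub>0:
  assumes t: "t \<ge> 0"
  shows "(\<Phi>\<^sub>0 has_real_derivative
    - (\<alpha> * \<beta> - \<gamma>) * inner (q t) (q t) - k 0 * inner (p t) (q t) + m t (q t)
    - \<alpha> / 2 * (k 0 * sqp t) + \<alpha> * m t (p t) - \<alpha> / 2 * n t) (at t within {0..})"
proof -
  note D = has_real_derivative_inner[OF dw[OF t] dw[OF t]] has_real_derivative_inner[OF dw[OF t] dv[OF t]]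
    has_real_derivative_inner[OF dv[OF t] dv[OF t]] has_real_derivative_inner[OF dq[OF t] dq[OF t]]
    has_real_derivative_inner[OF dp[OF t] dq[OF t]] has_real_derivative_inner[OF dp[OF t] dp[OF t]]
    has_real_derivative_blinfun_apply[OF dK[OF t] dq[OF t]]
    has_real_derivative_blinfun_apply[OF dK[OF t] dp[OF t]] d\<Xi>[OF t]
  show ?thesis
    unfolding \<Phi>\<^sub>0_def[abs_def]
    apply (rule DERIV_cong)
     apply (rule D DERIV_add DERIV_diff DERIV_cmult DERIV_cdivide)+
    using eq_v[OF t] eq_w[OF t]
    apply (simp add: blinfun.diff_left blinfun.scaleR_left inner_commute sqp_def power2_norm_eq_inner)
    apply (simp add: algebra_simps power2_eq_square add_divide_distrib diff_divide_distrib)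
    done
qed

text \<open>The majorant freezes the factor k at time t, as k is nonincreasing, and bounds the
  memory by \<open>Mem_touch\<close>. The factor exp(\<rho> (x - t)) costs \<rho>/2 Mem against the
  gain \<alpha>/2 Mem in \<open>d\<Phi>\<^sub>0\<close>.\<close>

lemma \<Phi>_touch:
  assumes t: "t \<ge> 0"
  shows "\<exists>G. (G has_real_derivative - (\<alpha> * \<beta> - \<gamma>) * inner (q t) (q t) - \<alpha> / 2 * (k t * sqp t)
        - (\<alpha> - \<rho>) / 2 * Mem t) (at t within {0..}) \<and> G t = \<Phi> t \<and>
      (\<forall>x. t < x \<longrightarrow> x < t + 1 \<longrightarrow> \<Phi> x \<le> G x)"
proof -
  obtain C where C: "\<And>x. t < x \<Longrightarrow> x < t + 1 \<Longrightarrow>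
      Mem x \<le> C * (x - t)\<^sup>2 + exp (\<rho> * (x - t)) * ((k 0 - k t) * sqp x - 2 * m t (p x) + n t)"
    using Mem_touch[OF t] by blast
  define G where "G x = \<Phi>\<^sub>0 x + (k t * sqp x + (C * (x - t)\<^sup>2
      + exp (\<rho> * (x - t)) * ((k 0 - k t) * sqp x - 2 * m t (p x) + n t))) / 2" for x
  have dm: "((\<lambda>x. m t (p x)) has_real_derivative m t (q t)) (at t within {0..})"
    using bounded_linear.has_vector_derivative[OF blinfun.bounded_linear_right dp[OF t], of "m t"]
    by (simp add: has_real_derivative_iff_has_vector_derivative)
  have dexp: "((\<lambda>x. exp (\<rho> * (x - t))) has_real_derivative \<rho>) (at t within {0..})"
    by (auto intro!: derivative_eq_intros)
  have dC: "((\<lambda>x. C * (x - t)\<^sup>2) has_real_derivative 0) (at t within {0..})"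
    by (auto intro!: derivative_eq_intros)
  have "(G has_real_derivative - (\<alpha> * \<beta> - \<gamma>) * inner (q t) (q t) - \<alpha> / 2 * (k t * sqp t)
        - (\<alpha> - \<rho>) / 2 * Mem t) (at t within {0..})"
    unfolding G_def[abs_def]
    apply (rule DERIV_cong)
     apply (rule d\<Phi>\<^sub>0[OF t] dC dexp dm dsqp[OF t, folded has_real_derivative_iff_has_vector_derivative]
        DERIV_add DERIV_diff DERIV_cdivide DERIV_cmult DERIV_mult DERIV_const)+
    apply (simp add: Mem_eq[OF t])
    apply (simp add: algebra_simps add_divide_distrib diff_divide_distrib)
    done
  moreover have "G t = \<Phi> t" by (simp add: G_def \<Phi>_def Mem_eq[OF t])
  moreover have "\<Phi> x \<le> G x" if "t < x" "x < t + 1" for x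
  proof -
    have "k x * sqp x \<le> k t * sqp x"
      using that t by (intro mult_right_mono k_antimono) (auto simp: sqp_def)
    then show ?thesis using C[OF that] by (simp add: G_def \<Phi>_def)
  qed
  ultimately show ?thesis by blast
qed

text \<open>The multiplier u: - |v|^2/2 cancels the inner product of w and v from the product rule,
  and \<open>\<Theta>\<close>/2 trades the \<open>\<Xi>\<close> of the memory term for \<kappa>/2
  |p|^2.\<close>

definition N\<^sub>1 :: "real \<Rightarrow> real" where
  "N\<^sub>1 t = inner (w t) (u t) + \<alpha> * inner (v t) (u t) - inner (v t) (v t) / 2 + \<Theta> t / 2"

definition N\<^sub>2 :: "real \<Rightarrow> real" where
  "N\<^sub>2 t = - inner (w t) (v t)"

lemma dN\<^sub>1:
  assumes t: "t \<ge> 0"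
  shows "(N\<^sub>1 has_real_derivative \<alpha> * inner (v t) (v t) - \<beta> * inner (q t) (p t)
     - \<gamma> * sqp t + K t (p t) + (\<kappa> * sqp t - \<Xi> t) / 2) (at t within {0..})"
proof -
  note D = has_real_derivative_inner[OF dw[OF t] du[OF t]] has_real_derivative_inner[OF dv[OF t] du[OF t]]
    has_real_derivative_inner[OF dv[OF t] dv[OF t]] d\<Theta>[OF t]
  show ?thesis
    unfolding N\<^sub>1_def[abs_def]
    apply (rule DERIV_cong)
     apply (rule D DERIV_add DERIV_diff DERIV_cmult DERIV_cdivide)+
    using eq_u[OF t]
    apply (simp add: inner_commute sqp_def power2_norm_eq_inner algebra_simps)
    done
qed

lemma dN\<^sub>2:
  assumes t: "t \<ge> 0"
  shows "(N\<^sub>2 has_real_derivative - inner (w t) (w t) + \<alpha> * inner (w t) (v t) + \<beta> * inner (q t) (q t)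
     + \<gamma> * inner (p t) (q t) - K t (q t)) (at t within {0..})"
proof -
  note D = has_real_derivative_inner[OF dw[OF t] dv[OF t]]
  show ?thesis
    unfolding N\<^sub>2_def[abs_def]
    apply (rule DERIV_cong)
     apply (rule DERIV_minus D)+
    using eq_v[OF t]
    apply (simp add: inner_commute sqp_def power2_norm_eq_inner algebra_simps)
    done
qed

section \<open>Two-sided bounds and dissipation estimates\<close>

definition energy_density :: "real \<Rightarrow> real" where
  "energy_density t = sqp t + (norm (q t))\<^sup>2 + (norm (w t))\<^sup>2 + Mem t"

lemma v_sq_le: "t \<ge> 0 \<Longrightarrow> (norm (v t))\<^sup>2 \<le> c\<^sup>2 * (norm (q t))\<^sup>2"
  and u_sq_le: "t \<ge> 0 \<Longrightarrow> (norm (u t))\<^sup>2 \<le> c\<^sup>2 * sqp t"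
  using poincare[of t] power_mono[of "norm (v t)" "c * norm (q t)" 2] power_mono[of "norm (u t)" "c * norm (p t)" 2]
  by (simp_all add: sqp_def power_mult_distrib)

text \<open>With y = q + \<alpha> p the quadratic terms in p and q split into (\<beta> -
  \<gamma>/\<alpha>)/2 |q|^2 + \<gamma>/(2 \<alpha>) |y|^2. The memory terms are \<alpha>
  K(y/\<alpha>), at most \<kappa>/(2 \<alpha>) |y|^2 + \<alpha>/2 \<open>\<Xi>\<close> by
  \<open>K_le\<close>, and the last summand is exactly the one contained in
  \<open>\<Phi>\<^sub>0\<close>.\<close>

lemma \<Phi>_lower:
  assumes t: "t \<ge> 0" and \<alpha>: "\<alpha> > 0"
  shows "(norm (w t + \<alpha> *\<^sub>R v t))\<^sup>2 / 2 + (\<beta> - \<gamma> / \<alpha>) / 2 * (norm (q t))\<^sup>2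
    + (\<gamma> - \<kappa>) / (2 * \<alpha>) * (norm (q t + \<alpha> *\<^sub>R p t))\<^sup>2 + Mem t / 2 \<le> \<Phi> t"
proof -
  define y where "y = q t + \<alpha> *\<^sub>R p t"
  define A where "A = \<kappa> / (2 * \<alpha>) * (norm y)\<^sup>2"
  define B where "B = \<gamma> / (2 * \<alpha>) * (norm y)\<^sup>2"
  define C where "C = (\<beta> - \<gamma> / \<alpha>) / 2 * (norm (q t))\<^sup>2"
  have "K t (q t) + \<alpha> * K t (p t) = \<alpha> * K t ((1 / \<alpha>) *\<^sub>R y)"
    using \<alpha> by (simp add: y_def blinfun.add_right blinfun.scaleR_right algebra_simps)
  also have "\<dots> \<le> \<alpha> * (\<kappa> / 2 * (norm ((1 / \<alpha>) *\<^sub>R y))\<^sup>2 + \<Xi> t / 2)"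
    using \<alpha> by (intro mult_left_mono K_le t) simp
  also have "\<dots> = A + \<alpha> / 2 * \<Xi> t"
    using \<alpha> by (simp add: A_def power_divide field_simps power2_eq_square[of \<alpha>])
  finally have 1: "K t (q t) + \<alpha> * K t (p t) \<le> A + \<alpha> / 2 * \<Xi> t" .
  have 2: "\<beta> / 2 * inner (q t) (q t) + \<gamma> * inner (p t) (q t) + \<alpha> * \<gamma> / 2 * inner (p t) (p t) = C + B"
    unfolding power2_norm_eq_inner B_def C_def y_def using \<alpha>
    by (simp add: inner_add_left inner_add_right inner_commute field_simps)
  have 3: "inner (w t) (w t) / 2 + \<alpha> * inner (w t) (v t) + \<alpha>\<^sup>2 / 2 * inner (v t) (v t)
      = (norm (w t + \<alpha> *\<^sub>R v t))\<^sup>2 / 2"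
    unfolding power2_norm_eq_inner power2_eq_square[of \<alpha>]
    by (simp add: inner_add_left inner_add_right inner_commute field_simps)
  have 4: "0 \<le> k t * sqp t" using k_nonneg[OF t] by (simp add: sqp_def)
  have 5: "(\<gamma> - \<kappa>) / (2 * \<alpha>) * (norm y)\<^sup>2 = B - A"
    by (simp add: A_def B_def diff_divide_distrib left_diff_distrib)
  define Z where "Z = K t (q t) + \<alpha> * K t (p t)"
  have "\<Phi> t = (norm (w t + \<alpha> *\<^sub>R v t))\<^sup>2 / 2 + (C + B) - Z + \<alpha> / 2 * \<Xi> t + (k t * sqp t + Mem t) / 2"
    unfolding \<Phi>_def \<Phi>\<^sub>0_def 2[symmetric] 3[symmetric] Z_def by simp
  moreover define X KS AX where "X = (norm (w t + \<alpha> *\<^sub>R v t))\<^sup>2" and "KS = k t * sqp t" and "AX = \<alpha> / 2 * \<Xi> t"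
  ultimately have "\<Phi> t = X / 2 + (C + B) - Z + AX + (KS + Mem t) / 2" by simp
  moreover have "Z \<le> A + AX" "0 \<le> KS" using 1 4 by (simp_all add: Z_def KS_def AX_def)
  ultimately show ?thesis unfolding y_def[symmetric] 5 C_def[symmetric] X_def[symmetric] by argo
qed

lemma \<Phi>_coercive:
  assumes t: "t \<ge> 0" and \<alpha>: "\<alpha> > 0" and b: "\<beta> - \<gamma> / \<alpha> > 0" and \<nu>: "\<kappa> < \<gamma>"
  shows "energy_density t
    \<le> (6 + 2 / (\<beta> - \<gamma> / \<alpha>) * (1 + 2 / \<alpha>\<^sup>2 + 2 * \<alpha>\<^sup>2 * c\<^sup>2) + 4 / (\<alpha> * (\<gamma> - \<kappa>))) * \<Phi> t"
proof -
  define B where "B = \<beta> - \<gamma> / \<alpha>"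
  define \<nu>' where "\<nu>' = \<gamma> - \<kappa>"
  define D where "D = 1 + 2 / \<alpha>\<^sup>2 + 2 * \<alpha>\<^sup>2 * c\<^sup>2"
  \<comment> \<open>A sum of nonnegative parts, each sufficient for its own terms of
    \<open>\<Phi>_lower\<close>: 6 for |w + \<alpha> v|^2 and \<open>Mem\<close>, the second for
    |q|^2, the third for |q + \<alpha> p|^2.\<close>
  define R where "R = 6 + 2 / B * D + 4 / (\<alpha> * \<nu>')"
  have pos: "B > 0" "\<nu>' > 0" using b \<nu> by (simp_all add: B_def \<nu>'_def)
  have D0: "D \<ge> 0" by (simp add: D_def)
  define X where "X = (norm (w t + \<alpha> *\<^sub>R v t))\<^sup>2"
  define Y where "Y = (norm (q t + \<alpha> *\<^sub>R p t))\<^sup>2"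
  define Q where "Q = (norm (q t))\<^sup>2"
  have nn: "X \<ge> 0" "Y \<ge> 0" "Q \<ge> 0" by (simp_all add: X_def Y_def Q_def)
  have par: "(norm x)\<^sup>2 \<le> 2 * (norm (x + y))\<^sup>2 + 2 * (norm y)\<^sup>2" for x y :: "'z::real_inner"
  proof -
    \<comment> \<open>The difference of the two sides of \<open>par\<close> is exactly this
      square.\<close>
    have "0 \<le> (norm (x + 2 *\<^sub>R y))\<^sup>2" by simp
    then show ?thesis unfolding power2_norm_eq_inner
      by (simp add: inner_add_left inner_add_right inner_commute algebra_simps)
  qed
  have W: "(norm (w t))\<^sup>2 \<le> 2 * X + 2 * \<alpha>\<^sup>2 * c\<^sup>2 * Q"
  proof -
    have "(norm (w t))\<^sup>2 \<le> 2 * X + 2 * (\<alpha>\<^sup>2 * (norm (v t))\<^sup>2)"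
      using par[of "w t" "\<alpha> *\<^sub>R v t"] by (simp add: X_def power_mult_distrib)
    also have "\<dots> \<le> 2 * X + 2 * (\<alpha>\<^sup>2 * (c\<^sup>2 * Q))"
      unfolding Q_def by (intro add_left_mono mult_left_mono v_sq_le t) auto
    finally show ?thesis by (simp add: mult.assoc)
  qed
  have P: "sqp t \<le> 2 / \<alpha>\<^sup>2 * Y + 2 / \<alpha>\<^sup>2 * Q"
  proof -
    have "\<alpha>\<^sup>2 * sqp t \<le> 2 * Y + 2 * Q"
      using par[of "\<alpha> *\<^sub>R p t" "q t"] by (simp add: Y_def Q_def sqp_def power_mult_distrib add.commute)
    then show ?thesis using \<alpha> by (simp add: field_simps)
  qed
  have "energy_density t \<le> 2 * X + D * Q + 2 / \<alpha>\<^sup>2 * Y + Mem t"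
    using W P by (simp add: energy_density_def D_def algebra_simps flip: Q_def)
  also have "\<dots> \<le> R * (X / 2) + R * (B / 2 * Q) + R * (\<nu>' / (2 * \<alpha>) * Y) + R * (Mem t / 2)"
  proof (intro add_mono)
    have R6: "R \<ge> 6" using pos D0 \<alpha> by (simp add: R_def)
    show "2 * X \<le> R * (X / 2)" using mult_right_mono[OF R6, of "X / 2"] nn by simp
    show "Mem t \<le> R * (Mem t / 2)" using mult_right_mono[OF R6, of "Mem t / 2"] Mem_nonneg[of t] by simp
    have "2 / B * D \<le> R" using \<alpha> pos by (simp add: R_def)
    from mult_right_mono[OF this, of "B / 2 * Q"] show "D * Q \<le> R * (B / 2 * Q)"
      using pos nn by simp
    have "4 / (\<alpha> * \<nu>') \<le> R" using \<alpha> pos D0 by (simp add: R_def)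
    from mult_right_mono[OF this, of "\<nu>' / (2 * \<alpha>) * Y"]
    show "2 / \<alpha>\<^sup>2 * Y \<le> R * (\<nu>' / (2 * \<alpha>) * Y)"
      using pos nn \<alpha> by (simp add: power2_eq_square)
  qed
  also have "\<dots> = R * (X / 2 + B / 2 * Q + \<nu>' / (2 * \<alpha>) * Y + Mem t / 2)"
    by (simp add: distrib_left)
  also have "\<dots> \<le> R * \<Phi> t"
    using \<Phi>_lower[OF t \<alpha>] \<alpha> pos D0 unfolding B_def[symmetric] \<nu>'_def[symmetric] X_def Y_def Q_def
    by (intro mult_left_mono) (auto simp: R_def)
  finally show ?thesis by (simp only: R_def D_def B_def \<nu>'_def)
qed

lemma K_abs_le: "t \<ge> 0 \<Longrightarrow> \<bar>K t x\<bar> \<le> \<kappa> / 2 * (norm x)\<^sup>2 + M / 2 * \<Psi> t"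
  using K_le[of t x] K_ge[of t x] \<Xi>_le[of t] by linarith

lemma sqp_nonneg: "0 \<le> sqp t"
  by (simp add: sqp_def)

lemma energy_density_parts:
  "sqp t \<le> energy_density t" "(norm (q t))\<^sup>2 \<le> energy_density t" "(norm (w t))\<^sup>2 \<le> energy_density t"
  "Mem t \<le> energy_density t" "0 \<le> energy_density t"
  using Mem_nonneg[of t] sqp_nonneg[of t] by (simp_all add: energy_density_def)

lemma v_sq_le_energy: "t \<ge> 0 \<Longrightarrow> (norm (v t))\<^sup>2 \<le> c\<^sup>2 * energy_density t"
  and u_sq_le_energy: "t \<ge> 0 \<Longrightarrow> (norm (u t))\<^sup>2 \<le> c\<^sup>2 * energy_density t"
  using v_sq_le[of t] u_sq_le[of t] mult_left_mono[OF energy_density_parts(2)[of t], of "c\<^sup>2"]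
    mult_left_mono[OF energy_density_parts(1)[of t], of "c\<^sup>2"]
  by simp_all

lemma N\<^sub>2_abs_le: "t \<ge> 0 \<Longrightarrow> \<bar>N\<^sub>2 t\<bar> \<le> (1 + c\<^sup>2) * energy_density t"
  using inner_abs_le[of "w t" "v t"] v_sq_le_energy[of t] energy_density_parts(3,5)[of t]
  by (simp add: N\<^sub>2_def distrib_right)

text \<open>\<open>\<Theta>\<close> is nonnegative, so \<open>\<Psi>\<close> enters the upper bound
  only. The lower bound has to be in terms of the energy alone, as it is absorbed by a multiple of
  \<Phi>.\<close>

lemma N\<^sub>1_bounds:
  assumes t: "t \<ge> 0" and \<alpha>: "\<alpha> > 0"
  shows "- ((1 + (2 + \<alpha>) * c\<^sup>2) * energy_density t) \<le> N\<^sub>1 t"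
    and "N\<^sub>1 t \<le> (1 + (2 + \<alpha>) * c\<^sup>2) * energy_density t + M / \<omega> * \<Psi> t"
proof -
  define e where "e = energy_density t"
  define V where "V = c\<^sup>2 * e"
  have V: "(norm (v t))\<^sup>2 \<le> V" "(norm (u t))\<^sup>2 \<le> V" "(norm (w t))\<^sup>2 \<le> e" "0 \<le> e" "0 \<le> V"
    using v_sq_le_energy[OF t] u_sq_le_energy[OF t] energy_density_parts[of t]
    by (simp_all add: e_def V_def)
  have 1: "\<bar>inner (w t) (u t)\<bar> \<le> e + V" using inner_abs_le[of "w t" "u t"] V by simp
  have "\<bar>inner (v t) (u t)\<bar> \<le> V" using inner_abs_le[of "v t" "u t"] V by simp
  then have 2: "\<bar>\<alpha> * inner (v t) (u t)\<bar> \<le> \<alpha> * V" using \<alpha> by (simp add: abs_mult)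
  have 3: "\<bar>inner (v t) (v t) / 2\<bar> \<le> V" using V by (simp add: dot_square_norm)
  have 4: "0 \<le> \<Theta> t / 2" "\<Theta> t / 2 \<le> M / \<omega> * \<Psi> t"
    using \<Theta>_nonneg[of t] \<Theta>_le[of t] by linarith+
  have 5: "(1 + (2 + \<alpha>) * c\<^sup>2) * energy_density t = e + 2 * V + \<alpha> * V"
    by (simp add: V_def e_def algebra_simps)
  have N: "N\<^sub>1 t = inner (w t) (u t) + \<alpha> * inner (v t) (u t) - inner (v t) (v t) / 2 + \<Theta> t / 2"
    by (simp add: N\<^sub>1_def)
  show "- ((1 + (2 + \<alpha>) * c\<^sup>2) * energy_density t) \<le> N\<^sub>1 t" unfolding 5 N using 1 2 3 4 by linarith
  show "N\<^sub>1 t \<le> (1 + (2 + \<alpha>) * c\<^sup>2) * energy_density t + M / \<omega> * \<Psi> t" unfolding 5 N using 1 2 3 4 by linarith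
qed

lemma \<Phi>_upper:
  assumes t: "t \<ge> 0" and pos: "\<alpha> > 0" "\<beta> > 0" "\<gamma> > 0"
  shows "\<Phi> t \<le> (2 + \<alpha> + \<alpha> * c\<^sup>2 + \<alpha>\<^sup>2 * c\<^sup>2 + \<beta> + \<gamma> + \<alpha> * \<gamma> + \<kappa> + \<alpha> * \<kappa> + M) * energy_density t
      + (M + \<alpha> * M) * \<Psi> t"
proof -
  define e where "e = energy_density t"
  define V where "V = c\<^sup>2 * e"
  have V: "(norm (v t))\<^sup>2 \<le> V" "(norm (w t))\<^sup>2 \<le> e" "(norm (q t))\<^sup>2 \<le> e" "(norm (p t))\<^sup>2 \<le> e" "0 \<le> e" "0 \<le> V" "Mem t \<le> e"
    using v_sq_le_energy[OF t] energy_density_parts[of t]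
    by (simp_all add: e_def V_def sqp_def)
  have "inner (w t) (v t) \<le> e + V" using inner_abs_le[of "w t" "v t"] V by simp
  then have 1: "\<alpha> * inner (w t) (v t) \<le> \<alpha> * (e + V)" using pos by (intro mult_left_mono) auto
  have 2: "\<alpha>\<^sup>2 / 2 * inner (v t) (v t) \<le> \<alpha>\<^sup>2 * V"
    using mult_mono[of "\<alpha>\<^sup>2 / 2" "\<alpha>\<^sup>2" "inner (v t) (v t)" V] V by (simp add: dot_square_norm)
  have 3: "\<beta> / 2 * inner (q t) (q t) \<le> \<beta> * e"
    using mult_mono[of "\<beta> / 2" "\<beta>" "inner (q t) (q t)" e] V pos by (simp add: dot_square_norm)
  have "inner (p t) (q t) \<le> e" using inner_abs_le[of "p t" "q t"] V by simp
  then have 4: "\<gamma> * inner (p t) (q t) \<le> \<gamma> * e" using pos by (intro mult_left_mono) auto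
  have 5: "\<alpha> * \<gamma> / 2 * inner (p t) (p t) \<le> \<alpha> * \<gamma> * e"
    using mult_mono[of "\<alpha> * \<gamma> / 2" "\<alpha> * \<gamma>" "inner (p t) (p t)" e] V pos by (simp add: dot_square_norm)
  have M\<Psi>: "0 \<le> M * \<Psi> t" using M_pos \<Psi>_nonneg[of t] by simp
  have K: "- K t x \<le> \<kappa> * e + M * \<Psi> t / 2" if "(norm x)\<^sup>2 \<le> e" for x
  proof -
    have "\<kappa> / 2 * (norm x)\<^sup>2 \<le> \<kappa> * e"
      using mult_mono[of "\<kappa> / 2" \<kappa> "(norm x)\<^sup>2" e] \<kappa>_nonneg that V by simp
    then show ?thesis using K_abs_le[OF t, of x] by linarith
  qed
  have 6: "- K t (q t) \<le> \<kappa> * e + M * \<Psi> t / 2" using K V by blast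
  have 7: "- (\<alpha> * K t (p t)) \<le> \<alpha> * (\<kappa> * e + M * \<Psi> t / 2)"
    using mult_left_mono[OF K[OF V(4)], of \<alpha>] pos by simp
  have 8: "\<alpha> / 2 * \<Xi> t \<le> \<alpha> * (M * \<Psi> t / 2)"
    using mult_left_mono[OF \<Xi>_le[of t], of "\<alpha> / 2"] pos by simp
  have "k t \<le> M"
  proof -
    have "M * exp (- \<omega> * t) \<le> M * 1"
      using M_pos \<omega>_pos t by (intro mult_left_mono) auto
    then show ?thesis using k_le[OF t] by simp
  qed
  then have 9: "k t * sqp t \<le> M * e"
    using V M_pos k_nonneg[OF t] by (intro mult_mono) (auto simp: sqp_def)
  have "\<Phi> t \<le> e + \<alpha> * (e + V) + \<alpha>\<^sup>2 * V + \<beta> * e + \<gamma> * e + \<alpha> * \<gamma> * e + (\<kappa> * e + M * \<Psi> t / 2)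
      + \<alpha> * (\<kappa> * e + M * \<Psi> t / 2) + \<alpha> * (M * \<Psi> t / 2) + (M * e + e)"
  proof -
    have a: "inner (w t) (w t) / 2 \<le> e" using V by (simp add: dot_square_norm)
    have b: "(k t * sqp t + Mem t) / 2 \<le> M * e + e"
    proof -
      have "k t * sqp t + Mem t \<le> M * e + e" using 9 V(7) by simp
      moreover have "0 \<le> M * e + e" using V M_pos by simp
      ultimately show ?thesis by argo
    qed
    show ?thesis unfolding \<Phi>_def \<Phi>\<^sub>0_def diff_conv_add_uminus
      by (intro add_mono a b 1 2 3 4 5 6 7 8)
  qed
  also have "\<dots> \<le> (2 + \<alpha> + \<alpha> * c\<^sup>2 + \<alpha>\<^sup>2 * c\<^sup>2 + \<beta> + \<gamma> + \<alpha> * \<gamma> + \<kappa> + \<alpha> * \<kappa> + M) * e + (M + \<alpha> * M) * \<Psi> t"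
    using M\<Psi> by (simp add: V_def algebra_simps)
  finally show ?thesis by (simp only: e_def)
qed

text \<open>Of \<gamma> |p|^2 the memory consumes \<kappa> |p|^2, half through \<open>K_le\<close>
  and half through \<open>\<Theta>\<close>, while the \<open>\<Xi>\<close> terms cancel. Young's
  inequality with weight \<gamma> - \<kappa> on the product of q and p takes half of the
  rest.\<close>

lemma N\<^sub>1_dissipation:
  assumes t: "t \<ge> 0" and \<nu>: "\<kappa> < \<gamma>" and pos: "\<alpha> > 0"
  shows "\<alpha> * inner (v t) (v t) - \<beta> * inner (q t) (p t) - \<gamma> * sqp t + K t (p t) + (\<kappa> * sqp t - \<Xi> t) / 2
    \<le> (\<alpha> * c\<^sup>2 + \<beta>\<^sup>2 / (2 * (\<gamma> - \<kappa>))) * (norm (q t))\<^sup>2 - (\<gamma> - \<kappa>) / 2 * sqp t"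
proof -
  have 1: "\<alpha> * inner (v t) (v t) \<le> \<alpha> * (c\<^sup>2 * (norm (q t))\<^sup>2)"
    using v_sq_le[OF t] pos by (intro mult_left_mono) (auto simp: dot_square_norm)
  have 2: "- (\<beta> * inner (q t) (p t)) \<le> (\<gamma> - \<kappa>) / 2 * sqp t + \<beta>\<^sup>2 / (2 * (\<gamma> - \<kappa>)) * (norm (q t))\<^sup>2"
    using inner_le_half[of "\<gamma> - \<kappa>" "p t" "- \<beta> *\<^sub>R q t"] \<nu>
    by (simp add: sqp_def inner_commute power_mult_distrib)
  have 3: "K t (p t) \<le> \<kappa> / 2 * sqp t + \<Xi> t / 2" using K_le[OF t] by (simp add: sqp_def)
  have "\<alpha> * inner (v t) (v t) - \<beta> * inner (q t) (p t) - \<gamma> * sqp t + K t (p t) + (\<kappa> * sqp t - \<Xi> t) / 2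
    \<le> \<alpha> * (c\<^sup>2 * (norm (q t))\<^sup>2) + ((\<gamma> - \<kappa>) / 2 * sqp t + \<beta>\<^sup>2 / (2 * (\<gamma> - \<kappa>)) * (norm (q t))\<^sup>2)
      - \<gamma> * sqp t + (\<kappa> / 2 * sqp t + \<Xi> t / 2) + (\<kappa> * sqp t - \<Xi> t) / 2"
    using 1 2 3 by argo
  also have "\<dots> = (\<alpha> * c\<^sup>2 + \<beta>\<^sup>2 / (2 * (\<gamma> - \<kappa>))) * (norm (q t))\<^sup>2 - (\<gamma> - \<kappa>) / 2 * sqp t"
    by (simp add: left_diff_distrib distrib_right diff_divide_distrib)
  finally show ?thesis .
qed

text \<open>Only - |w|^2/2 is dissipative on the right; the other terms are absorbed later by giving
  this functional a small weight.\<close>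

lemma N\<^sub>2_dissipation:
  assumes t: "t \<ge> 0" and pos: "\<alpha> > 0" "\<beta> > 0" "\<gamma> > 0"
  shows "- inner (w t) (w t) + \<alpha> * inner (w t) (v t) + \<beta> * inner (q t) (q t) + \<gamma> * inner (p t) (q t) - K t (q t)
    \<le> - (norm (w t))\<^sup>2 / 2 + (\<alpha>\<^sup>2 * c\<^sup>2 / 2 + \<beta> + \<gamma> / 2 + \<kappa> / 2) * (norm (q t))\<^sup>2 + \<gamma> / 2 * sqp t + M / 2 * \<Psi> t"
proof -
  have "inner (w t) (\<alpha> *\<^sub>R v t) \<le> (norm (w t))\<^sup>2 / 2 + (norm (\<alpha> *\<^sub>R v t))\<^sup>2 / 2"
    using inner_abs_le[of "w t" "\<alpha> *\<^sub>R v t"] by simp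
  also have "(norm (\<alpha> *\<^sub>R v t))\<^sup>2 \<le> \<alpha>\<^sup>2 * (c\<^sup>2 * (norm (q t))\<^sup>2)"
    using mult_left_mono[OF v_sq_le[OF t], of "\<alpha>\<^sup>2"] by (simp add: power_mult_distrib)
  finally have 1: "\<alpha> * inner (w t) (v t) \<le> (norm (w t))\<^sup>2 / 2 + \<alpha>\<^sup>2 * (c\<^sup>2 * (norm (q t))\<^sup>2) / 2"
    by simp
  have 2: "\<gamma> * inner (p t) (q t) \<le> \<gamma> * (sqp t / 2 + (norm (q t))\<^sup>2 / 2)"
    using inner_abs_le[of "p t" "q t"] pos by (intro mult_left_mono) (auto simp: sqp_def)
  have 3: "- K t (q t) \<le> \<kappa> / 2 * (norm (q t))\<^sup>2 + M / 2 * \<Psi> t"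
    using K_abs_le[OF t, of "q t"] by linarith
  have "- inner (w t) (w t) + \<alpha> * inner (w t) (v t) + \<beta> * inner (q t) (q t) + \<gamma> * inner (p t) (q t) - K t (q t)
     \<le> - (norm (w t))\<^sup>2 + ((norm (w t))\<^sup>2 / 2 + \<alpha>\<^sup>2 * (c\<^sup>2 * (norm (q t))\<^sup>2) / 2) + \<beta> * (norm (q t))\<^sup>2
      + \<gamma> * (sqp t / 2 + (norm (q t))\<^sup>2 / 2) + (\<kappa> / 2 * (norm (q t))\<^sup>2 + M / 2 * \<Psi> t)"
    unfolding dot_square_norm using 1 2 3 by linarith
  also have "\<dots> = - (norm (w t))\<^sup>2 / 2 + (\<alpha>\<^sup>2 * c\<^sup>2 / 2 + \<beta> + \<gamma> / 2 + \<kappa> / 2) * (norm (q t))\<^sup>2 + \<gamma> / 2 * sqp t + M / 2 * \<Psi> t"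
    by (simp add: algebra_simps)
  finally show ?thesis .
qed

lemma \<Phi>_cont: "continuous_on {0..} \<Phi>"
  unfolding \<Phi>_def[abs_def]
  by (intro continuous_intros k_cont sqp_cont Mem_cont DERIV_continuous_on[OF d\<Phi>\<^sub>0]) auto

lemma N\<^sub>1_cont: "continuous_on {0..} N\<^sub>1" and N\<^sub>2_cont: "continuous_on {0..} N\<^sub>2" and \<Psi>_cont: "continuous_on {0..} \<Psi>"
  by (rule DERIV_continuous_on[OF dN\<^sub>1], simp, rule DERIV_continuous_on[OF dN\<^sub>2], simp,
      rule DERIV_continuous_on[OF d\<Psi>], simp)

end

section \<open>Choice of the constants and exponential decay\<close>

text \<open>The constants are quantified before the solution, so that one pair serves all
  regularisations and all initial data.\<close>

lemma exponential_decay_mgt: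
  fixes \<alpha> \<beta> \<gamma> c \<rho> \<kappa> M \<omega> :: real
  assumes pos: "\<alpha> > 0" "\<beta> > 0" "\<gamma> > 0" and b: "\<beta> - \<gamma> / \<alpha> > 0" and \<nu>: "\<kappa> < \<gamma>" and \<rho>: "\<rho> < \<alpha>"
    and kernel: "memory_kernel k \<mu> \<rho> \<kappa> M \<omega>"
  shows "\<exists>C\<ge>1. \<exists>\<eta>>0. \<forall>(u :: real \<Rightarrow> 'a::real_inner) v w f (p :: real \<Rightarrow> 'b::real_inner) q z.
    mgt_solution k \<mu> \<rho> \<kappa> M \<omega> \<alpha> \<beta> \<gamma> c u v w f p q z \<longrightarrow>
    (\<forall>t\<ge>0. (norm (p t))\<^sup>2 + (norm (q t))\<^sup>2 + (norm (w t))\<^sup>2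
        + integral {0..t} (\<lambda>s. \<mu> s * (norm (p t - p (t - s)))\<^sup>2)
      \<le> C * ((norm (p 0))\<^sup>2 + (norm (q 0))\<^sup>2 + (norm (w 0))\<^sup>2) * exp (- \<eta> * t))"
proof -
  interpret memory_kernel k \<mu> \<rho> \<kappa> M \<omega> by fact
  define \<nu> where "\<nu> = \<gamma> - \<kappa>"
  define \<theta> where "\<theta> = \<alpha> * \<beta> - \<gamma>"
  define R where "R = 6 + 2 / (\<beta> - \<gamma> / \<alpha>) * (1 + 2 / \<alpha>\<^sup>2 + 2 * \<alpha>\<^sup>2 * c\<^sup>2) + 4 / (\<alpha> * (\<gamma> - \<kappa>))"
  define c1 where "c1 = 1 + (2 + \<alpha>) * c\<^sup>2"
  define c2 where "c2 = 1 + c\<^sup>2"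
  define c3 where "c3 = 2 + \<alpha> + \<alpha> * c\<^sup>2 + \<alpha>\<^sup>2 * c\<^sup>2 + \<beta> + \<gamma> + \<alpha> * \<gamma> + \<kappa> + \<alpha> * \<kappa> + M"
  define d1 where "d1 = \<alpha> * c\<^sup>2 + \<beta>\<^sup>2 / (2 * (\<gamma> - \<kappa>))"
  define d2 where "d2 = \<alpha>\<^sup>2 * c\<^sup>2 / 2 + \<beta> + \<gamma> / 2 + \<kappa> / 2"
  \<comment> \<open>\<open>N\<^sub>1\<close> dissipates \<nu>/2 |p|^2. Of this \<open>\<Psi>\<close>
    may spend \<nu>/8 and \<open>N\<^sub>2\<close> another \<nu>/8; \<nu>/4 remains.\<close>
  define a where "a = \<nu> / 8"
  \<comment> \<open>The first bound keeps the |p|^2 cost of \<open>N\<^sub>2\<close> below \<nu>/8,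
    the second its \<open>\<Psi>\<close> cost below half of the decay a \<omega>.\<close>
  define b' where "b' = min (\<nu> / (4 * \<gamma>)) (a * \<omega> / M)"
  \<comment> \<open>Large enough, once \<open>a\<close> and \<open>b'\<close> are fixed, for N
    \<theta> |q|^2 to absorb all |q|^2 terms with one |q|^2 to spare, and for N \<Phi> to dominate
    the indefinite \<open>N\<^sub>1\<close> and b' \<open>N\<^sub>2\<close>.\<close>
  define N where "N = max 1 (max ((d1 + b' * d2 + 1) / \<theta>) (R * (1 + c1 + b' * c2)))"
  have "\<gamma> / \<alpha> < \<beta>" using b by simp
  then have \<theta>: "\<theta> > 0" using pos(1) by (simp add: \<theta>_def field_simps)
  have \<nu>0: "\<nu> > 0" using assms(5) by (simp add: \<nu>_def)
  have a0: "a > 0" using \<nu>0 by (simp add: a_def)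
  have b0: "b' > 0" using \<nu>0 a0 pos M_pos \<omega>_pos by (simp add: b'_def)
  have b1: "b' * (\<gamma> / 2) \<le> \<nu> / 8"
  proof -
    have "b' * (\<gamma> / 2) \<le> \<nu> / (4 * \<gamma>) * (\<gamma> / 2)" using pos by (intro mult_right_mono) (auto simp: b'_def)
    then show ?thesis using pos by simp
  qed
  have b2: "b' * (M / 2) \<le> a * \<omega> / 2"
  proof -
    have "b' * (M / 2) \<le> a * \<omega> / M * (M / 2)" using M_pos by (intro mult_right_mono) (auto simp: b'_def)
    then show ?thesis using M_pos by simp
  qed
  have R0: "R > 0" using b pos \<nu>0 by (simp add: R_def \<nu>_def add_pos_nonneg)
  have N1: "N \<ge> 1" by (simp add: N_def)
  have N2: "d1 + b' * d2 + 1 \<le> N * \<theta>"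
  proof -
    have "(d1 + b' * d2 + 1) / \<theta> \<le> N" by (simp add: N_def)
    then show ?thesis using \<theta> by (simp add: field_simps)
  qed
  have N3: "R * (1 + c1 + b' * c2) \<le> N" by (simp add: N_def)
  have c123: "c1 \<ge> 0" "c2 \<ge> 0" "c3 \<ge> 0" using pos M_pos \<kappa>_nonneg by (simp_all add: c1_def c2_def c3_def)
  define c4 where "c4 = N * (M + \<alpha> * M) + M / \<omega> + a"
  define CU where "CU = max 1 (max (N * c3 + c1 + b' * c2) c4)"
  \<comment> \<open>The smallest coefficient left in front of |q|^2, Mem, |p|^2,
    \<open>\<Psi>\<close> and |w|^2; dividing by the upper bound \<open>CU\<close> of the functional
    gives the rate.\<close>
  define r where "r = min (min 1 ((\<alpha> - \<rho>) / 2)) (min (\<nu> / 4) (min (a * \<omega> / 2) (b' / 2)))"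
  have r0: "r > 0" using assms(6) \<nu>0 a0 \<omega>_pos b0 by (simp add: r_def)
  have rle: "r \<le> 1" "r \<le> \<nu> / 4" "r \<le> b' / 2" "r \<le> (\<alpha> - \<rho>) / 2" "r \<le> a * \<omega> / 2"
    unfolding r_def by (simp_all only: min_le_iff_disj order_refl simp_thms)
  have CU1: "CU \<ge> 1" by (simp add: CU_def)
  show ?thesis
  proof (rule exI[of _ CU], rule conjI[OF CU1], rule exI[of _ "r / CU"], intro conjI allI impI)
    show "0 < r / CU" using r0 CU1 by simp
    fix u v w f :: "real \<Rightarrow> 'a" and p q z :: "real \<Rightarrow> 'b" and T :: real
    assume sol: "mgt_solution k \<mu> \<rho> \<kappa> M \<omega> \<alpha> \<beta> \<gamma> c u v w f p q z" and T: "T \<ge> 0"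
    interpret mgt_solution k \<mu> \<rho> \<kappa> M \<omega> \<alpha> \<beta> \<gamma> c u v w f p q z by fact
    define L where "L t = N * \<Phi> t + N\<^sub>1 t + a * \<Psi> t + b' * N\<^sub>2 t" for t
    have Lc: "continuous_on {0..} L"
      unfolding L_def[abs_def] by (intro continuous_intros \<Phi>_cont N\<^sub>1_cont N\<^sub>2_cont \<Psi>_cont)
    have lower: "energy_density t \<le> L t" if t: "t \<ge> 0" for t
    proof -
      define e where "e = energy_density t"
      have e0: "e \<ge> 0" using energy_density_parts(5) by (simp add: e_def)
      have "e \<le> R * \<Phi> t"
        unfolding R_def e_def by (rule \<Phi>_coercive[OF t pos(1) b assms(5)])
      then have "(1 + c1 + b' * c2) * e \<le> (1 + c1 + b' * c2) * (R * \<Phi> t)"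
        using c123 b0 by (intro mult_left_mono) auto
      also have "\<dots> = R * (1 + c1 + b' * c2) * \<Phi> t" by simp
      also have "\<dots> \<le> N * \<Phi> t"
      proof (rule mult_right_mono[OF N3])
        have "0 \<le> R * \<Phi> t" using \<open>e \<le> R * \<Phi> t\<close> e0 by linarith
        then show "0 \<le> \<Phi> t" using R0 by (simp add: zero_le_mult_iff)
      qed
      finally have 1: "e + c1 * e + b' * (c2 * e) \<le> N * \<Phi> t" by (simp add: algebra_simps)
      have 2: "- (c1 * e) \<le> N\<^sub>1 t" using N\<^sub>1_bounds(1)[OF t pos(1)] by (simp add: c1_def e_def)
      have 3: "- (b' * (c2 * e)) \<le> b' * N\<^sub>2 t"
        using mult_left_mono[of "- (c2 * e)" "N\<^sub>2 t" b'] N\<^sub>2_abs_le[OF t] b0 by (simp add: c2_def e_def abs_le_iff)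
      have 4: "0 \<le> a * \<Psi> t" using a0 \<Psi>_nonneg[of t] by simp
      show ?thesis unfolding L_def e_def[symmetric] using 1 2 3 4 by linarith
    qed
    have upper: "L t \<le> CU * (energy_density t + \<Psi> t)" if t: "t \<ge> 0" for t
    proof -
      define e where "e = energy_density t"
      have e0: "e \<ge> 0" using energy_density_parts(5) by (simp add: e_def)
      have 1: "N * \<Phi> t \<le> N * (c3 * e + (M + \<alpha> * M) * \<Psi> t)"
        unfolding c3_def e_def using N1 by (intro mult_left_mono \<Phi>_upper t pos) auto
      have 2: "N\<^sub>1 t \<le> c1 * e + M / \<omega> * \<Psi> t" using N\<^sub>1_bounds(2)[OF t pos(1)] by (simp add: c1_def e_def)
      have 3: "b' * N\<^sub>2 t \<le> b' * (c2 * e)"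
        using N\<^sub>2_abs_le[OF t] b0 by (intro mult_left_mono) (auto simp: c2_def e_def abs_le_iff)
      have "L t \<le> N * (c3 * e + (M + \<alpha> * M) * \<Psi> t) + (c1 * e + M / \<omega> * \<Psi> t) + a * \<Psi> t + b' * (c2 * e)"
        unfolding L_def using 1 2 3 by linarith
      also have "\<dots> = (N * c3 + c1 + b' * c2) * e + c4 * \<Psi> t"
        by (simp add: c4_def algebra_simps)
      also have "\<dots> \<le> CU * e + CU * \<Psi> t"
        using e0 \<Psi>_nonneg[of t] by (intro add_mono mult_right_mono) (auto simp: CU_def)
      finally show ?thesis by (simp add: e_def distrib_left)
    qed
    have touch: "\<exists>G D. (G has_real_derivative D) (at t within {t..}) \<and> D \<le> - (r / CU) * L t
      \<and> G t = L t \<and> (\<forall>\<^sub>F x in at_right t. L x \<le> G x)" if t: "t \<ge> 0" for t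
    proof -
      define Q where "Q = (norm (q t))\<^sup>2"
      define W where "W = (norm (w t))\<^sup>2"
      have nn: "Q \<ge> 0" "W \<ge> 0" "sqp t \<ge> 0" "Mem t \<ge> 0" "\<Psi> t \<ge> 0"
        by (simp_all add: Q_def W_def sqp_nonneg Mem_nonneg \<Psi>_nonneg)
      obtain G0 where G0: "(G0 has_real_derivative - (\<alpha> * \<beta> - \<gamma>) * inner (q t) (q t) - \<alpha> / 2 * (k t * sqp t)
        - (\<alpha> - \<rho>) / 2 * Mem t) (at t within {0..})" "G0 t = \<Phi> t"
        "\<And>x. t < x \<Longrightarrow> x < t + 1 \<Longrightarrow> \<Phi> x \<le> G0 x"
        using \<Phi>_touch[OF t] by blast
      define G where "G x = N * G0 x + N\<^sub>1 x + a * \<Psi> x + b' * N\<^sub>2 x" for x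
      define D\<Phi> where "D\<Phi> = - (\<alpha> * \<beta> - \<gamma>) * inner (q t) (q t) - \<alpha> / 2 * (k t * sqp t) - (\<alpha> - \<rho>) / 2 * Mem t"
      define D1 where "D1 = \<alpha> * inner (v t) (v t) - \<beta> * inner (q t) (p t) - \<gamma> * sqp t + K t (p t) + (\<kappa> * sqp t - \<Xi> t) / 2"
      define D2 where "D2 = - inner (w t) (w t) + \<alpha> * inner (w t) (v t) + \<beta> * inner (q t) (q t)
        + \<gamma> * inner (p t) (q t) - K t (q t)"
      have "(G has_real_derivative N * D\<Phi> + D1 + a * (sqp t - \<omega> * \<Psi> t) + b' * D2) (at t within {0..})"
        unfolding G_def[abs_def] D\<Phi>_def D1_def D2_def
        by (intro DERIV_add DERIV_cmult G0(1) dN\<^sub>1[OF t] dN\<^sub>2[OF t] d\<Psi>[OF t])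
      then have der: "(G has_real_derivative N * D\<Phi> + D1 + a * (sqp t - \<omega> * \<Psi> t) + b' * D2) (at t within {t..})"
        by (rule has_field_derivative_subset) (use t in auto)
      have "D\<Phi> \<le> - \<theta> * Q - (\<alpha> - \<rho>) / 2 * Mem t"
        using k_nonneg[OF t] nn(3) pos(1) by (simp add: D\<Phi>_def \<theta>_def Q_def dot_square_norm)
      then have 1: "N * D\<Phi> \<le> - (N * \<theta> * Q) - N * ((\<alpha> - \<rho>) / 2 * Mem t)"
        using mult_left_mono[of D\<Phi> _ N] N1 by (fastforce simp: algebra_simps)
      have 2: "D1 \<le> d1 * Q - \<nu> / 2 * sqp t"
        using N\<^sub>1_dissipation[OF t assms(5) pos(1)] by (simp add: D1_def d1_def \<nu>_def Q_def)
      have "D2 \<le> - W / 2 + d2 * Q + \<gamma> / 2 * sqp t + M / 2 * \<Psi> t"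
        using N\<^sub>2_dissipation[OF t pos] by (simp add: D2_def d2_def Q_def W_def)
      then have "b' * D2 \<le> b' * (- W / 2 + d2 * Q + \<gamma> / 2 * sqp t + M / 2 * \<Psi> t)"
        using b0 by (intro mult_left_mono) auto
      then have 3: "b' * D2 \<le> - (b' / 2 * W) + b' * d2 * Q + b' * (\<gamma> / 2) * sqp t + b' * (M / 2) * \<Psi> t"
        by (simp add: algebra_simps)
      have 4: "b' * (\<gamma> / 2) * sqp t \<le> \<nu> / 8 * sqp t" by (intro mult_right_mono b1 nn)
      have 5: "b' * (M / 2) * \<Psi> t \<le> a * \<omega> / 2 * \<Psi> t" by (intro mult_right_mono b2 nn)
      have 6: "(d1 + b' * d2 + 1) * Q \<le> N * \<theta> * Q" by (intro mult_right_mono N2 nn)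
      have 7: "(\<alpha> - \<rho>) / 2 * Mem t \<le> N * ((\<alpha> - \<rho>) / 2 * Mem t)"
        using mult_right_mono[OF N1, of "(\<alpha> - \<rho>) / 2 * Mem t"] nn assms(6) by simp
      have 8: "r * Q \<le> 1 * Q" "r * sqp t \<le> \<nu> / 4 * sqp t" "r * W \<le> b' / 2 * W"
        "r * Mem t \<le> (\<alpha> - \<rho>) / 2 * Mem t" "r * \<Psi> t \<le> a * \<omega> / 2 * \<Psi> t"
        by (intro mult_right_mono nn rle)+
      have 9: "(d1 + b' * d2 + 1) * Q = d1 * Q + b' * d2 * Q + Q" by (simp add: distrib_right)
      have 10: "a * (sqp t - \<omega> * \<Psi> t) = \<nu> / 8 * sqp t - a * \<omega> * \<Psi> t" by (simp add: a_def algebra_simps)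
      have 11: "a * \<omega> / 2 * \<Psi> t + a * \<omega> / 2 * \<Psi> t = a * \<omega> * \<Psi> t" by simp
      have 12: "\<nu> / 4 * sqp t + \<nu> / 8 * sqp t + \<nu> / 8 * sqp t = \<nu> / 2 * sqp t" by simp
      have "N * D\<Phi> + D1 + a * (sqp t - \<omega> * \<Psi> t) + b' * D2
          \<le> - (r * Q + r * sqp t + r * W + r * Mem t + r * \<Psi> t)"
      proof -
        \<comment> \<open>The bookkeeping is done for abstract reals, so that every product counts
          as one atom in the linear arithmetic.\<close>
        have "A1 + A2 + (s8 - (o1 + o1)) + A3 \<le> - (rq + rs + rw + rm + rp)"
          if "A1 \<le> - X - Y" "A2 \<le> dq - (s4 + s8 + s8)" "A3 \<le> - bw + bd + bs + bm" "bs \<le> s8" "bm \<le> o1"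
            "dq + bd + Q' \<le> X" "mm \<le> Y" "rq \<le> Q'" "rs \<le> s4" "rw \<le> bw" "rm \<le> mm" "rp \<le> o1"
          for A1 A2 A3 s4 s8 o1 rq rs rw rm rp X Y dq bw bd bs bm Q' mm :: real
          using that by linarith
        from this[OF 1 2[folded 12] 3 4 5 6[unfolded 9] 7 8(1)[unfolded mult_1] 8(2-5)]
        show ?thesis unfolding 10 11 by simp
      qed
      also have "\<dots> = - (r / CU) * (CU * (energy_density t + \<Psi> t))"
        using CU1 by (simp add: energy_density_def Q_def W_def algebra_simps)
      also have "\<dots> \<le> - (r / CU) * L t"
        using upper[OF t] r0 CU1 by (intro mult_left_mono_neg) auto
      finally have "N * D\<Phi> + D1 + a * (sqp t - \<omega> * \<Psi> t) + b' * D2 \<le> - (r / CU) * L t" .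
      moreover have "G t = L t" by (simp add: G_def L_def G0(2))
      moreover have "\<forall>\<^sub>F x in at_right t. L x \<le> G x"
        unfolding eventually_at_right_field
        using G0(3) N1 by (intro exI[of _ "t + 1"]) (auto simp: L_def G_def intro!: mult_left_mono)
      ultimately show ?thesis using der by blast
    qed
    have "energy_density T \<le> L T" by (rule lower[OF T])
    also have "\<dots> \<le> L 0 * exp (- (r / CU) * T)"
      by (rule exponential_decay_touching[OF Lc touch T])
    \<comment> \<open>At time 0 both \<open>\<Psi>\<close> and the memory term vanish, which leaves
      the norms of the data.\<close>
    also have "\<dots> \<le> CU * energy_density 0 * exp (- (r / CU) * T)"
      using upper[of 0] by (intro mult_right_mono) (auto simp: \<Psi>_0)
    finally show "(norm (p T))\<^sup>2 + (norm (q T))\<^sup>2 + (norm (w T))\<^sup>2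
        + integral {0..T} (\<lambda>s. \<mu> s * (norm (p T - p (T - s)))\<^sup>2)
      \<le> CU * ((norm (p 0))\<^sup>2 + (norm (q 0))\<^sup>2 + (norm (w 0))\<^sup>2) * exp (- (r / CU) * T)"
      by (simp add: energy_density_def sqp_def Mem_def)
  qed
qed

section \<open>The kernel\<close>

lemma exp_lipschitz:
  assumes "0 \<le> a" "\<rho> \<ge> 0"
  shows "\<rho>-lipschitz_on {a..b} (\<lambda>x. exp (- \<rho> * x))"
proof (rule lipschitz_onI)
  fix x y assume xy: "x \<in> {a..b}" "y \<in> {a..b}"
  have "norm (exp (- \<rho> * x) - exp (- \<rho> * y)) \<le> \<rho> * norm (x - y)"
  proof (rule field_differentiable_bound[OF _ _ _ xy])
    fix z assume z: "z \<in> {a..b}"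
    show "((\<lambda>x. exp (- \<rho> * x)) has_field_derivative - \<rho> * exp (- \<rho> * z)) (at z within {a..b})"
      by (auto intro!: derivative_eq_intros)
    show "norm (- \<rho> * exp (- \<rho> * z)) \<le> \<rho>"
      using z assms by (simp add: abs_mult mult_left_le)
  qed simp
  then show "dist (exp (- \<rho> * x)) (exp (- \<rho> * y)) \<le> \<rho> * dist x y"
    by (simp add: dist_norm)
qed (use assms in simp)

section \<open>Extension of the kernel to the closed half-line\<close>

text \<open>The given g is nonincreasing and bounded for s > 0, so this is its limit at 0 from the
  right; the actual value \<open>g 0\<close> is arbitrary.\<close>

definition kernel_at_0 :: "(real \<Rightarrow> real) \<Rightarrow> real" where
  "kernel_at_0 g = (SUP s\<in>{0<..}. g s)"

definition kernel_ext :: "(real \<Rightarrow> real) \<Rightarrow> real \<Rightarrow> real" where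
  "kernel_ext g s = (if s \<le> 0 then kernel_at_0 g else g s)"

text \<open>The value 0 replaces the meaningless \<open>deriv g 0\<close> and keeps the function
  nonnegative on the closed half-line.\<close>

definition kernel_slope :: "(real \<Rightarrow> real) \<Rightarrow> real \<Rightarrow> real" where
  "kernel_slope g s = (if s \<le> 0 then 0 else - deriv g s)"

locale mgt_kernel =
  fixes g :: "real \<Rightarrow> real" and \<gamma> M \<omega> :: real
  assumes g1: "kernel_g1 \<gamma> g" and g2: "kernel_g2 g"
    and g_le: "\<And>s. s > 0 \<Longrightarrow> g s \<le> M * exp (- \<omega> * s)" and M_pos: "M > 0" and \<omega>_pos: "\<omega> > 0"
begin

lemma g_deriv: "s > 0 \<Longrightarrow> (g has_real_derivative deriv g s) (at s)"
  using g1 by (auto simp: kernel_g1_def DERIV_deriv_iff_field_differentiable)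

lemma g_nonneg: "s > 0 \<Longrightarrow> 0 \<le> g s" and deriv_g_nonpos: "s > 0 \<Longrightarrow> deriv g s \<le> 0"
  using g2 by (auto simp: kernel_g2_def)

lemma g_integrable: "set_integrable lborel {0<..} g" and deriv_g_integrable: "set_integrable lborel {0<..} (deriv g)"
  using g1 by (auto simp: kernel_g1_def)

lemma deriv_g_cont: "continuous_on {0<..} (deriv g)"
proof (intro continuous_at_imp_continuous_on ballI)
  fix s :: real assume "s \<in> {0<..}"
  then have s: "s > 0" by simp
  have "abs_cont_on (s / 2) (s + 1) (deriv g)"
    using g1 s by (auto simp: kernel_g1_def)
  then have "continuous_on {s/2..s+1} (deriv g)" by (rule abs_cont_on_imp_continuous_on)
  then show "isCont (deriv g) s"
    by (rule continuous_on_interior) (use s in simp)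
qed

lemma g_antimono: "0 < s \<Longrightarrow> s \<le> t \<Longrightarrow> g t \<le> g s"
  by (rule DERIV_nonpos_imp_nonincreasing[of s t g]) (auto intro!: exI[of _ "deriv g _"] g_deriv deriv_g_nonpos)

lemma g_le_M: "s > 0 \<Longrightarrow> g s \<le> M"
proof -
  assume s: "s > 0"
  have "M * exp (- \<omega> * s) \<le> M * 1" using s M_pos \<omega>_pos by (intro mult_left_mono) auto
  then show ?thesis using g_le[OF s] by simp
qed

lemma kernel_at_0_ge: "s > 0 \<Longrightarrow> g s \<le> kernel_at_0 g"
  unfolding kernel_at_0_def using g_le_M by (intro cSUP_upper bdd_aboveI2[of _ _ M]) auto

lemma kernel_at_0_le: "kernel_at_0 g \<le> M"
  unfolding kernel_at_0_def using g_le_M by (intro cSUP_least) auto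

lemma kernel_tendsto: "(g \<longlongrightarrow> kernel_at_0 g) (at_right 0)"
proof (rule order_tendstoI)
  fix a assume "a < kernel_at_0 g"
  then obtain s where s: "s > 0" "a < g s"
    unfolding kernel_at_0_def using less_cSUP_iff[of "{0<..}" g a] bdd_aboveI2[of "{0<..}" g M] g_le_M by auto
  have "a < g x" if "0 < x" "x < s" for x using g_antimono[of x s] that s by simp
  then show "\<forall>\<^sub>F x in at_right 0. a < g x" unfolding eventually_at_right_field using s(1) by blast
next
  fix a assume "kernel_at_0 g < a"
  then have "g x < a" if "0 < x" for x using kernel_at_0_ge[OF that] by simp
  then show "\<forall>\<^sub>F x in at_right 0. g x < a" unfolding eventually_at_right_field by (intro exI[of _ 1]) auto
qed

lemma kernel_ext_cont: "continuous_on {0..} (kernel_ext g)"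
  unfolding continuous_on_eq_continuous_within
proof
  fix s :: real assume "s \<in> {0..}"
  then consider "s = 0" | "s > 0" by fastforce
  then show "continuous (at s within {0..}) (kernel_ext g)"
  proof cases
    case 1
    have "(kernel_ext g \<longlongrightarrow> kernel_at_0 g) (at_right 0)"
      by (rule Lim_transform_eventually[OF kernel_tendsto])
         (auto simp: eventually_at_right_field kernel_ext_def intro!: exI[of _ 1])
    then show ?thesis using 1
      by (simp add: continuous_within kernel_ext_def at_within_Ici_at_right)
  next
    case 2
    have "isCont g s" using g_deriv[OF 2] by (rule DERIV_isCont)
    moreover have "\<forall>\<^sub>F x in nhds s. kernel_ext g x = g x"
      using eventually_nhds_in_open[of "{0<..}" s] 2 by (auto simp: kernel_ext_def elim!: eventually_mono)
    ultimately have "isCont (kernel_ext g) s" by (simp add: isCont_cong)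
    then show ?thesis by (rule continuous_at_imp_continuous_at_within)
  qed
qed

lemma kernel_ext_deriv: "s > 0 \<Longrightarrow> (kernel_ext g has_real_derivative - kernel_slope g s) (at s)"
proof -
  assume s: "s > 0"
  have "\<forall>\<^sub>F x in nhds s. kernel_ext g x = g x"
    using eventually_nhds_in_open[of "{0<..}" s] s by (auto simp: kernel_ext_def elim!: eventually_mono)
  then show ?thesis using g_deriv[OF s] s
    by (subst DERIV_cong_ev[OF refl _ refl, of _ g]) (auto simp: kernel_slope_def)
qed

lemma kernel_ext_has_integral: "(kernel_ext g has_integral (LINT s:{0<..}|lborel. g s)) {0..}"
proof -
  have "(g has_integral (LINT s:{0<..}|lborel. g s)) {0<..}"
    using set_borel_integral_eq_integral[OF g_integrable] by (simp add: has_integral_iff)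
  then have "((\<lambda>s. if s \<in> {0<..} then g s else 0) has_integral (LINT s:{0<..}|lborel. g s)) UNIV"
    by (simp only: has_integral_restrict_UNIV)
  then have "((\<lambda>s. if s \<in> {0..} then kernel_ext g s else 0) has_integral (LINT s:{0<..}|lborel. g s)) UNIV"
    by (rule has_integral_spike_finite[of "{0}", rotated 2]) (auto simp: kernel_ext_def)
  then show ?thesis by (simp only: has_integral_restrict_UNIV)
qed

lemma kernel_ext_nonneg: "0 \<le> s \<Longrightarrow> 0 \<le> kernel_ext g s"
  using g_nonneg[of s] g_nonneg[of 1] kernel_at_0_ge[of 1] by (simp add: kernel_ext_def)

lemma kernel_ext_le: "0 \<le> s \<Longrightarrow> kernel_ext g s \<le> M * exp (- \<omega> * s)"
  using kernel_at_0_le g_le by (simp add: kernel_ext_def)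

text \<open>The assumed inequality says that - g'(s) exp(- \<rho> s) has nonpositive derivative
  almost everywhere; local absolute continuity of g' makes this product nonincreasing.\<close>

lemma kernel_slope_grow:
  assumes ae: "AE s in lborel. 0 < s \<longrightarrow> deriv g field_differentiable (at s) \<and>
      \<rho> * deriv g s - deriv (deriv g) s \<le> 0"
    and \<rho>: "\<rho> \<ge> 0" and s: "s > 0" and h: "h \<ge> 0"
  shows "kernel_slope g (s + h) \<le> exp (\<rho> * h) * kernel_slope g s"
proof -
  have "abs_cont_on s (s + h) (deriv g)" using g1 s h by (auto simp: kernel_g1_def)
  from abs_cont_on_mult_lipschitz[OF this lipschitz_on_minus[OF exp_lipschitz[OF less_imp_le[OF s] \<rho>]]]
  have ac: "abs_cont_on s (s + h) (\<lambda>x. deriv g x * - exp (- \<rho> * x))" .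
  have "deriv g (s + h) * - exp (- \<rho> * (s + h)) \<le> deriv g s * - exp (- \<rho> * s)"
  proof (rule abs_cont_on_nonincreasing[OF ac])
    show "AE x in lborel. s < x \<and> x < s + h \<longrightarrow>
        (\<exists>D\<le>0. ((\<lambda>x. deriv g x * - exp (- \<rho> * x)) has_real_derivative D) (at x))"
      using ae
    proof eventually_elim
      case (elim x)
      show ?case
      proof
        assume "s < x \<and> x < s + h"
        then have x: "deriv g field_differentiable (at x)" "\<rho> * deriv g x - deriv (deriv g) x \<le> 0"
          using elim s by auto
        have "(deriv g has_real_derivative deriv (deriv g) x) (at x)"
          using x(1) by (simp add: DERIV_deriv_iff_field_differentiable)
        then have "((\<lambda>x. deriv g x * - exp (- \<rho> * x)) has_real_derivative
            (\<rho> * deriv g x - deriv (deriv g) x) * exp (- \<rho> * x)) (at x)"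
          by (auto intro!: derivative_eq_intros simp: algebra_simps)
        moreover have "(\<rho> * deriv g x - deriv (deriv g) x) * exp (- \<rho> * x) \<le> 0"
          using x(2) by (simp add: mult_nonpos_nonneg)
        ultimately show "\<exists>D\<le>0. ((\<lambda>x. deriv g x * - exp (- \<rho> * x)) has_real_derivative D) (at x)" by blast
      qed
    qed
  qed (use h in simp)
  from mult_left_mono[OF this, of "exp (\<rho> * (s + h))"]
  have "exp (\<rho> * (s + h)) * (deriv g (s + h) * - exp (- \<rho> * (s + h)))
      \<le> exp (\<rho> * (s + h)) * (deriv g s * - exp (- \<rho> * s))" by simp
  moreover have "exp (\<rho> * (s + h)) * exp (- \<rho> * (s + h)) = 1" by (simp flip: exp_add)
  moreover have "exp (\<rho> * (s + h)) * exp (- \<rho> * s) = exp (\<rho> * h)"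
    by (simp add: algebra_simps flip: exp_add)
  ultimately have "- deriv g (s + h) \<le> exp (\<rho> * h) * (- deriv g s)"
    by (metis (no_types, opaque_lifting) mult.left_commute mult_minus_left mult_minus_right mult_1 mult.commute)
  then show ?thesis using s h by (simp add: kernel_slope_def)
qed

lemma memory_kernel:
  assumes "AE s in lborel. 0 < s \<longrightarrow> deriv g field_differentiable (at s) \<and>
      \<rho> * deriv g s - deriv (deriv g) s \<le> 0" and "\<rho> \<ge> 0"
  shows "memory_kernel (kernel_ext g) (kernel_slope g) \<rho> (LINT s:{0<..}|lborel. g s) M \<omega>"
proof
  let ?\<kappa> = "LINT s:{0<..}|lborel. g s"
  show "continuous_on {0..} (kernel_ext g)" by (rule kernel_ext_cont)
  show "(kernel_ext g has_real_derivative - kernel_slope g s) (at s)" if "s > 0" for s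
    by (rule kernel_ext_deriv[OF that])
  show "0 \<le> kernel_slope g s" if "s \<ge> 0" for s
    using deriv_g_nonpos[of s] by (simp add: kernel_slope_def)
  show "kernel_slope g (s + h) \<le> exp (\<rho> * h) * kernel_slope g s" if "s > 0" "h \<ge> 0" for s h
    by (rule kernel_slope_grow[OF assms that])
  show "0 \<le> kernel_ext g s" "kernel_ext g s \<le> M * exp (- \<omega> * s)" if "s \<ge> 0" for s
    using kernel_ext_nonneg[OF that] kernel_ext_le[OF that] by auto
  show "M > 0" "\<omega> > 0" by (fact M_pos \<omega>_pos)+
  have ai: "kernel_ext g absolutely_integrable_on {0..}"
    using kernel_ext_has_integral kernel_ext_nonneg by (intro nonnegative_absolutely_integrable_1) auto
  fix t :: real assume t: "t \<ge> 0"
  have int1: "kernel_ext g integrable_on {0..t}"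
    by (intro integrable_continuous_interval continuous_on_subset[OF kernel_ext_cont]) auto
  have "set_integrable lebesgue {t..} (kernel_ext g)"
    by (rule set_integrable_subset[OF ai]) (use t in auto)
  then have int2: "kernel_ext g integrable_on {t..}" by (rule set_lebesgue_integral_eq_integral(1))
  have "(kernel_ext g has_integral integral {0..t} (kernel_ext g) + integral {t..} (kernel_ext g)) ({0..t} \<union> {t..})"
    by (rule has_integral_Un[OF integrable_integral[OF int1] integrable_integral[OF int2]],
        rule negligible_subset[of "{t}"]) auto
  moreover have "{0..t} \<union> {t..} = {0..}" using t by auto
  \<comment> \<open>The mass missing from [0, t] is the integral over [t, infinity), which the
    integral of M exp(- \<omega> s) bounds.\<close>
  ultimately have sum: "?\<kappa> = integral {0..t} (kernel_ext g) + integral {t..} (kernel_ext g)"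
    using has_integral_unique[OF kernel_ext_has_integral] by simp
  have "0 \<le> integral {t..} (kernel_ext g)"
    using t kernel_ext_nonneg by (intro integral_nonneg int2) auto
  then show "integral {0..t} (kernel_ext g) \<le> ?\<kappa>" using sum by simp
  have e: "((\<lambda>x. M * exp (- \<omega> * x)) has_integral M * (exp (- \<omega> * t) / \<omega>)) {t..}"
    by (intro has_integral_mult_right has_integral_exp_minus_to_infinity \<omega>_pos)
  have "integral {t..} (kernel_ext g) \<le> M * (exp (- \<omega> * t) / \<omega>)"
    using t kernel_ext_le by (intro has_integral_le[OF integrable_integral[OF int2] e]) auto
  then show "?\<kappa> - integral {0..t} (kernel_ext g) \<le> M / \<omega> * exp (- \<omega> * t)" using sum by simp
qed

text \<open>Links the Lebesgue integral in the energy with the gauge integral used for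
  \<open>Mem\<close>; \<open>h\<close> is bounded, so summability of g' gives integrability.\<close>

lemma memory_integral_eq:
  assumes h: "continuous_on {0..t} h"
  shows "(LINT s:{0<..<t}|lborel. - deriv g s * h s) = integral {0..t} (\<lambda>s. kernel_slope g s * h s)"
proof -
  obtain B where B: "\<And>s. s \<in> {0..t} \<Longrightarrow> \<bar>h s\<bar> \<le> B" "B \<ge> 0"
  proof -
    have "bounded (h ` {0..t})" using h by (intro compact_imp_bounded compact_continuous_image) auto
    then obtain b where "b > 0" "\<forall>x\<in>{0..t}. norm (h x) \<le> b" unfolding bounded_pos by auto
    then show thesis by (intro that[of b]) auto
  qed
  have d: "set_integrable lborel {0<..<t} (\<lambda>s. B * deriv g s)"
    by (intro set_integrable_mult_right set_integrable_subset[OF deriv_g_integrable]) auto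
  have "set_integrable lborel {0<..<t} (\<lambda>s. - deriv g s * h s)"
  proof (rule set_integrable_bound[OF d])
    have "continuous_on {0<..<t} (\<lambda>s. - deriv g s * h s)"
      by (intro continuous_intros continuous_on_subset[OF deriv_g_cont] continuous_on_subset[OF h]) auto
    then show "set_borel_measurable lborel {0<..<t} (\<lambda>s. - deriv g s * h s)"
      using borel_measurable_continuous_on_indicator[of "{0<..<t}" "\<lambda>s. - deriv g s * h s"]
      by (simp add: set_borel_measurable_def)
    show "AE s in lborel. s \<in> {0<..<t} \<longrightarrow> norm (- deriv g s * h s) \<le> norm (B * deriv g s)"
      using B by (auto simp: abs_mult mult.commute intro!: mult_right_mono)
  qed
  from set_borel_integral_eq_integral(2)[OF this]
  have "(LINT s:{0<..<t}|lborel. - deriv g s * h s) = integral {0<..<t} (\<lambda>s. - deriv g s * h s)" .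
  also have "\<dots> = integral {0<..<t} (\<lambda>s. kernel_slope g s * h s)"
    by (rule integral_cong) (simp add: kernel_slope_def)
  finally show ?thesis by (simp add: integral_open_interval_real)
qed

lemma convolution_integral_eq:
  assumes h: "continuous_on {0..t} h"
  shows "(LINT s:{0<..<t}|lborel. g s * h s) = integral {0..t} (\<lambda>s. kernel_ext g s * h s)"
proof -
  have "set_integrable lborel {0..t} (\<lambda>s. kernel_ext g s * h s)"
    by (intro borel_integrable_atLeastAtMost' continuous_intros h continuous_on_subset[OF kernel_ext_cont]) auto
  then have i: "set_integrable lborel {0<..<t} (\<lambda>s. kernel_ext g s * h s)"
    by (rule set_integrable_subset) auto
  have "(LINT s:{0<..<t}|lborel. g s * h s) = (LINT s:{0<..<t}|lborel. kernel_ext g s * h s)"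
    by (rule set_lebesgue_integral_cong) (auto simp: kernel_ext_def)
  also have "\<dots> = integral {0<..<t} (\<lambda>s. kernel_ext g s * h s)"
    by (rule set_borel_integral_eq_integral(2)[OF i])
  finally show ?thesis by (simp add: integral_open_interval_real)
qed

end

section \<open>Regularisation of weak solutions\<close>

lemma norm_blinfun_inner_right: "norm (blinfun_inner_right x :: 'a::real_inner \<Rightarrow>\<^sub>L real) = norm x"
proof (rule antisym)
  show "norm (blinfun_inner_right x :: 'a \<Rightarrow>\<^sub>L real) \<le> norm x"
    by (rule norm_blinfun_bound) (simp_all add: Cauchy_Schwarz_ineq2)
  have "norm x * norm x \<le> norm (blinfun_inner_right x :: 'a \<Rightarrow>\<^sub>L real) * norm x"
    using norm_blinfun[of "blinfun_inner_right x" x] by (simp add: dot_square_norm power2_eq_square)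
  then show "norm x \<le> norm (blinfun_inner_right x :: 'a \<Rightarrow>\<^sub>L real)"
    by (cases "x = 0") simp_all
qed

text \<open>The Riesz map is isometric, so the remainder of the linearisation has the same norm in
  the dual and in the space.\<close>

lemma has_vector_derivative_inner_rightD:
  fixes X :: "real \<Rightarrow> 'a::real_inner"
  assumes "((\<lambda>t. blinfun_inner_right (X t) :: 'a \<Rightarrow>\<^sub>L real) has_vector_derivative blinfun_inner_right y) (at t within S)"
  shows "(X has_vector_derivative y) (at t within S)"
proof -
  interpret bounded_linear "blinfun_inner_right :: 'a \<Rightarrow> 'a \<Rightarrow>\<^sub>L real"
    by (rule bounded_linear_blinfun_inner_right)
  have eq: "norm (blinfun_inner_right (X s) - blinfun_inner_right (X t) - (s - t) *\<^sub>R blinfun_inner_right y :: 'a \<Rightarrow>\<^sub>L real)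
      = norm (X s - X t - (s - t) *\<^sub>R y)" for s
    by (simp add: norm_blinfun_inner_right flip: diff scaleR)
  show ?thesis
    using assms unfolding has_vector_derivative_def has_derivative_within_alt eq
    by (simp add: bounded_linear_scaleR_left)
qed

lemma riesz_blinfun:
  fixes \<phi> :: "'a::{real_inner,complete_space} \<Rightarrow>\<^sub>L real"
  shows "\<exists>y. \<phi> = blinfun_inner_right y"
proof -
  obtain y where "\<And>x. \<phi> x = inner x y"
    using riesz_representation[OF blinfun.bounded_linear_right[of \<phi>]] by blast
  then have "\<phi> = blinfun_inner_right y" by (intro blinfun_eqI) (simp add: inner_commute)
  then show ?thesis ..
qed

lemma at_within_Ici_eq:
  fixes t :: real
  assumes "0 \<le> t" shows "at t within {0..} = at t within {0..t + 1}"
  by (rule at_within_nhd[of _ "{..<t + 1}"]) (use assms in auto)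

locale weak_mgt = mgt_kernel g \<gamma> M \<omega> for g \<gamma> M \<omega> +
  fixes A :: "'a::{real_inner,complete_space} unb_op" and \<alpha> \<beta> l :: real and U0 u v w
  assumes A: "selfadjoint A" and l: "l > 0" "\<And>x. x \<in> op_dom A \<Longrightarrow> l * (norm x)\<^sup>2 \<le> inner (op_app A x) x"
    and sol: "global_weak_solution A \<alpha> \<beta> \<gamma> g U0 u v w"
begin

definition B :: "'a \<Rightarrow> 'a" where "B = op_app (sqrt_op A)"

lemma sqrt_selfadjoint: "selfadjoint (sqrt_op A)"
proof -
  have "strictly_positive A" using l by (auto simp: strictly_positive_def)
  from is_sqrt_op_sqrt_op[OF A this] show ?thesis by (simp add: is_sqrt_op_def)
qed

lemma B_diff: "x \<in> H1 A \<Longrightarrow> y \<in> H1 A \<Longrightarrow> B (x - y) = B x - B y"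
  unfolding B_def H1_def by (rule op_linear(4)[OF sqrt_selfadjoint])

lemma norm1_eq: "norm1 A x = norm (B x)"
  by (simp add: norm1_def B_def)

lemma weak: "T > 0 \<Longrightarrow> weak_solution_on A \<alpha> \<beta> \<gamma> g U0 T u v w"
  using sol by (simp add: global_weak_solution_def)


lemma du: "t \<ge> 0 \<Longrightarrow> (u has_vector_derivative v t) (at t within {0..})"
  and dv: "t \<ge> 0 \<Longrightarrow> (v has_vector_derivative w t) (at t within {0..})"
  using weak[of "t + 1"] by (simp_all add: weak_solution_on_def at_within_Ici_eq)

lemma u_cont: "continuous_on {0..} u" and v_cont: "continuous_on {0..} v"
  using du dv by (auto intro!: continuous_on_vector_derivative)

lemma phase: "t \<ge> 0 \<Longrightarrow> phase_continuous_on A {0..t + 1} (\<lambda>t. (u t, v t, w t))"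
  using weak[of "t + 1"] by (simp add: weak_solution_on_def)

lemma u_H1: "t \<ge> 0 \<Longrightarrow> u t \<in> H1 A" and v_H1: "t \<ge> 0 \<Longrightarrow> v t \<in> H1 A"
  using phase[of t] by (auto simp: phase_continuous_on_def phase_space_def)

lemma phase_tendsto:
  assumes t: "t \<ge> 0"
  shows "((\<lambda>s. phase_norm A (u s - u t, v s - v t, w s - w t)) \<longlongrightarrow> 0) (at t within {0..})"
  using phase[OF t] t by (simp add: phase_continuous_on_def at_within_Ici_eq)

lemma w_cont: "continuous_on {0..} w"
  unfolding continuous_on_def
proof
  fix t :: real assume "t \<in> {0..}"
  then have t: "((\<lambda>s. phase_norm A (u s - u t, v s - v t, w s - w t)) \<longlongrightarrow> 0) (at t within {0..})"
    using phase_tendsto[of t] by simp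
  have "((\<lambda>s. norm (w s - w t)) \<longlongrightarrow> 0) (at t within {0..})"
    by (rule Lim_null_comparison[OF _ t])
       (auto simp: phase_norm_def intro!: always_eventually real_le_rsqrt)
  then show "(w \<longlongrightarrow> w t) (at t within {0..})" by (simp add: tendsto_norm_zero_iff LIM_zero_iff)
qed

lemma Bu_cont: "continuous_on {0..} (\<lambda>t. B (u t))"
  unfolding continuous_on_def
proof
  fix t :: real assume t: "t \<in> {0..}"
  have ev: "\<forall>\<^sub>F s in at t within {0..}. norm (norm (B (u s) - B (u t))) \<le> phase_norm A (u s - u t, v s - v t, w s - w t)"
    unfolding eventually_at_filter
  proof (intro always_eventually allI impI)
    fix s :: real assume "s \<in> {0..}"
    then have "B (u s) - B (u t) = B (u s - u t)" using t by (simp add: B_diff u_H1)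
    then show "norm (norm (B (u s) - B (u t))) \<le> phase_norm A (u s - u t, v s - v t, w s - w t)"
      by (auto simp: phase_norm_def norm1_eq intro!: real_le_rsqrt)
  qed
  have "((\<lambda>s. norm (B (u s) - B (u t))) \<longlongrightarrow> 0) (at t within {0..})"
    by (rule Lim_null_comparison[OF ev]) (use phase_tendsto[of t] t in simp)
  then show "((\<lambda>t. B (u t)) \<longlongrightarrow> B (u t)) (at t within {0..})"
    by (simp add: tendsto_norm_zero_iff LIM_zero_iff)
qed

text \<open>Testing with J \<xi> and moving the symmetric J across turns the dual-valued equation
  into one for J w with the bounded operators J and C. Its right-hand side is continuous in time, so
  J w is continuously differentiable in the Hilbert space itself.\<close>

lemma regularised_solution:
  assumes kernel: "memory_kernel (kernel_ext g) (kernel_slope g) \<rho> \<kappa> M \<omega>"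
    and J: "bounded_linear J" and L: "bounded_linear L" and C: "bounded_linear C"
    and JH1: "\<And>x. J x \<in> H1 A"
    and lower: "\<And>x. l * (norm (J x))\<^sup>2 \<le> (norm (L x))\<^sup>2"
    and sym: "\<And>x y. inner (J x) y = inner x (J y)"
    and CJ: "\<And>x y. inner (C x) (J y) = inner (L x) (L y)"
    and CH1: "\<And>x y. x \<in> H1 A \<Longrightarrow> inner1 A x (J y) = inner (C x) y"
  shows "\<exists>f. mgt_solution (kernel_ext g) (kernel_slope g) \<rho> \<kappa> M \<omega> \<alpha> \<beta> \<gamma> (1 / sqrt l)
    (\<lambda>t. J (u t)) (\<lambda>t. J (v t)) (\<lambda>t. J (w t)) f (\<lambda>t. L (u t)) (\<lambda>t. L (v t)) (\<lambda>t. L (w t))"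
proof -
  let ?k = "kernel_ext g"
  let ?i = "blinfun_inner_right :: 'a \<Rightarrow> 'a \<Rightarrow>\<^sub>L real"
  \<comment> \<open>The right-hand side of the equation for J w, kept in the dual for integration;
    \<open>f\<close> will be its Riesz representative.\<close>
  define F where "F t = integral {0..t} (\<lambda>s. ?k s *\<^sub>R ?i (C (u (t - s)))) - \<alpha> *\<^sub>R ?i (J (w t))
      - \<beta> *\<^sub>R ?i (C (v t)) - \<gamma> *\<^sub>R ?i (C (u t))" for t
  note bl = bounded_linear.continuous_on[OF J w_cont] bounded_linear.continuous_on[OF C v_cont]
    bounded_linear.continuous_on[OF C u_cont]
  note blc = bl[THEN bounded_linear.continuous_on[OF bounded_linear_blinfun_inner_right]]
  have Fc: "continuous_on {0..} F"
    unfolding F_def[abs_def] by (intro continuous_intros conv_continuous kernel_ext_cont blc)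
  have F_apply: "F t \<xi> = integral {0..t} (\<lambda>s. ?k s * inner (C (u (t - s))) \<xi>) - \<alpha> * inner (J (w t)) \<xi>
      - \<beta> * inner (C (v t)) \<xi> - \<gamma> * inner (C (u t)) \<xi>" for t \<xi>
  proof -
    have "((\<lambda>s. ?k s *\<^sub>R ?i (C (u (t - s)))) has_integral integral {0..t} (\<lambda>s. ?k s *\<^sub>R ?i (C (u (t - s))))) {0..t}"
      by (intro integrable_integral conv_integrable kernel_ext_cont blc)
    from has_integral_linear[OF this blinfun.bounded_linear_left[of \<xi>]]
    have "((\<lambda>s. ?k s * inner (C (u (t - s))) \<xi>) has_integral
        blinfun_apply (integral {0..t} (\<lambda>s. ?k s *\<^sub>R ?i (C (u (t - s))))) \<xi>) {0..t}"
      by (simp add: o_def blinfun.scaleR_left)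
    from integral_unique[OF this] show ?thesis
      by (simp add: F_def blinfun.diff_left blinfun.scaleR_left)
  qed
  have main: "inner (J (w t)) \<xi> - inner (J (w 0)) \<xi> = integral {0..t} (\<lambda>s. F s \<xi>)" if t: "t \<ge> 0" for t \<xi>
  proof -
    obtain z' where z': "is_dual_derivative A (t + 1) w z'"
      and eq: "\<forall>\<zeta>\<in>H1 A. AE s in lborel. s \<in> {0..t + 1} \<longrightarrow>
           z' s \<zeta> + \<alpha> * inner (w s) \<zeta> + \<beta> * inner1 A (v s) \<zeta> + \<gamma> * inner1 A (u s) \<zeta>
             - (LINT r:{0<..<s}|lborel. g r * inner1 A (u (s - r)) \<zeta>) = 0"
      using weak[of "t + 1"] t by (auto simp: weak_solution_on_def)
    have zint: "set_integrable lborel {0..t + 1} (\<lambda>s. z' s (J \<xi>))"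
      and ztc: "inner (w t) (J \<xi>) - inner (w 0) (J \<xi>) = (LINT s:{0..t}|lborel. z' s (J \<xi>))"
      using z' JH1 t by (auto simp: is_dual_derivative_def)
    have Fsc: "continuous_on {0..t} (\<lambda>s. F s \<xi>)"
      by (intro bounded_linear.continuous_on[OF blinfun.bounded_linear_left] continuous_on_subset[OF Fc]) auto
    have Fi: "set_integrable lborel {0..t} (\<lambda>s. F s \<xi>)"
      by (rule borel_integrable_atLeastAtMost'[OF Fsc])
    have "(LINT s:{0..t}|lborel. z' s (J \<xi>)) = (LINT s:{0..t}|lborel. F s \<xi>)"
      unfolding set_lebesgue_integral_def
    proof (rule integral_cong_AE)
      have "set_integrable lborel {0..t} (\<lambda>s. z' s (J \<xi>))"
        by (rule set_integrable_subset[OF zint]) auto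
      then show "(\<lambda>s. indicator {0..t} s *\<^sub>R z' s (J \<xi>)) \<in> borel_measurable lborel"
        unfolding set_integrable_def by (rule borel_measurable_integrable)
      show "(\<lambda>s. indicator {0..t} s *\<^sub>R F s \<xi>) \<in> borel_measurable lborel"
        using Fi unfolding set_integrable_def by (rule borel_measurable_integrable)
      \<comment> \<open>The exceptional null set depends on the test vector; this is harmless, since
        \<open>\<xi>\<close> is fixed before integrating.\<close>
      show "AE s in lborel. indicator {0..t} s *\<^sub>R z' s (J \<xi>) = indicator {0..t} s *\<^sub>R F s \<xi>"
        using eq[rule_format, OF JH1[of \<xi>]]
      proof eventually_elim
        case (elim s)
        have "z' s (J \<xi>) = F s \<xi>" if s: "s \<in> {0..t}"
        proof -
          have "(LINT r:{0<..<s}|lborel. g r * inner1 A (u (s - r)) (J \<xi>))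
              = (LINT r:{0<..<s}|lborel. g r * inner (C (u (s - r))) \<xi>)"
            by (rule set_lebesgue_integral_cong) (auto simp: CH1 u_H1)
          also have "\<dots> = integral {0..s} (\<lambda>r. ?k r * inner (C (u (s - r))) \<xi>)"
            by (rule convolution_integral_eq)
               (auto intro!: continuous_intros continuous_on_compose2[OF bl(3)])
          finally show "z' s (J \<xi>) = F s \<xi>"
            using elim s by (simp add: F_apply CH1 u_H1 v_H1 sym)
        qed
        then show ?case by (simp split: split_indicator)
      qed
    qed
    also have "\<dots> = integral {0..t} (\<lambda>s. F s \<xi>)"
      by (rule set_borel_integral_eq_integral(2)[OF Fi])
    finally show ?thesis using ztc by (simp add: sym)
  qed
  have "\<forall>t. \<exists>y. F t = ?i y" by (intro allI riesz_blinfun)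
  from choice[OF this] obtain f where f0: "\<forall>t. F t = ?i (f t)" ..
  note f = f0[rule_format]
  have iJw: "?i (J (w t)) = ?i (J (w 0)) + integral {0..t} F" if t: "t \<ge> 0" for t
  proof (rule blinfun_eqI)
    fix \<xi>
    have "(F has_integral integral {0..t} F) {0..t}"
      by (intro integrable_integral integrable_continuous_interval continuous_on_subset[OF Fc]) auto
    from has_integral_linear[OF this blinfun.bounded_linear_left[of \<xi>]]
    have "integral {0..t} F \<xi> = integral {0..t} (\<lambda>s. F s \<xi>)"
      by (simp add: o_def integral_unique)
    then show "?i (J (w t)) \<xi> = (?i (J (w 0)) + integral {0..t} F) \<xi>"
      using main[OF t, of \<xi>] by (simp add: blinfun.add_left)
  qed
  have dw: "((\<lambda>t. J (w t)) has_vector_derivative f t) (at t within {0..})" if t: "t \<ge> 0" for t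
  proof (rule has_vector_derivative_inner_rightD)
    have "((\<lambda>t. integral {0..t} F) has_vector_derivative F t) (at t within {0..t + 1})"
      using t by (intro integral_has_vector_derivative continuous_on_subset[OF Fc]) auto
    then have "((\<lambda>t. ?i (J (w 0)) + integral {0..t} F) has_vector_derivative F t) (at t within {0..})"
      using t by (auto intro!: derivative_eq_intros simp: at_within_Ici_eq)
    then show "((\<lambda>t. ?i (J (w t))) has_vector_derivative ?i (f t)) (at t within {0..})"
      unfolding f[symmetric]
      by (rule has_vector_derivative_transform[rotated 2]) (simp add: t, rule iJw, simp)
  qed
  \<comment> \<open>For test vectors J y the identity \<open>CJ\<close> restores the symmetric form
    with A^(1/2); the regularised u, v and w are all of this kind.\<close>
  have eq: "inner (f t) (J y) = - \<alpha> * inner (J (w t)) (J y) - \<beta> * inner (L (v t)) (L y)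
        - \<gamma> * inner (L (u t)) (L y) + integral {0..t} (\<lambda>s. ?k s * inner (L (u (t - s))) (L y))" for t y
  proof -
    have "inner (f t) (J y) = F t (J y)" by (simp add: f)
    then show ?thesis by (simp add: F_apply CJ)
  qed
  have pc: "norm (J x) \<le> 1 / sqrt l * norm (L x)" for x
  proof -
    have "(sqrt l * norm (J x))\<^sup>2 \<le> (norm (L x))\<^sup>2"
      using lower[of x] l(1) by (simp add: power_mult_distrib)
    then have "sqrt l * norm (J x) \<le> norm (L x)" by (rule power2_le_imp_le) simp
    then show ?thesis using l(1) by (simp add: field_simps)
  qed
  have "mgt_solution ?k (kernel_slope g) \<rho> \<kappa> M \<omega> \<alpha> \<beta> \<gamma> (1 / sqrt l)
    (\<lambda>t. J (u t)) (\<lambda>t. J (v t)) (\<lambda>t. J (w t)) f (\<lambda>t. L (u t)) (\<lambda>t. L (v t)) (\<lambda>t. L (w t))"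
  proof (intro mgt_solution.intro kernel mgt_solution_axioms.intro)
    fix t :: real assume t: "t \<ge> 0"
    show "((\<lambda>t. J (u t)) has_vector_derivative J (v t)) (at t within {0..})"
      "((\<lambda>t. J (v t)) has_vector_derivative J (w t)) (at t within {0..})"
      "((\<lambda>t. L (u t)) has_vector_derivative L (v t)) (at t within {0..})"
      "((\<lambda>t. L (v t)) has_vector_derivative L (w t)) (at t within {0..})"
      by (intro bounded_linear.has_vector_derivative[OF J] bounded_linear.has_vector_derivative[OF L] du dv t)+
    show "((\<lambda>t. J (w t)) has_vector_derivative f t) (at t within {0..})" by (rule dw[OF t])
    show "norm (J (u t)) \<le> 1 / sqrt l * norm (L (u t))" "norm (J (v t)) \<le> 1 / sqrt l * norm (L (v t))"
      by (rule pc)+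
    fix x \<xi> assume "(x, \<xi>) \<in> {(\<lambda>t. J (u t), \<lambda>t. L (u t)), (\<lambda>t. J (v t), \<lambda>t. L (v t)), (\<lambda>t. J (w t), \<lambda>t. L (w t))}"
    then obtain y where "x = (\<lambda>t. J (y t))" "\<xi> = (\<lambda>t. L (y t))" by auto
    then show "inner (f t) (x t) = - \<alpha> * inner (J (w t)) (x t) - \<beta> * inner (L (v t)) (\<xi> t)
        - \<gamma> * inner (L (u t)) (\<xi> t) + integral {0..t} (\<lambda>s. ?k s * inner (L (u (t - s))) (\<xi> t))"
      by (simp add: eq)
  qed
  then show ?thesis by blast
qed

text \<open>On H^1 one has L = J A^(1/2), so the regularised energy is the original one with a
  contraction inserted: its initial value is at most E(0), and its value at t converges as the
  contractions tend strongly to the identity.\<close>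

lemma energy_decay:
  assumes kernel: "memory_kernel (kernel_ext g) (kernel_slope g) \<rho> \<kappa> M \<omega>"
    and decay: "\<And>(u :: real \<Rightarrow> 'a) v w f (p :: real \<Rightarrow> 'a) q z.
      mgt_solution (kernel_ext g) (kernel_slope g) \<rho> \<kappa> M \<omega> \<alpha> \<beta> \<gamma> (1 / sqrt l) u v w f p q z \<Longrightarrow>
      (norm (p t))\<^sup>2 + (norm (q t))\<^sup>2 + (norm (w t))\<^sup>2
        + integral {0..t} (\<lambda>s. kernel_slope g s * (norm (p t - p (t - s)))\<^sup>2)
      \<le> D * ((norm (p 0))\<^sup>2 + (norm (q 0))\<^sup>2 + (norm (w 0))\<^sup>2) * exp (- \<eta> * t)"
    and D: "D \<ge> 0" and t: "t \<ge> 0"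
  shows "energy A g u v w t \<le> D * energy A g u v w 0 * exp (- \<eta> * t)"
proof -
  interpret kernel: memory_kernel "kernel_ext g" "kernel_slope g" \<rho> \<kappa> M \<omega> by fact
  define good where "good i J L \<longleftrightarrow> bounded_linear J \<and> (\<forall>x. norm (J x) \<le> norm x) \<and>
      (\<forall>x\<in>H1 A. L x = J (B x)) \<and>
      (\<forall>x\<in>op_dom A. norm (J x - x) \<le> 1 / Suc i * norm (op_app A x)) \<and>
      (\<exists>f. mgt_solution (kernel_ext g) (kernel_slope g) \<rho> \<kappa> M \<omega> \<alpha> \<beta> \<gamma> (1 / sqrt l)
        (\<lambda>t. J (u t)) (\<lambda>t. J (v t)) (\<lambda>t. J (w t)) f (\<lambda>t. L (u t)) (\<lambda>t. L (v t)) (\<lambda>t. L (w t)))"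
    for i and J L :: "'a \<Rightarrow> 'a"
  have "\<exists>J L. good i J L" for i
  proof (rule resolvent[OF A _ l, of "1 / Suc i"])
    fix J L C :: "'a \<Rightarrow> 'a"
    assume J: "bounded_linear J" and L: "bounded_linear L" and C: "bounded_linear C"
      and *: "\<And>x. norm (J x) \<le> norm x" and JH1: "\<And>x. J x \<in> H1 A"
        "\<And>x. op_app (sqrt_op A) (J x) = L x"
      and LJ: "\<And>x. x \<in> H1 A \<Longrightarrow> L x = J (op_app (sqrt_op A) x)"
      and lower: "\<And>x. l * (norm (J x))\<^sup>2 \<le> (norm (L x))\<^sup>2"
      and sym: "\<And>x y. inner (J x) y = inner x (J y)"
      and CJ: "\<And>x y. inner (C x) (J y) = inner (L x) (L y)"
      and CH1: "\<And>x y. x \<in> H1 A \<Longrightarrow> inner1 A x (J y) = inner (C x) y"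
      and approx: "\<And>x. x \<in> op_dom A \<Longrightarrow> norm (J x - x) \<le> 1 / Suc i * norm (op_app A x)"
    show ?thesis
      using regularised_solution[OF kernel J L C JH1(1) lower sym CJ CH1] J * LJ approx
      unfolding good_def B_def by blast
  qed simp_all
  then obtain J L where good: "\<And>i. good i (J i) (L i)" by metis
  have JL: "\<And>i. bounded_linear (J i)" "\<And>i x. norm (J i x) \<le> norm x"
    "\<And>i x. x \<in> H1 A \<Longrightarrow> L i x = J i (B x)"
    "\<And>i x. x \<in> op_dom A \<Longrightarrow> norm (J i x - x) \<le> 1 / Suc i * norm (op_app A x)"
    using good unfolding good_def by blast+
  \<comment> \<open>The rate 1/(i + 1) on the dense domain of A becomes convergence on the whole
    space because all \<open>J i\<close> are contractions.\<close>
  have conv: "(\<lambda>i. J i x) \<longlonglongrightarrow> x" for x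
  proof (rule LIMSEQ_I)
    fix e :: real assume e: "e > 0"
    have "x \<in> closure (op_dom A)"
      using A by (simp add: selfadjoint_def densely_defined_linear_def)
    then obtain y where y: "y \<in> op_dom A" "norm (x - y) < e / 3"
      using e unfolding closure_approachable dist_norm by (metis norm_minus_commute divide_pos_pos zero_less_numeral)
    have "(\<lambda>i. 1 / Suc i * norm (op_app A y)) \<longlonglongrightarrow> 0 * norm (op_app A y)"
      by (intro tendsto_intros LIMSEQ_inverse_real_of_nat[unfolded inverse_eq_divide])
    then obtain N where N: "\<And>i. i \<ge> N \<Longrightarrow> norm (1 / Suc i * norm (op_app A y)) < e / 3"
      using LIMSEQ_D[of _ _ "e / 3"] e by fastforce
    have "norm (J i x - x) < e" if "i \<ge> N" for i
    proof -
      have "J i x - x = J i (x - y) + (J i y - y) - (x - y)"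
        using linear_diff[OF bounded_linear.linear[OF JL(1)], of i x y] by simp
      also have "norm \<dots> \<le> norm (J i (x - y)) + norm (J i y - y) + norm (x - y)"
        by (meson add_right_mono norm_triangle_ineq norm_triangle_ineq4 order_trans)
      also have "\<dots> < e / 3 + e / 3 + e / 3"
        using JL(2)[of i "x - y"] y(2)
          le_less_trans[OF order_trans[OF JL(4)[OF y(1), of i] abs_ge_self] N[OF that, unfolded real_norm_def]]
        by linarith
      finally show ?thesis by simp
    qed
    then show "\<exists>N. \<forall>i\<ge>N. norm (J i x - x) < e" by blast
  qed
  define y where "y s = B (u t) - B (u (t - s))" for s
  have yc: "continuous_on {0..t} y"
    unfolding y_def by (intro continuous_intros continuous_on_compose2[OF Bu_cont]) (use t in auto)
  define Mn where "Mn i = integral {0..t} (\<lambda>s. kernel_slope g s * (norm (J i (y s)))\<^sup>2)" for i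
  \<comment> \<open>As |J i (y s)| <= |y s|, the limit integrand itself is the dominating
    function.\<close>
  have Mn_lim: "Mn \<longlonglongrightarrow> integral {0..t} (\<lambda>s. kernel_slope g s * (norm (y s))\<^sup>2)"
    unfolding Mn_def
  proof (rule dominated_convergence(2))
    show "(\<lambda>s. kernel_slope g s * (norm (J i (y s)))\<^sup>2) integrable_on {0..t}" for i
      by (intro kernel.\<mu>_mult_integrable continuous_intros bounded_linear.continuous_on[OF JL(1) yc])
    show "(\<lambda>s. kernel_slope g s * (norm (y s))\<^sup>2) integrable_on {0..t}"
      by (intro kernel.\<mu>_mult_integrable continuous_intros yc)
    show "norm (kernel_slope g s * (norm (J i (y s)))\<^sup>2) \<le> kernel_slope g s * (norm (y s))\<^sup>2"
      if "s \<in> {0..t}" for i s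
      using that kernel.\<mu>_nonneg[of s] by (simp add: abs_mult mult_left_mono power_mono JL(2))
    show "(\<lambda>i. kernel_slope g s * (norm (J i (y s)))\<^sup>2) \<longlonglongrightarrow> kernel_slope g s * (norm (y s))\<^sup>2" for s
      by (intro tendsto_intros conv)
  qed
  have E0: "energy A g u v w 0 = (norm (B (u 0)))\<^sup>2 + (norm (B (v 0)))\<^sup>2 + (norm (w 0))\<^sup>2"
    by (simp add: energy_def norm1_eq set_lebesgue_integral_def)
  have "(LINT s:{0<..<t}|lborel. - deriv g s * (norm1 A (u t - u (t - s)))\<^sup>2)
      = (LINT s:{0<..<t}|lborel. - deriv g s * (norm (y s))\<^sup>2)"
    by (rule set_lebesgue_integral_cong) (use t in \<open>auto simp: norm1_eq y_def B_diff u_H1\<close>)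
  also have "\<dots> = integral {0..t} (\<lambda>s. kernel_slope g s * (norm (y s))\<^sup>2)"
    by (intro memory_integral_eq continuous_intros yc)
  finally have Et: "energy A g u v w t = (norm (B (u t)))\<^sup>2 + (norm (B (v t)))\<^sup>2 + (norm (w t))\<^sup>2
      + integral {0..t} (\<lambda>s. kernel_slope g s * (norm (y s))\<^sup>2)"
    by (simp add: energy_def norm1_eq)
  have le: "(norm (J i (B (u t))))\<^sup>2 + (norm (J i (B (v t))))\<^sup>2 + (norm (J i (w t)))\<^sup>2 + Mn i
      \<le> D * energy A g u v w 0 * exp (- \<eta> * t)" for i
  proof -
    obtain f where "mgt_solution (kernel_ext g) (kernel_slope g) \<rho> \<kappa> M \<omega> \<alpha> \<beta> \<gamma> (1 / sqrt l)
        (\<lambda>t. J i (u t)) (\<lambda>t. J i (v t)) (\<lambda>t. J i (w t)) f (\<lambda>t. L i (u t)) (\<lambda>t. L i (v t)) (\<lambda>t. L i (w t))"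
      using good[of i] unfolding good_def by blast
    note dec = decay[OF this]
    have "Mn i = integral {0..t} (\<lambda>s. kernel_slope g s * (norm (L i (u t) - L i (u (t - s))))\<^sup>2)"
      unfolding Mn_def y_def
      by (rule integral_cong) (use t in \<open>simp add: JL(3) u_H1 linear_diff[OF bounded_linear.linear[OF JL(1)]]\<close>)
    then have "(norm (J i (B (u t))))\<^sup>2 + (norm (J i (B (v t))))\<^sup>2 + (norm (J i (w t)))\<^sup>2 + Mn i
      \<le> D * ((norm (J i (B (u 0))))\<^sup>2 + (norm (J i (B (v 0))))\<^sup>2 + (norm (J i (w 0)))\<^sup>2) * exp (- \<eta> * t)"
      using dec t by (simp add: JL(3) u_H1 v_H1)
    also have "\<dots> \<le> D * energy A g u v w 0 * exp (- \<eta> * t)"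
      unfolding E0 using D by (intro mult_right_mono mult_left_mono add_mono power_mono JL(2)) auto
    finally show ?thesis .
  qed
  have "(\<lambda>i. (norm (J i (B (u t))))\<^sup>2 + (norm (J i (B (v t))))\<^sup>2 + (norm (J i (w t)))\<^sup>2 + Mn i) \<longlonglongrightarrow> energy A g u v w t"
    unfolding Et by (intro tendsto_intros conv Mn_lim)
  then show ?thesis by (rule LIMSEQ_le_const2) (use le in blast)
qed

end

theorem theorem4p3:
  fixes A :: "'a::{real_inner, complete_space} unb_op"
    and \<alpha> \<beta> \<gamma> M_g \<omega>_g :: real
    and g :: "real \<Rightarrow> real"
  assumes "selfadjoint A" and "strictly_positive A"
    and "\<alpha> > 0" and "\<beta> > 0" and "\<gamma> > 0"
    and "\<beta> - \<gamma> / \<alpha> > 0"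
    and "\<exists>s>0. g s \<noteq> 0"
    and "kernel_g1 \<gamma> g" and "kernel_g2 g" and "kernel_g3 \<alpha> g"
    and "M_g > 0" and "\<omega>_g > 0"
    and "\<And>s. s > 0 \<Longrightarrow> g s \<le> M_g * exp (- \<omega>_g * s)"
  shows "\<exists>M\<ge>1. \<exists>\<omega>>0. \<forall>U0\<in>phase_space A. \<forall>u v w.
           global_weak_solution A \<alpha> \<beta> \<gamma> g U0 u v w \<longrightarrow>
           (\<forall>t\<ge>0. energy A g u v w t \<le> M * energy A g u v w 0 * exp (- \<omega> * t))"
proof -
  interpret mgt_kernel g \<gamma> M_g \<omega>_g
    by unfold_locales (fact assms)+
  obtain \<delta> where \<delta>: "\<delta> > 0" "\<delta> < \<alpha>" and ae: "AE s in lborel. 0 < s \<longrightarrow>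
      deriv g field_differentiable (at s) \<and> (\<alpha> - \<delta>) * deriv g s - deriv (deriv g) s \<le> 0"
    using \<open>kernel_g3 \<alpha> g\<close> unfolding kernel_g3_def by blast
  let ?\<kappa> = "LINT s:{0<..}|lborel. g s"
  have kernel: "memory_kernel (kernel_ext g) (kernel_slope g) (\<alpha> - \<delta>) ?\<kappa> M_g \<omega>_g"
    by (rule memory_kernel[OF ae]) (use \<delta> in simp)
  have \<kappa>: "?\<kappa> < \<gamma>" using \<open>kernel_g1 \<gamma> g\<close> by (simp add: kernel_g1_def)
  obtain l where l: "l > 0" "\<And>x. x \<in> op_dom A \<Longrightarrow> l * (norm x)\<^sup>2 \<le> inner (op_app A x) x"
    using \<open>strictly_positive A\<close> by (auto simp: strictly_positive_def)
  have "\<alpha> - \<delta> < \<alpha>" using \<delta> by simp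
  \<comment> \<open>Here \<rho> = \<alpha> - \<delta>, so the memory dissipates at rate \<delta>/2;
    1 / sqrt l is the constant in |x| <= c |A^(1/2) x|.\<close>
  from exponential_decay_mgt[OF assms(3-6) \<kappa> this kernel, of "1 / sqrt l", where ?'a = 'a and ?'b = 'a]
  obtain C \<eta> where C: "C \<ge> 1" "\<eta> > 0" and decay: "\<And>(u :: real \<Rightarrow> 'a) v w f (p :: real \<Rightarrow> 'a) q z t.
      mgt_solution (kernel_ext g) (kernel_slope g) (\<alpha> - \<delta>) ?\<kappa> M_g \<omega>_g \<alpha> \<beta> \<gamma> (1 / sqrt l) u v w f p q z \<Longrightarrow> t \<ge> 0 \<Longrightarrow>
      (norm (p t))\<^sup>2 + (norm (q t))\<^sup>2 + (norm (w t))\<^sup>2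
        + integral {0..t} (\<lambda>s. kernel_slope g s * (norm (p t - p (t - s)))\<^sup>2)
      \<le> C * ((norm (p 0))\<^sup>2 + (norm (q 0))\<^sup>2 + (norm (w 0))\<^sup>2) * exp (- \<eta> * t)"
    by blast
  show ?thesis
  proof (rule exI[of _ C], rule conjI[OF C(1)], rule exI[of _ \<eta>], rule conjI[OF C(2)], intro ballI allI impI)
    fix U0 u v w and t :: real
    assume "global_weak_solution A \<alpha> \<beta> \<gamma> g U0 u v w" and t: "t \<ge> 0"
    then interpret weak_mgt g \<gamma> M_g \<omega>_g A \<alpha> \<beta> l U0 u v w
      using \<open>selfadjoint A\<close> l by unfold_locales
    show "energy A g u v w t \<le> C * energy A g u v w 0 * exp (- \<eta> * t)"
      by (rule energy_decay[OF kernel decay[OF _ t] _ t]) (use C in auto)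
  qed
qed

end
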